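(* Let $\boldsymbol{\beta}=\{\beta_j\mid j\in \mathbb{N}\}$ be a sequence of positive real numbers with $\sum_{j=1}^\infty\beta_j^p<\infty$ for some $p\in (0,1]$. Define $\alpha=\lfloor 1/p\rfloor+1$ and let $b$ be a prime number. Then there exists a constant $C_{\alpha,\boldsymbol{\beta},b,p}<\infty$, depending only on $\alpha,\boldsymbol{\beta},b,p$ and in particular independent of $s$, such that the following holds. For every $s\in\mathbb{N}$, every $N=b^m$ with $m\in\mathbb{N}$, if $\{\boldsymbol{x}_0,\boldsymbol{x}_1,\dots,\boldsymbol{x}_{N-1}\}\subseteq [0,1]^s$ are the quadrature points of an interlaced polynomial lattice rule of order $\alpha$ constructed by the component-by-component (CBC) algorithm with respect to the weights $$\gamma_{v}=\gamma_{v,\alpha,\boldsymbol{\beta}}=\sum_{\boldsymbol{\nu}\in \{1,\dots,\alpha\}^{|v|}}|\boldsymbol{\nu}|!\prod_{j\in v} \beta_j^{\nu_j}\qquad(\emptyset\neq v\subseteq\{1,\dots,s\}),$$ then for every smooth integrand $F:[0,1]^s\to \mathbb{R}$ with $\Vert F\Vert_{s,\alpha,\boldsymbol{\beta}}\leq 1$, $$\left|\frac{1}{N}\sum_{n=0}^{N-1} F(\boldsymbol{x}_n)-\int_{[0,1]^s}F(\boldsymbol{x})\,\mathrm{d} \boldsymbol{x}\right|\leq C_{\alpha,\boldsymbol{\beta},b,p}\, N^{-1/p}.$$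
   Context: **Notation and norm.** $\mathbb{N}=\{1,2,3,\dots\}$. For a finite set $v\subseteq\mathbb{N}$, a multi-index $\boldsymbol{\nu}\in\{1,\dots,\alpha\}^{|v|}$ is indexed by the elements of $v$, $\boldsymbol{\nu}=(\nu_j)_{j\in v}$, and $|\boldsymbol{\nu}|=\sum_{j\in v}\nu_j$. Put $\gamma_{\boldsymbol{\nu},\boldsymbol{\beta}}=|\boldsymbol{\nu}|!\prod_{j\in v}\beta_j^{\nu_j}$ if $v\ne\emptyset$, and $\gamma_{\boldsymbol{\nu},\boldsymbol{\beta}}=1$ if $v=\emptyset$. For smooth $F:[0,1]^s\to\mathbb{R}$, $v\subseteq\{1,\dots,s\}$ and $\boldsymbol{\nu}\in\{1,\dots,\alpha\}^{|v|}$, let $$\partial^{\boldsymbol{\nu}}F(\boldsymbol{x})=\Big(\prod_{j\in v}\frac{\partial^{\nu_j}}{\partial x_j^{\nu_j}}\Big)F(\boldsymbol{x}),\qquad \Vert\partial^{\boldsymbol{\nu}}F\Vert_\infty=\sup_{\boldsymbol{x}\in[0,1]^s}|\partial^{\boldsymbol{\nu}}F(\boldsymbol{x})|$$ (for $v=\emptyset$, $\partial^{\boldsymbol{\nu}}F=F$). If all these suprema are finite, $$\Vert F\Vert_{s,\alpha,\boldsymbol{\beta}}=\sup_{v\subseteq\{1,\dots,s\}}\ \sup_{\boldsymbol{\nu}\in\{1,\dots,\alpha\}^{|v|}}\gamma_{\boldsymbol{\nu},\boldsymbol{\beta}}^{-1}\Vert\partial^{\boldsymbol{\nu}}F\Vert_\infty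 .$$ **Polynomial lattice point sets.** Let $b$ be prime, $m\in\mathbb{N}$, and let $\mathbb{Z}_b$ be the field with $b$ elements, identified with $\{0,\dots,b-1\}$. Fix an irreducible polynomial $P\in\mathbb{Z}_b[x]$ of degree $m$. For an integer $0\le n<b^m$ with base-$b$ expansion $n=\sum_{r=0}^{m-1}\eta_r b^r$, write $n(x)=\sum_{r=0}^{m-1}\eta_r x^r\in\mathbb{Z}_b[x]$. For a formal Laurent series over $\mathbb{Z}_b$ in $x^{-1}$ put $v_m\big(\sum_{l=w}^\infty \xi_l x^{-l}\big)=\sum_{l=\max(1,w)}^m \xi_l b^{-l}\in[0,1)$. For a generating vector $(q_1,\dots,q_d)$ of polynomials over $\mathbb{Z}_b$ of degree less than $m$, the polynomial lattice point set consists of the points $\boldsymbol{y}^{(n)}=(y^{(n)}_1,\dots,y^{(n)}_d)$, $0\le n<b^m$, with $y^{(n)}_j=v_m\big(n(x)q_j(x)/P(x)\big)$. **Interlacing of order $\alpha$.** For $y_1,\dots,y_\alpha\in[0,1)$ with finite base-$b$ expansions $y_i=\sum_{a\ge1}\xi_{i,a}b^{-a}$, set $\mathscr{D}_\alpha(y_1,\dots,y_\alpha)=\sum_{a=1}^\infty\sum_{i=1}^\alpha \xi_{i,a}b^{-i-(a-1)\alpha}$. The interlaced polynomial lattice rule of order $\alpha$ in dimension $s$ with generating vector $(q_1,\dots,q_{\alpha s})$ is the equal-weight quadrature rule with points $\boldsymbol{x}_n=(x_{n,1},\dots,x_{n,s})$, $0\le n<N=b^m$, where $x_{n,j}=\mathscr{D}_\alpha\big(y^{(n)}_{\alpha(j-1)+1},\dots,y^{(n)}_{\alpha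 j}\big)$. **CBC construction with respect to weights $(\gamma_v)$.** Here $\alpha\ge2$. Let $$C_{\alpha,b}=\max\Big(\frac{2}{(2\sin\frac{\pi}{b})^\alpha},\max_{1\le z\le\alpha-1}\frac{1}{(2\sin\frac{\pi}{b})^z}\Big)\Big(1+\frac1b+\frac1{b(b+1)}\Big)^{\alpha-2}\Big(3+\frac2b+\frac{2b+1}{b-1}\Big).$$ For nonempty $w\subseteq\{1,\dots,\alpha s\}$ let $u(w)=\{\lceil j/\alpha\rceil : j\in w\}\subseteq\{1,\dots,s\}$ and $\widetilde\gamma_w=\gamma_{u(w)}\big(C_{\alpha,b}\,b^{\alpha(\alpha-1)/2}\big)^{|u(w)|}$. For $y\in[0,1)$ let $$\omega(y)=\frac{b-1}{b^\alpha-b}-b^{(\alpha-1)\lfloor\log_b y\rfloor}\,\frac{b^\alpha-1}{b^\alpha-b}\ \ (y>0),\qquad \omega(0)=\frac{b-1}{b^\alpha-b}.$$ For $1\le d\le\alpha s$ define the figure of merit $$E_d(q_1,\dots,q_d)=\frac1{b^m}\sum_{n=0}^{b^m-1}\ \sum_{\emptyset\ne w\subseteq\{1,\dots,d\}}\widetilde\gamma_w\prod_{j\in w}\omega\big(y^{(n)}_j\big).$$ The CBC algorithm sets $q_1=1$ and then, successively for $d=2,\dots,\alpha s$ with $q_1,\dots,q_{d-1}$ fixed, chooses $q_d$ among the nonzero polynomials over $\mathbb{Z}_b$ of degree less than $m$ so as to minimize $E_d(q_1,\dots,q_d)$ (any minimizer may be taken). *)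

theory Defs
  imports
    "HOL-Analysis.Analysis"
    "HOL-Computational_Algebra.Formal_Laurent_Series"
    "Berlekamp_Zassenhaus.Finite_Field"
begin

section \<open>Smooth functions on the unit cube and the norm\<close>

text \<open>
  The dimension \<open>s\<close> varies inside the theorem, so points of the cube are functions on \<open>{1..s}\<close>
  (extensional, i.e. \<open>undefined\<close> elsewhere). Only the values of an integrand on the cube matter.
\<close>

definition unit_cube :: "nat \<Rightarrow> (nat \<Rightarrow> real) set" where
  "unit_cube s = (\<Pi>\<^sub>E j\<in>{1..s}. {0..1})"

text \<open>The derivative is taken within \<open>[0,1]\<close>, hence it is one-sided on the faces of the cube.\<close>

definition partial_deriv :: "nat \<Rightarrow> ((nat \<Rightarrow> real) \<Rightarrow> real) \<Rightarrow> (nat \<Rightarrow> real) \<Rightarrow> real" where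
  "partial_deriv j F x = vector_derivative (\<lambda>t. F (x(j := t))) (at (x j) within {0..1})"

primrec Ck_on_cube :: "nat \<Rightarrow> nat \<Rightarrow> ((nat \<Rightarrow> real) \<Rightarrow> real) \<Rightarrow> bool" where
  "Ck_on_cube s 0 F \<longleftrightarrow> continuous_on (unit_cube s) F"
| "Ck_on_cube s (Suc k) F \<longleftrightarrow> continuous_on (unit_cube s) F \<and>
     (\<forall>j\<in>{1..s}.
        (\<forall>x\<in>unit_cube s. (\<lambda>t. F (x(j := t))) differentiable (at (x j) within {0..1})) \<and>
        Ck_on_cube s k (partial_deriv j F))"

definition smooth_on_cube :: "nat \<Rightarrow> ((nat \<Rightarrow> real) \<Rightarrow> real) \<Rightarrow> bool" where
  "smooth_on_cube s F \<longleftrightarrow> (\<forall>k. Ck_on_cube s k F)"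

text \<open>
  The order in which the partial derivatives are applied (the smallest index is applied last) is
  immaterial for smooth functions.
\<close>

definition mixed_deriv ::
  "nat set \<Rightarrow> (nat \<Rightarrow> nat) \<Rightarrow> ((nat \<Rightarrow> real) \<Rightarrow> real) \<Rightarrow> (nat \<Rightarrow> real) \<Rightarrow> real" where
  "mixed_deriv v \<nu> F = foldr (\<lambda>j. partial_deriv j ^^ \<nu> j) (sorted_list_of_set v) F"

definition multi_indices :: "nat \<Rightarrow> nat set \<Rightarrow> (nat \<Rightarrow> nat) set" where
  "multi_indices \<alpha> v = (\<Pi>\<^sub>E j\<in>v. {1..\<alpha>})"

text \<open>For \<open>v = {}\<close> this is \<open>0! = 1\<close>.\<close>

definition gamma_coeff :: "(nat \<Rightarrow> real) \<Rightarrow> nat set \<Rightarrow> (nat \<Rightarrow> nat) \<Rightarrow> real" where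
  "gamma_coeff \<beta> v \<nu> = fact (\<Sum>j\<in>v. \<nu> j) * (\<Prod>j\<in>v. \<beta> j ^ \<nu> j)"

text \<open>The suprema are formed in the extended reals, where they always exist.\<close>

definition cube_norm ::
  "nat \<Rightarrow> nat \<Rightarrow> (nat \<Rightarrow> real) \<Rightarrow> ((nat \<Rightarrow> real) \<Rightarrow> real) \<Rightarrow> ereal" where
  "cube_norm s \<alpha> \<beta> F =
     (SUP v\<in>Pow {1..s}. SUP \<nu>\<in>multi_indices \<alpha> v.
        ereal (inverse (gamma_coeff \<beta> v \<nu>)) *
        (SUP x\<in>unit_cube s. ereal \<bar>mixed_deriv v \<nu> F x\<bar>))"

definition spod_weight :: "nat \<Rightarrow> (nat \<Rightarrow> real) \<Rightarrow> nat set \<Rightarrow> real" where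
  "spod_weight \<alpha> \<beta> v = (\<Sum>\<nu>\<in>multi_indices \<alpha> v. gamma_coeff \<beta> v \<nu>)"

definition cube_integral :: "nat \<Rightarrow> ((nat \<Rightarrow> real) \<Rightarrow> real) \<Rightarrow> real" where
  "cube_integral s F = (LINT x : unit_cube s | (\<Pi>\<^sub>M j\<in>{1..s}. lborel). F x)"

section \<open>Polynomial lattice point sets\<close>

text \<open>
  The field \<open>\<int>\<^sub>b\<close> is \<open>'b mod_ring\<close> with \<open>b = CARD('b)\<close> (prime, by the sort \<open>prime_card\<close>), and
  \<open>to_int_mod_ring\<close> identifies it with \<open>{0..b-1}\<close>. A Laurent series in \<open>x\<^sup>-\<^sup>1\<close> is an element of
  \<open>'b mod_ring fls\<close> whose formal variable stands for \<open>x\<^sup>-\<^sup>1\<close>; hence \<open>x\<close> is \<open>fls_X_inv\<close>.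
\<close>

definition laurent_of_poly :: "'b::prime_card mod_ring poly \<Rightarrow> 'b mod_ring fls" where
  "laurent_of_poly q = poly (map_poly fls_const q) fls_X_inv"

definition poly_of_index :: "nat \<Rightarrow> nat \<Rightarrow> 'b::prime_card mod_ring poly" where
  "poly_of_index m n = (\<Sum>r<m. Polynomial.monom (of_nat (n div CARD('b) ^ r mod CARD('b))) r)"

definition v_trunc :: "nat \<Rightarrow> 'b::prime_card mod_ring fls \<Rightarrow> real" where
  "v_trunc m L =
     (\<Sum>l=1..m. real_of_int (to_int_mod_ring (fls_nth L (int l))) / real CARD('b) ^ l)"

text \<open>\<open>lattice_coord m P n q\<close> is the coordinate of the \<open>n\<close>-th point belonging to the generator \<open>q\<close>.\<close>

definition lattice_coord ::
  "nat \<Rightarrow> 'b::prime_card mod_ring poly \<Rightarrow> nat \<Rightarrow> 'b mod_ring poly \<Rightarrow> real" where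
  "lattice_coord m P n q =
     v_trunc m (laurent_of_poly (poly_of_index m n * q) / laurent_of_poly P)"

section \<open>Interlacing\<close>

text \<open>
  The \<open>a\<close>-th digit after the point. For a number with a finite expansion this is the digit of the
  finite expansion.
\<close>

definition frac_digit :: "nat \<Rightarrow> real \<Rightarrow> nat \<Rightarrow> int" where
  "frac_digit b y a = \<lfloor>y * real b ^ a\<rfloor> mod int b"

text \<open>
  The summation index \<open>a\<close> is shifted to start at \<open>0\<close>, which turns the exponent
  \<open>i + (a - 1) * \<alpha>\<close> into \<open>i + a * \<alpha>\<close>.
\<close>

definition interlace :: "nat \<Rightarrow> nat \<Rightarrow> (nat \<Rightarrow> real) \<Rightarrow> real" where
  "interlace b \<alpha> y =
     (\<Sum>a. \<Sum>i=1..\<alpha>. real_of_int (frac_digit b (y i) (Suc a)) / real b ^ (i + a * \<alpha>))"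

definition interlaced_point ::
  "nat \<Rightarrow> nat \<Rightarrow> nat \<Rightarrow> 'b::prime_card mod_ring poly \<Rightarrow> (nat \<Rightarrow> 'b mod_ring poly) \<Rightarrow>
     nat \<Rightarrow> nat \<Rightarrow> real" where
  "interlaced_point \<alpha> s m P q n =
     (\<lambda>j\<in>{1..s}. interlace CARD('b) \<alpha> (\<lambda>i. lattice_coord m P n (q (\<alpha> * (j - 1) + i))))"

section \<open>Component-by-component construction\<close>

definition C_const :: "nat \<Rightarrow> nat \<Rightarrow> real" where
  "C_const \<alpha> b =
     max (2 / (2 * sin (pi / real b)) ^ \<alpha>)
         (Max ((\<lambda>z. 1 / (2 * sin (pi / real b)) ^ z) ` {1..\<alpha> - 1})) *
     (1 + 1 / real b + 1 / (real b * (real b + 1))) ^ (\<alpha> - 2) *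
     (3 + 2 / real b + (2 * real b + 1) / (real b - 1))"

definition block_set :: "nat \<Rightarrow> nat set \<Rightarrow> nat set" where
  "block_set \<alpha> w = (\<lambda>j. nat \<lceil>real j / real \<alpha>\<rceil>) ` w"

definition interlaced_weight :: "nat \<Rightarrow> nat \<Rightarrow> (nat set \<Rightarrow> real) \<Rightarrow> nat set \<Rightarrow> real" where
  "interlaced_weight b \<alpha> \<gamma> w =
     \<gamma> (block_set \<alpha> w) *
     (C_const \<alpha> b * real b ^ (\<alpha> * (\<alpha> - 1) div 2)) ^ card (block_set \<alpha> w)"

definition omega :: "nat \<Rightarrow> nat \<Rightarrow> real \<Rightarrow> real" where
  "omega b \<alpha> y =
     (if y = 0 then (real b - 1) / (real b ^ \<alpha> - real b)
      else (real b - 1) / (real b ^ \<alpha> - real b) -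
           real b powi ((int \<alpha> - 1) * \<lfloor>log (real b) y\<rfloor>) *
             ((real b ^ \<alpha> - 1) / (real b ^ \<alpha> - real b)))"

definition merit ::
  "nat \<Rightarrow> (nat set \<Rightarrow> real) \<Rightarrow> nat \<Rightarrow> 'b::prime_card mod_ring poly \<Rightarrow> nat \<Rightarrow>
     (nat \<Rightarrow> 'b mod_ring poly) \<Rightarrow> real" where
  "merit \<alpha> \<gamma> m P d q =
     1 / real (CARD('b) ^ m) *
     (\<Sum>n<CARD('b) ^ m. \<Sum>w\<in>Pow {1..d} - {{}}.
        interlaced_weight CARD('b) \<alpha> \<gamma> w *
        (\<Prod>j\<in>w. omega CARD('b) \<alpha> (lattice_coord m P n (q j))))"

definition cbc_constructed ::
  "nat \<Rightarrow> (nat set \<Rightarrow> real) \<Rightarrow> nat \<Rightarrow> nat \<Rightarrow> 'b::prime_card mod_ring poly \<Rightarrow>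
     (nat \<Rightarrow> 'b mod_ring poly) \<Rightarrow> bool" where
  "cbc_constructed \<alpha> \<gamma> s m P q \<longleftrightarrow>
     q 1 = 1 \<and>
     (\<forall>d\<in>{2..\<alpha> * s}. q d \<noteq> 0 \<and> Polynomial.degree (q d) < m \<and>
        (\<forall>r. r \<noteq> 0 \<and> Polynomial.degree r < m \<longrightarrow> merit \<alpha> \<gamma> m P d q \<le> merit \<alpha> \<gamma> m P d (q(d := r))))"

end

theory Submission
  imports Defs
begin

text \<open>
  The error of the rule is bounded by the figure of merit, and the figure of merit that the
  component-by-component construction reaches is \<open>O(N powr (-1/p))\<close> uniformly in the dimension.

  Discretization. The quadrature points, and all points of the grid with \<open>\<alpha> * L\<close> digits in each
  coordinate, are values of arrays of base-\<open>b\<close> digits, which form a finite abelian group. Fourier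
  inversion on this group (\<open>discrete_quadrature_error\<close>) turns the difference between the mean of \<open>F\<close>
  over the rule and its mean over the grid into a sum of Fourier coefficients over the nonzero
  frequencies that are trivial on the point set, the dual net (\<open>net_character_sum\<close>). The grid means
  converge to the integral as \<open>L\<close> grows (\<open>array_mean_approx\<close>), since the bounds on the first derivatives
  make \<open>F\<close> Lipschitz. Hence only finite Fourier sums occur, and no Walsh series of \<open>F\<close> has to converge.

  Decay. Summing \<open>F\<close> over one digit of value \<open>h\<close> against a nontrivial character is a combination of
  differences, so it gains the factor \<open>h\<close> at the price of one derivative. This is done for the leading
  nonzero digit of every component that is interlaced into a coordinate. The weights of the
  construction contain a fixed constant for each coordinate, and any larger constant would enter
  with the power \<open>card v\<close>, which is unbounded. A digit-by-digit estimate would lose a factor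
  that grows geometrically in \<open>\<alpha>\<close>; \<open>digit_sum_derivative_bound\<close> avoids the loss, because the sum over the
  finer digits depends on a coarser one, up to a small remainder, only through one derivative at a single
  point. Together with \<open>fine_const_le_C_const\<close> and an induction over the coordinates this gives
  \<open>fourier_coeff_bound\<close>.

  Figure of merit. The function \<open>omega\<close> is a character series whose coefficients are the decay factors
  just obtained, so the figure of merit is the limit of the sums of the bounds over the dual net
  (\<open>merit_trunc_tendsto\<close>); this yields \<open>quadrature_error_le_merit\<close>.

  Construction. Raising a sum over the dual net to the power \<open>p\<close> only increases it if the power is taken
  term by term. A minimizer is at least as good as the average over all generators, and since \<open>P\<close> is
  irreducible, a frequency whose last component does not vanish modulo \<open>b ^ m\<close> lies in the dual net for
  at most one generator. Therefore the \<open>p\<close>-th power of the figure of merit is at most \<open>4 / N\<close> times a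
  sum over all sets of components (\<open>cbc_merit_bound\<close>). Here \<open>\<alpha> * p > 1\<close> makes the series over the
  frequencies converge.

  Dimension. That sum stays bounded as \<open>s\<close> grows (\<open>interlaced_weights_powr_sum_bounded\<close>): the generating
  function of the weights without factorials is a product that grows more slowly than any exponential,
  because \<open>\<beta> j powr p\<close> is summable, and this compensates the factorials.
\<close>

section \<open>Additive characters of the digit field\<close>

text \<open>
  The standard character \<open>z \<mapsto> exp (2 \<pi> i z / b)\<close> of the additive group of the digit field.
\<close>

definition add_char :: "'b::prime_card mod_ring \<Rightarrow> complex" where
  "add_char z = cis (2 * pi * real_of_int (to_int_mod_ring z) / real CARD('b))"

lemma card_prime_gt_1: "CARD('b::prime_card) > 1"
  using prime_card[where 'a='b] prime_gt_1_nat by blast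

lemma to_int_mod_ring_range:
  "0 \<le> to_int_mod_ring (z :: 'b::prime_card mod_ring)" "to_int_mod_ring z < int CARD('b)"
  using range_to_int_mod_ring[where 'a='b] by fastforce+

lemma norm_add_char [simp]: "cmod (add_char z) = 1"
  by (simp add: add_char_def)

lemma add_char_0 [simp]: "add_char 0 = 1"
  by (simp add: add_char_def)

lemma add_char_add: "add_char (x + y) = add_char x * add_char (y :: 'b::prime_card mod_ring)"
proof -
  let ?b = "real CARD('b)"
  let ?k = "to_int_mod_ring x + to_int_mod_ring y"
  have b: "?b > 0" using card_prime_gt_1[where 'b='b] by simp
  have eq: "real_of_int (?k mod int CARD('b)) = real_of_int ?k - ?b * real_of_int (?k div int CARD('b))"
    by (metis minus_mult_div_eq_mod of_int_diff of_int_mult of_int_of_nat_eq)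
  have "add_char (x + y) = cis (2 * pi * real_of_int ?k / ?b - 2 * pi * real_of_int (?k div int CARD('b)))"
    unfolding add_char_def to_int_mod_ring_add eq using b
    by (intro arg_cong[where f=cis]) (simp add: field_simps)
  also have "\<dots> = cis (2 * pi * real_of_int ?k / ?b)"
    by (simp add: cis_divide [symmetric] del: cis_divide) 
  also have "\<dots> = add_char x * add_char y"
    by (simp add: add_char_def cis_mult add_divide_distrib distrib_left)
  finally show ?thesis .
qed

lemma add_char_sum: "add_char (\<Sum>i\<in>A. f i) = (\<Prod>i\<in>A. add_char (f i))"
  by (induction A rule: infinite_finite_induct) (auto simp: add_char_add)

lemma norm_one_minus_cis: "cmod (1 - cis t) = 2 * \<bar>sin (t / 2)\<bar>"
proof -
  have "(cmod (1 - cis t))\<^sup>2 = (1 - cos t)\<^sup>2 + (sin t)\<^sup>2"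
    by (simp add: cmod_power2)
  also have "\<dots> = 2 - 2 * cos t"
    using sin_cos_squared_add2[of t] by (simp add: power2_eq_square algebra_simps)
  also have "\<dots> = (2 * \<bar>sin (t / 2)\<bar>)\<^sup>2"
    using cos_double_sin[of "t/2"] by (simp add: power_mult_distrib)
  finally show ?thesis by (subst (asm) power2_eq_iff_nonneg) auto
qed

text \<open>
  The distance from \<open>1\<close> to the nearest other \<open>b\<close>-th root of unity.
\<close>

definition min_chord :: "nat \<Rightarrow> real" where
  "min_chord b = 2 * sin (pi / real b)"

lemma min_chord_pos: "b \<ge> 2 \<Longrightarrow> min_chord b > 0"
  unfolding min_chord_def by (intro mult_pos_pos sin_gt_zero) (auto simp: field_simps)

lemma min_chord_le_2: "min_chord b \<le> 2"
  by (simp add: min_chord_def)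

lemma min_chord_le:
  assumes "k \<noteq> (0 :: 'b::prime_card mod_ring)"
  shows "min_chord CARD('b) \<le> cmod (1 - add_char k)"
proof -
  let ?b = "CARD('b)"
  define n where "n = to_int_mod_ring k"
  have b: "?b > 1" by (rule card_prime_gt_1)
  have "n \<noteq> 0" using assms unfolding n_def by (metis to_int_mod_ring_hom.hom_0_iff)
  hence n: "1 \<le> n" "n \<le> int ?b - 1" using to_int_mod_ring_range[of k] unfolding n_def by linarith+
  define t where "t = pi * real_of_int n / real ?b"
  define u where "u = pi / real ?b"
  have "u \<le> t" unfolding t_def u_def using n b by (intro divide_right_mono) auto
  have nr: "real_of_int n \<le> real ?b - 1" using n(2) by linarith
  have "t \<le> pi - u"
  proof -
    have "pi * real_of_int n \<le> pi * (real ?b - 1)" using nr by (intro mult_left_mono) auto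
    hence "t \<le> pi * (real ?b - 1) / real ?b" unfolding t_def by (intro divide_right_mono) auto
    also have "\<dots> = pi - u" unfolding u_def using b by (simp add: field_simps)
    finally show ?thesis .
  qed
  have u0: "u > 0" using b by (simp add: u_def)
  have u2: "u \<le> pi / 2" unfolding u_def using b by (intro divide_left_mono) auto
  have "sin u \<le> sin t"
  proof (cases "t \<le> pi / 2")
    case True
    thus ?thesis using \<open>u \<le> t\<close> u0 by (intro sin_monotone_2pi_le) auto
  next
    case False
    have "sin u \<le> sin (pi - t)"
      using False \<open>t \<le> pi - u\<close> u0 by (intro sin_monotone_2pi_le) auto
    thus ?thesis by simp
  qed
  moreover have "cmod (1 - add_char k) = 2 * \<bar>sin t\<bar>"
    unfolding add_char_def norm_one_minus_cis t_def n_def by simp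
  ultimately show ?thesis unfolding min_chord_def u_def by linarith
qed

lemma add_char_ne_1:
  assumes "k \<noteq> (0 :: 'b::prime_card mod_ring)"
  shows "add_char k \<noteq> 1"
  using min_chord_le[OF assms] min_chord_pos[of "CARD('b)"] card_prime_gt_1[where 'b='b] by auto

text \<open>
  Summation by parts on the cyclic group: shifting the summation variable by one multiplies the
  character by \<open>add_char k\<close>. The boundary term appears as the difference across \<open>z = 0\<close>.
\<close>

lemma one_minus_add_char_sum:
  fixes g :: "'b::prime_card mod_ring \<Rightarrow> complex"
  shows "(1 - add_char k) * (\<Sum>z\<in>UNIV. add_char (k * z) * g z) = (\<Sum>z\<in>UNIV. add_char (k * z) * (g z - g (z - 1)))"
proof -
  have "(\<Sum>z\<in>UNIV. add_char (k * z) * g (z - 1)) = (\<Sum>z\<in>UNIV. add_char (k * (z + 1)) * g z)"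
    by (rule sum.reindex_bij_witness[where i="\<lambda>z. z + 1" and j="\<lambda>z. z - 1"]) auto
  also have "\<dots> = add_char k * (\<Sum>z\<in>UNIV. add_char (k * z) * g z)"
    by (simp add: sum_distrib_left distrib_left add_char_add mult_ac)
  finally show ?thesis by (simp add: algebra_simps sum_subtractf)
qed

lemma sum_add_char: "(\<Sum>z\<in>UNIV. add_char (k * z)) = (if k = 0 then of_nat CARD('b) else 0)"
  for k :: "'b::prime_card mod_ring"
  using one_minus_add_char_sum[of k "\<lambda>_. 1"] add_char_ne_1[of k] by auto

lemma to_int_mod_ring_diff_1:
  "to_int_mod_ring (z - 1) = (if z = 0 then int CARD('b) - 1 else to_int_mod_ring z - 1)"
  for z :: "'b::prime_card mod_ring"
proof -
  have b: "CARD('b) > 1" by (rule card_prime_gt_1)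
  have z: "0 \<le> to_int_mod_ring z" "to_int_mod_ring z < int CARD('b)"
    using to_int_mod_ring_range by blast+
  have *: "to_int_mod_ring (z - 1) = (to_int_mod_ring z - 1) mod int CARD('b)"
    using b by (transfer) (auto simp: mod_diff_eq)
  show ?thesis
  proof (cases "z = 0")
    case True
    thus ?thesis unfolding * using b by (simp add: zmod_minus1)
  next
    case False
    hence "to_int_mod_ring z \<noteq> 0" by (metis to_int_mod_ring_hom.hom_0_iff)
    hence "(to_int_mod_ring z - 1) mod int CARD('b) = to_int_mod_ring z - 1"
      using z by (intro mod_pos_pos_trivial) linarith+
    thus ?thesis unfolding * using False by simp
  qed
qed

lemma sum_to_int_add_char:
  assumes "k \<noteq> (0 :: 'b::prime_card mod_ring)"
  shows "(\<Sum>z\<in>UNIV. add_char (k * z) * of_int (to_int_mod_ring z)) = - of_nat CARD('b) / (1 - add_char k)"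
proof -
  have eq: "of_int (to_int_mod_ring z) - of_int (to_int_mod_ring (z - 1)) =
      (1 :: complex) - (if z = 0 then of_nat CARD('b) else 0)" for z :: "'b mod_ring"
    by (simp add: to_int_mod_ring_diff_1)
  have "(1 - add_char k) * (\<Sum>z\<in>UNIV. add_char (k * z) * of_int (to_int_mod_ring z)) =
      (\<Sum>z\<in>UNIV. add_char (k * z) * (1 - (if z = 0 then of_nat CARD('b) else 0)))"
    unfolding one_minus_add_char_sum eq ..
  also have "\<dots> = (\<Sum>z\<in>UNIV. add_char (k * z)) - (\<Sum>z\<in>(UNIV :: 'b mod_ring set). (if z = 0 then of_nat CARD('b) else 0))"
    by (subst sum_subtractf [symmetric], intro sum.cong) (auto simp: algebra_simps)
  also have "\<dots> = - of_nat CARD('b)" using assms by (simp add: sum_add_char)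
  finally show ?thesis using add_char_ne_1[OF assms] by (simp add: field_simps)
qed

text \<open>
  The cyclic differences of a Lipschitz function consist of \<open>b - 1\<close> steps of length one and a single
  jump back of length \<open>b - 1\<close>, so their total size is at most \<open>2 * b * B\<close>.
\<close>

lemma norm_sum_add_char_Lipschitz:
  fixes g :: "'b::prime_card mod_ring \<Rightarrow> complex"
  assumes k: "k \<noteq> 0" and B: "B \<ge> 0"
    and g: "\<And>y z. cmod (g y - g z) \<le> B * \<bar>of_int (to_int_mod_ring y) - of_int (to_int_mod_ring z)\<bar>"
  shows "cmod (\<Sum>z\<in>UNIV. add_char (k * z) * g z) \<le> 2 * real CARD('b) * B / min_chord CARD('b)"
proof -
  let ?b = "CARD('b)"
  have b: "?b > 1" by (rule card_prime_gt_1)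
  have m: "min_chord ?b > 0" using b by (intro min_chord_pos) auto
  have "cmod (1 - add_char k) * cmod (\<Sum>z\<in>UNIV. add_char (k * z) * g z) =
      cmod (\<Sum>z\<in>UNIV. add_char (k * z) * (g z - g (z - 1)))"
    by (simp add: norm_mult [symmetric] one_minus_add_char_sum)
  also have "\<dots> \<le> (\<Sum>z\<in>UNIV. cmod (g z - g (z - 1)))"
    by (rule order_trans[OF norm_sum]) (simp add: norm_mult)
  also have "\<dots> \<le> (\<Sum>z\<in>(UNIV :: 'b mod_ring set). B * (1 + (if z = 0 then real ?b else 0)))"
  proof (rule sum_mono)
    fix z :: "'b mod_ring"
    have "\<bar>real_of_int (to_int_mod_ring z) - real_of_int (to_int_mod_ring (z - 1))\<bar>
        \<le> 1 + (if z = 0 then real ?b else 0)"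
      using b by (auto simp: to_int_mod_ring_diff_1)
    thus "cmod (g z - g (z - 1)) \<le> B * (1 + (if z = 0 then real ?b else 0))"
      using g[of z "z - 1"] B by (meson mult_left_mono order_trans)
  qed
  also have "\<dots> = 2 * real ?b * B"
    by (simp add: sum_distrib_left [symmetric] sum.distrib CARD_mod_ring)
  finally have *: "cmod (1 - add_char k) * cmod (\<Sum>z\<in>UNIV. add_char (k * z) * g z) \<le> 2 * real ?b * B" .
  have "min_chord ?b * cmod (\<Sum>z\<in>UNIV. add_char (k * z) * g z) \<le> 2 * real ?b * B"
    by (rule order_trans[OF mult_right_mono *]) (auto intro: min_chord_le[OF k])
  thus ?thesis using m by (simp add: field_simps)
qed

section \<open>Summation of a function over digits against characters\<close>

text \<open>
  A digit is a pair of its value \<open>h\<close> (a power of \<open>1 / b\<close>) and the frequency \<open>k\<close> against which it is summed.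
  The mean runs over all combinations of the digits, the first one of the list being the outermost.
\<close>

primrec digit_sum :: "(real \<times> 'b::prime_card mod_ring) list \<Rightarrow> (real \<Rightarrow> complex) \<Rightarrow> real \<Rightarrow> complex" where
  "digit_sum [] f x = f x"
| "digit_sum (d # ds) f x =
     (\<Sum>z\<in>UNIV. add_char (snd d * z) * digit_sum ds f (x + of_int (to_int_mod_ring z) * fst d)) / of_nat CARD('b)"

text \<open>
  The largest displacement that the digits of the list can produce.
\<close>

definition span_of :: "(real \<times> 'b::prime_card mod_ring) list \<Rightarrow> real" where
  "span_of ds = (\<Sum>d\<leftarrow>ds. real (CARD('b) - 1) * fst d)"

lemma span_of_simps [simp]:
  "span_of ([] :: (real \<times> 'b::prime_card mod_ring) list) = 0"
  "span_of (d # ds) = real (CARD('b) - 1) * fst d + span_of (ds :: (real \<times> 'b::prime_card mod_ring) list)"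
  by (simp_all add: span_of_def)

lemma span_of_nonneg: "\<forall>d\<in>set ds. fst d \<ge> 0 \<Longrightarrow> span_of ds \<ge> 0"
  by (induction ds) auto

lemma digit_step_bounds:
  assumes "h \<ge> 0"
  shows "0 \<le> of_int (to_int_mod_ring (z :: 'b::prime_card mod_ring)) * h"
    "of_int (to_int_mod_ring z) * h \<le> real (CARD('b) - 1) * h"
proof -
  have z: "0 \<le> to_int_mod_ring z" "to_int_mod_ring z \<le> int (CARD('b) - 1)"
    using to_int_mod_ring_range[of z] by linarith+
  show "0 \<le> of_int (to_int_mod_ring z) * h" using z assms by simp
  have "real_of_int (to_int_mod_ring z) \<le> real (CARD('b) - 1)" using z(2) by linarith
  thus "of_int (to_int_mod_ring z) * h \<le> real (CARD('b) - 1) * h"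
    using assms by (intro mult_right_mono)
qed

lemma digit_sum_bound:
  assumes "\<And>t. t \<in> {x..x + span_of ds} \<Longrightarrow> cmod (f t) \<le> B" and "\<forall>d\<in>set ds. fst d \<ge> 0"
  shows "cmod (digit_sum ds f x) \<le> B"
  using assms
proof (induction ds arbitrary: x)
  case Nil
  thus ?case by simp
next
  case (Cons d ds)
  have h: "fst d \<ge> 0" using Cons.prems by simp
  have "cmod (digit_sum ds f (x + of_int (to_int_mod_ring z) * fst d)) \<le> B" for z :: "'a mod_ring"
    using digit_step_bounds[OF h, of z] Cons.prems(2) by (intro Cons.IH Cons.prems(1)) auto
  hence "cmod (\<Sum>z\<in>UNIV. add_char (snd d * z) * digit_sum ds f (x + of_int (to_int_mod_ring z) * fst d))
      \<le> (\<Sum>z\<in>(UNIV :: 'a mod_ring set). B)"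
    by (intro order_trans[OF norm_sum] sum_mono) (simp add: norm_mult)
  thus ?case using card_prime_gt_1[where 'b='a] by (simp add: norm_divide CARD_mod_ring field_simps)
qed

lemma digit_sum_diff_scale:
  "digit_sum ds (\<lambda>t. f t - c * g t) x = digit_sum ds f x - c * digit_sum ds g x"
proof (induction ds arbitrary: x)
  case (Cons d ds)
  show ?case unfolding digit_sum.simps Cons
    by (simp add: sum_subtractf sum_distrib_left diff_divide_distrib algebra_simps)
qed simp

lemma digit_sum_append: "digit_sum (ds @ es) f = digit_sum ds (digit_sum es f)"
  by (induction ds) (auto simp: fun_eq_iff)

lemma digit_sum_has_vector_derivative:
  assumes "\<And>x. (f has_vector_derivative f' x) (at x)"
  shows "(digit_sum ds f has_vector_derivative digit_sum ds f' x) (at x)"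
proof (induction ds arbitrary: x)
  case Nil
  have "digit_sum ([] :: (real \<times> 'a mod_ring) list) f = f" by (simp add: fun_eq_iff)
  thus ?case using assms by simp
next
  case (Cons d ds)
  have "((\<lambda>x. digit_sum ds f (x + c)) has_vector_derivative digit_sum ds f' (x + c)) (at x)" for c
  proof -
    have 1: "((\<lambda>x. x + c) has_vector_derivative 1) (at x)"
      by (auto intro!: derivative_eq_intros)
    show ?thesis using vector_diff_chain_at[OF 1 Cons.IH] by (simp add: o_def)
  qed
  thus ?case unfolding digit_sum.simps
    by (auto intro!: derivative_intros simp: fun_eq_iff)
qed

text \<open>
  The value of the digit sum at the monomial of degree \<open>length ds\<close>, divided by the factorial of the degree.
\<close>

definition digit_lead :: "(real \<times> 'b::prime_card mod_ring) list \<Rightarrow> complex" where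
  "digit_lead ds = (\<Prod>d\<leftarrow>ds. - of_real (fst d) / (1 - add_char (snd d)))"

lemma has_vector_derivative_monomial:
  "((\<lambda>t. complex_of_real t ^ Suc k / fact (Suc k)) has_vector_derivative (of_real t ^ k / fact k)) (at t within S)"
proof -
  have "((\<lambda>t. t ^ Suc k / fact (Suc k)) has_real_derivative (t ^ k / fact k)) (at t within S)"
  proof -
    have "((\<lambda>t. t ^ Suc k / fact (Suc k)) has_real_derivative (real (Suc k) * t ^ k / fact (Suc k))) (at t within S)"
      using DERIV_cdivide[OF DERIV_pow[of "Suc k" t S], of "fact (Suc k)"] by simp
    also have "real (Suc k) * t ^ k / fact (Suc k) = t ^ k / fact k"
      unfolding fact_Suc by (simp del: of_nat_Suc)
    finally show ?thesis .
  qed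
  from has_vector_derivative_of_real[OF this, where 'a=complex] show ?thesis
    by (simp only: of_real_divide of_real_power of_real_fact)
qed

text \<open>
  In the expansion of the power of a sum of digit values only the term that contains every digit once
  survives, all others being independent of some digit. The proof reaches this through derivatives:
  a digit sum of the monomial of one degree more has constant derivative, so it is affine in the base
  point, and the outer digit sees only its slope.
\<close>

lemma digit_sum_monomial:
  assumes "\<forall>d\<in>set ds. snd d \<noteq> 0"
  shows "digit_sum ds (\<lambda>t. of_real t ^ length ds / fact (length ds)) x = digit_lead ds"
  using assms
proof (induction ds arbitrary: x)
  case Nil
  thus ?case by (simp add: digit_lead_def)
next
  case (Cons d ds)
  define r where "r = length ds"
  define G where "G = digit_sum ds (\<lambda>t. complex_of_real t ^ Suc r / fact (Suc r))"
  define c where "c = digit_lead ds"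
  define b where "b = (of_nat CARD('a) :: complex)"
  have b0: "b \<noteq> 0" using card_prime_gt_1[where 'b='a] by (simp add: b_def)
  have k: "snd d \<noteq> 0" using Cons.prems by simp
  have "(G has_vector_derivative c) (at x)" for x
    unfolding G_def c_def r_def
    using digit_sum_has_vector_derivative[OF has_vector_derivative_monomial, of ds "length ds" x] Cons by simp
  hence "((\<lambda>x. G x - of_real x * c) has_vector_derivative 0) (at x within UNIV)" for x
    by (auto intro!: derivative_eq_intros)
  then obtain e where "\<And>x. x \<in> UNIV \<Longrightarrow> G x - of_real x * c = e"
    by (rule has_vector_derivative_zero_constant[OF convex_UNIV]) blast
  hence G: "G x = e + of_real x * c" for x by (metis UNIV_I diff_add_cancel)
  have "digit_sum (d # ds) (\<lambda>t. of_real t ^ length (d # ds) / fact (length (d # ds))) x =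
      (\<Sum>z\<in>UNIV. add_char (snd d * z) * G (x + of_int (to_int_mod_ring z) * fst d)) / b"
    by (simp add: G_def r_def b_def)
  also have "(\<Sum>z\<in>UNIV. add_char (snd d * z) * G (x + of_int (to_int_mod_ring z) * fst d)) =
      (e + of_real x * c) * (\<Sum>z\<in>UNIV. add_char (snd d * z)) +
      c * of_real (fst d) * (\<Sum>z\<in>UNIV. add_char (snd d * z) * of_int (to_int_mod_ring z))"
    unfolding G sum_distrib_left sum.distrib [symmetric]
    by (intro sum.cong) (auto simp: algebra_simps)
  also have "\<dots> / b = digit_lead (d # ds)"
    using k b0 by (simp add: sum_add_char sum_to_int_add_char c_def digit_lead_def b_def[symmetric])
  finally show ?case .
qed

text \<open>
  The growth of the bound when a coarser digit is put in front of \<open>r\<close> finer ones. The factor is an affine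
  recursion, not a product, and stays bounded for \<open>q < 1\<close>.
\<close>

primrec fine_const :: "real \<Rightarrow> nat \<Rightarrow> real" where
  "fine_const q 0 = 1"
| "fine_const q (Suc r) = 2 + q * fine_const q r"

text \<open>
  The digits are listed from coarse to fine, and all the finer ones together move the argument by at most
  one step of the current digit.
\<close>

primrec refining :: "(real \<times> 'b::prime_card mod_ring) list \<Rightarrow> bool" where
  "refining [] \<longleftrightarrow> True"
| "refining (d # ds) \<longleftrightarrow> fst d > 0 \<and> snd d \<noteq> 0 \<and> span_of ds \<le> fst d \<and> refining ds"

lemma refining_pos: "refining ds \<Longrightarrow> \<forall>d\<in>set ds. fst d > 0 \<and> snd d \<noteq> 0"
  by (induction ds) auto

text \<open>
  The functions \<open>f 0, \<dots>, f r\<close> are successive derivatives of each other on \<open>S\<close>, one-sided at the end points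
  of an interval.
\<close>

definition deriv_chain :: "real set \<Rightarrow> nat \<Rightarrow> (nat \<Rightarrow> real \<Rightarrow> complex) \<Rightarrow> bool" where
  "deriv_chain S r f \<longleftrightarrow> (\<forall>i<r. \<forall>t\<in>S. (f i has_vector_derivative f (Suc i) t) (at t within S))"

lemma norm_digit_lead_le:
  "\<forall>d\<in>set ds. fst d > 0 \<and> snd d \<noteq> 0 \<Longrightarrow>
   cmod (digit_lead (ds :: (real \<times> 'b::prime_card mod_ring) list)) \<le> (\<Prod>d\<leftarrow>ds. fst d / min_chord CARD('b))"
proof (induction ds)
  case Nil
  thus ?case by (simp add: digit_lead_def)
next
  case (Cons d ds)
  have m: "min_chord CARD('b) > 0" using card_prime_gt_1[where 'b='b] by (intro min_chord_pos) auto
  have le: "min_chord CARD('b) \<le> cmod (1 - add_char (snd d))"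
    using Cons.prems by (intro min_chord_le) auto
  hence "cmod (1 - add_char (snd d)) > 0" using m by linarith
  hence "fst d / cmod (1 - add_char (snd d)) \<le> fst d / min_chord CARD('b)"
    using Cons.prems m le by (intro divide_left_mono mult_pos_pos) auto
  hence "fst d / cmod (1 - add_char (snd d)) * cmod (digit_lead ds) \<le>
      fst d / min_chord CARD('b) * (\<Prod>d\<leftarrow>ds. fst d / min_chord CARD('b))"
    using Cons m by (intro mult_mono) auto
  thus ?case using Cons.prems by (simp add: digit_lead_def norm_mult norm_divide)
qed

text \<open>
  Induction from the finest digit upwards. For a fixed value of the coarsest digit, the sum over the finer
  ones equals \<open>digit_lead ds\<close> times the \<open>r\<close>-th derivative at the middle of the range that they sweep, up to a
  remainder: after subtraction of the monomial with this \<open>r\<close>-th derivative, the remaining \<open>r\<close>-th derivative is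
  at most \<open>B * h / 2\<close> on that range. The main term is a Lipschitz function of the coarsest digit, which
  contributes the summand \<open>2\<close> of the recursion, and the remainder contributes \<open>q\<close> times the previous bound.
\<close>

lemma digit_sum_derivative_bound:
  fixes ds :: "(real \<times> 'b::prime_card mod_ring) list"
  assumes "refining ds" and "deriv_chain {lo..hi} (length ds) f"
    and "\<And>t. t \<in> {lo..hi} \<Longrightarrow> cmod (f (length ds) t) \<le> B"
    and "lo \<le> x" and "x + span_of ds \<le> hi"
  shows "cmod (digit_sum ds (f 0) x) \<le>
    fine_const (min_chord CARD('b) / 2) (length ds) * (\<Prod>d\<leftarrow>ds. fst d / min_chord CARD('b)) * B"
  using assms
proof (induction ds arbitrary: f B lo hi x)
  case Nil
  thus ?case by simp
next
  case (Cons d ds)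
  define r where "r = length ds"
  define h where "h = fst d"
  define k where "k = snd d"
  define m where "m = min_chord CARD('b)"
  define A where "A = (\<Prod>d\<leftarrow>ds. fst d / m)"
  define K where "K = fine_const (m / 2) r"
  define sp where "sp = span_of ds"
  define n where "n = (\<lambda>z :: 'b mod_ring. real_of_int (to_int_mod_ring z))"
  have b1: "CARD('b) > 1" by (rule card_prime_gt_1)
  have m: "m > 0" unfolding m_def using b1 by (intro min_chord_pos) auto
  from Cons.prems have h: "h > 0" and k: "k \<noteq> 0" and sph: "sp \<le> h" and ref: "refining ds"
    by (auto simp: h_def k_def sp_def)
  have pos: "\<forall>d\<in>set ds. fst d > 0 \<and> snd d \<noteq> 0" using ref by (rule refining_pos)
  have sp0: "sp \<ge> 0" unfolding sp_def using pos by (intro span_of_nonneg) auto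
  have A0: "A \<ge> 0" unfolding A_def using pos m by (intro prod_list_nonneg) auto
  have xhi: "x + real (CARD('b) - 1) * h + sp \<le> hi" using Cons.prems by (simp add: h_def sp_def)
  have lox: "lo \<le> x" by fact
  have nb: "0 \<le> n z * h" "n z * h \<le> real (CARD('b) - 1) * h" for z
    unfolding n_def using digit_step_bounds[of h z] h by auto
  have B0: "B \<ge> 0"
  proof -
    have "x \<in> {lo..hi}" using lox xhi sp0 nb[of 0] by auto
    thus ?thesis using Cons.prems(3)[of x] norm_ge_zero order_trans by blast
  qed
  have chain: "(f i has_vector_derivative f (Suc i) t) (at t within {lo..hi})" if "i \<le> r" "t \<in> {lo..hi}" for i t
    using Cons.prems(2) that by (auto simp: deriv_chain_def r_def)
  have Lip: "cmod (f r s - f r t) \<le> B * \<bar>s - t\<bar>" if "s \<in> {lo..hi}" "t \<in> {lo..hi}" for s t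
  proof -
    have "norm (f r s - f r t) \<le> B * norm (s - t)"
    proof (rule differentiable_bound[where S = "{lo..hi}"])
      show "(f r has_derivative (\<lambda>h. h *\<^sub>R f (Suc r) y)) (at y within {lo..hi})" if "y \<in> {lo..hi}" for y
        using chain[of r y] that by (simp add: has_vector_derivative_def)
      show "onorm (\<lambda>h. h *\<^sub>R f (Suc r) y) \<le> B" if "y \<in> {lo..hi}" for y
        using Cons.prems(3)[OF that] B0
        by (intro onorm_le) (simp add: r_def mult.commute[of B] mult_left_mono)
    qed (use that in auto)
    thus ?thesis by simp
  qed
  define y where "y = (\<lambda>z :: 'b mod_ring. x + n z * h)"
  \<comment> \<open>The middle of the range swept by the finer digits; no point of it is farther away than \<open>h / 2\<close>.\<close>
  define mid where "mid = (\<lambda>z. y z + sp / 2)"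
  have ylo: "lo \<le> y z" "y z + sp \<le> hi" for z
    using nb[of z] lox xhi by (auto simp: y_def)
  have midS: "mid z \<in> {lo..hi}" for z using ylo[of z] sp0 by (auto simp: mid_def)
  define R where "R = (\<lambda>z. digit_sum ds (f 0) (y z) - f r (mid z) * digit_lead ds)"
  have R: "cmod (R z) \<le> K * A * (B * h / 2)" for z
  proof -
    define g where "g = (\<lambda>i t. f i t - f r (mid z) * (complex_of_real t ^ (r - i) / fact (r - i)))"
    have "deriv_chain {y z..y z + sp} r g"
      unfolding deriv_chain_def
    proof (intro allI impI ballI)
      fix i t assume i: "i < r" and t: "t \<in> {y z..y z + sp}"
      have Suc: "r - i = Suc (r - Suc i)" using i by simp
      have "(f i has_vector_derivative f (Suc i) t) (at t within {y z..y z + sp})"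
        by (rule has_vector_derivative_within_subset[OF chain]) (use i t ylo[of z] in auto)
      thus "(g i has_vector_derivative g (Suc i) t) (at t within {y z..y z + sp})"
        unfolding g_def Suc
        by (intro has_vector_derivative_diff has_vector_derivative_mult_right has_vector_derivative_monomial)
    qed
    moreover have "cmod (g r t) \<le> B * h / 2" if t: "t \<in> {y z..y z + sp}" for t
    proof -
      have mid: "\<bar>t - mid z\<bar> \<le> h / 2"
        using t sph unfolding mid_def abs_le_iff atLeastAtMost_iff by linarith
      have "cmod (g r t) = cmod (f r t - f r (mid z))" by (simp add: g_def)
      also have "\<dots> \<le> B * \<bar>t - mid z\<bar>" using t ylo[of z] midS[of z] by (intro Lip) auto
      also have "\<dots> \<le> B * (h / 2)" using mid B0 by (rule mult_left_mono)
      finally show ?thesis by simp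
    qed
    ultimately have "cmod (digit_sum ds (g 0) (y z)) \<le> K * A * (B * h / 2)"
      unfolding K_def A_def r_def m_def
      by (intro Cons.IH[OF ref, where lo = "y z" and hi = "y z + sp"]) (auto simp: sp_def)
    also have "digit_sum ds (g 0) (y z) = R z"
      unfolding g_def R_def digit_sum_diff_scale using digit_sum_monomial[of ds "y z"] pos
      by (simp add: r_def)
    finally show ?thesis .
  qed
  have "cmod (\<Sum>z\<in>UNIV. add_char (k * z) * f r (mid z)) \<le> 2 * real CARD('b) * (B * h) / m"
    unfolding m_def
  proof (rule norm_sum_add_char_Lipschitz[OF k])
    show "cmod (f r (mid u) - f r (mid v)) \<le>
        B * h * \<bar>of_int (to_int_mod_ring u) - of_int (to_int_mod_ring v)\<bar>" for u v :: "'b mod_ring"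
    proof -
      have "\<bar>mid u - mid v\<bar> = \<bar>(n u - n v) * h\<bar>" by (simp add: mid_def y_def algebra_simps)
      also have "\<dots> = \<bar>n u - n v\<bar> * h" using h by (simp add: abs_mult)
      finally show ?thesis using Lip[OF midS midS, of u v] by (simp add: n_def mult_ac)
    qed
  qed (use B0 h in auto)
  hence 1: "cmod (digit_lead ds * (\<Sum>z\<in>UNIV. add_char (k * z) * f r (mid z))) \<le> A * (2 * real CARD('b) * (B * h) / m)"
    unfolding norm_mult using norm_digit_lead_le[OF pos] A0 by (intro mult_mono) (auto simp: A_def m_def)
  have 2: "cmod (\<Sum>z\<in>UNIV. add_char (k * z) * R z) \<le> real CARD('b) * (K * A * (B * h / 2))"
  proof -
    have "cmod (\<Sum>z\<in>UNIV. add_char (k * z) * R z) \<le> (\<Sum>z\<in>(UNIV :: 'b mod_ring set). K * A * (B * h / 2))"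
      using R by (intro order_trans[OF norm_sum] sum_mono) (simp add: norm_mult)
    thus ?thesis by (simp add: CARD_mod_ring)
  qed
  have "of_nat CARD('b) * digit_sum (d # ds) (f 0) x = (\<Sum>z\<in>UNIV. add_char (k * z) * digit_sum ds (f 0) (y z))"
    using b1 by (simp add: k_def y_def h_def n_def)
  also have "\<dots> = digit_lead ds * (\<Sum>z\<in>UNIV. add_char (k * z) * f r (mid z)) + (\<Sum>z\<in>UNIV. add_char (k * z) * R z)"
    unfolding sum_distrib_left sum.distrib [symmetric] by (intro sum.cong) (auto simp: R_def algebra_simps)
  finally have "real CARD('b) * cmod (digit_sum (d # ds) (f 0) x) =
      cmod (digit_lead ds * (\<Sum>z\<in>UNIV. add_char (k * z) * f r (mid z)) + (\<Sum>z\<in>UNIV. add_char (k * z) * R z))"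
    by (metis norm_mult norm_of_nat)
  also have "\<dots> \<le> A * (2 * real CARD('b) * (B * h) / m) + real CARD('b) * (K * A * (B * h / 2))"
    by (rule order_trans[OF norm_triangle_ineq add_mono[OF 1 2]])
  also have "\<dots> = real CARD('b) * ((2 + m / 2 * K) * (h / m * A) * B)"
    using m by (simp add: field_simps)
  finally have "cmod (digit_sum (d # ds) (f 0) x) \<le> (2 + m / 2 * K) * (h / m * A) * B"
    using b1 by (subst (asm) mult_le_cancel_left_pos) auto
  thus ?case by (simp add: K_def A_def m_def h_def r_def)
qed

section \<open>Comparison with the constant of the weights\<close>

lemma fine_const_nonneg: "0 \<le> q \<Longrightarrow> 0 \<le> fine_const q r"
  by (induction r) auto

lemma fine_const_le_linear: "0 \<le> q \<Longrightarrow> q \<le> 1 \<Longrightarrow> fine_const q r \<le> 2 * real r + 1"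
proof (induction r)
  case (Suc r)
  have "q * fine_const q r \<le> 1 * fine_const q r"
    using Suc by (intro mult_right_mono fine_const_nonneg) auto
  thus ?case using Suc by auto
qed auto

lemma fine_const_le_geometric: "0 \<le> q \<Longrightarrow> q < 1 \<Longrightarrow> fine_const q r \<le> 2 / (1 - q)"
proof (induction r)
  case 0
  thus ?case by (simp add: field_simps)
next
  case (Suc r)
  have "q * fine_const q r \<le> q * (2 / (1 - q))"
    using Suc by (intro mult_left_mono) auto
  also have "\<dots> = 2 / (1 - q) - 2" using Suc.prems by (simp add: field_simps)
  finally show ?case by simp
qed

text \<open>
  For \<open>b \<in> {2, 3}\<close> the linear bound on \<open>fine_const\<close> is beaten by the geometric growth of the right-hand side;
  for larger primes the geometric series bound is below the last factor alone.
\<close>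

lemma fine_const_le_growth:
  assumes "prime b" and "2 \<le> \<alpha>" and "r \<le> \<alpha>"
  shows "fine_const (min_chord b / 2) r \<le>
     (1 + 1 / real b + 1 / (real b * (real b + 1))) ^ (\<alpha> - 2) *
     (3 + 2 / real b + (2 * real b + 1) / (real b - 1))" (is "?E \<le> ?c ^ _ * ?D")
proof -
  define n where "n = \<alpha> - 2"
  define q where "q = min_chord b / 2"
  have b2: "b \<ge> 2" using assms prime_ge_2_nat by blast
  have q: "0 \<le> q" "q \<le> 1"
    using min_chord_pos[OF b2] min_chord_le_2[of b] by (auto simp: q_def)
  have c1: "1 + 1 / real b \<le> ?c" by simp
  show ?thesis
  proof (cases "b \<le> 3")
    case True
    hence b: "b = 2 \<or> b = 3" using b2 by linarith
    have "1 + real n * (1/3) \<le> (1 + 1/3) ^ n" by (rule Bernoulli_inequality) simp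
    also have "(1 + 1/3 :: real) ^ n \<le> ?c ^ n"
      using b by (intro power_mono) auto
    finally have c: "1 + real n / 3 \<le> ?c ^ n" by simp
    have D: "7 \<le> ?D" using b by auto
    have "?E \<le> 2 * real r + 1" using fine_const_le_linear q by (simp add: q_def)
    also have "\<dots> \<le> (1 + real n / 3) * 7" using assms by (simp add: n_def field_simps)
    also have "\<dots> \<le> ?c ^ n * ?D" using c D by (intro mult_mono) auto
    finally show ?thesis by (simp add: n_def)
  next
    case False
    hence b5: "b \<ge> 5" using assms(1) b2 
      by (cases "b = 4") auto
    have D: "q < 1 \<and> 2 / (1 - q) \<le> ?D"
    proof (cases "b = 5")
      case True
      \<comment> \<open>The bound \<open>sin x \<le> x\<close> with \<open>pi < 4\<close> is too coarse here; it suffices for the small increment \<open>pi / 30\<close>.\<close>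
      have "q = sin (pi / 6 + pi / 30)" using True by (simp add: q_def min_chord_def)
      also have "\<dots> = 1 / 2 * cos (pi / 30) + cos (pi / 6) * sin (pi / 30)"
        by (subst sin_add) (simp add: sin_30)
      also have "\<dots> \<le> 1 / 2 + 1 * (pi / 30)"
        by (intro add_mono mult_mono sin_x_le_x sin_ge_zero) auto
      also have "\<dots> \<le> 19 / 30" using pi_less_4 by simp
      finally have q': "q \<le> 19 / 30" .
      hence "2 / (1 - q) \<le> 2 / (11 / 30)" by (intro divide_left_mono) auto
      also have "\<dots> \<le> ?D" using True by simp
      finally show ?thesis using q' by simp
    next
      case False
      hence b7: "b \<ge> 7" using b5 assms(1) by (cases "b = 6") auto
      have "q \<le> pi / real b" using b5 by (simp add: q_def min_chord_def sin_x_le_x)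
      also have "\<dots> \<le> 4 / 7" using pi_less_4 b7 by (intro frac_le) auto
      finally have q': "q \<le> 4 / 7" .
      hence "2 / (1 - q) \<le> 2 / (3 / 7)" by (intro divide_left_mono) auto
      also have "\<dots> \<le> 5" by simp
      also have "\<dots> \<le> 3 + 2 / real b + (2 * real b - 2) / (real b - 1)"
      proof -
        have "(2 * real b - 2) / (real b - 1) = 2" using b5 by (simp add: field_simps)
        thus ?thesis by simp
      qed
      also have "\<dots> \<le> ?D" using b5 by (intro add_mono divide_right_mono) auto
      finally show ?thesis using q' by simp
    qed
    have "?E \<le> 2 / (1 - q)" using fine_const_le_geometric q D by (simp add: q_def)
    also have "\<dots> \<le> 1 * ?D" using D by simp
    also have "\<dots> \<le> ?c ^ n * ?D"
      using b5 by (intro mult_right_mono one_le_power) auto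
    finally show ?thesis by (simp add: n_def)
  qed
qed

text \<open>
  The constant of the weights majorizes the constant of the digit sums for every number of derivatives
  that can occur.
\<close>

lemma fine_const_le_C_const:
  assumes "prime b" and "2 \<le> \<alpha>" and "1 \<le> r" and "r \<le> \<alpha>"
  shows "fine_const (min_chord b / 2) r / min_chord b ^ r \<le> C_const \<alpha> b"
proof -
  define m where "m = min_chord b"
  have b2: "b \<ge> 2" using assms prime_ge_2_nat by blast
  have m: "m > 0" unfolding m_def using b2 by (rule min_chord_pos)
  define X where "X = max (2 / m ^ \<alpha>) (Max ((\<lambda>z. 1 / m ^ z) ` {1..\<alpha> - 1}))"
  have X: "1 / m ^ r \<le> X"
  proof (cases "r = \<alpha>")
    case True
    have "1 / m ^ r \<le> 2 / m ^ \<alpha>" using m True by (simp add: divide_right_mono)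
    thus ?thesis by (simp add: X_def)
  next
    case False
    hence "1 / m ^ r \<le> Max ((\<lambda>z. 1 / m ^ z) ` {1..\<alpha> - 1})"
      using assms by (intro Max_ge) auto
    thus ?thesis by (simp add: X_def)
  qed
  have "fine_const (m / 2) r / m ^ r = 1 / m ^ r * fine_const (m / 2) r" by simp
  also have "\<dots> \<le> X * fine_const (m / 2) r"
    using m by (intro mult_right_mono X fine_const_nonneg) auto
  also have "\<dots> \<le> X * ((1 + 1 / real b + 1 / (real b * (real b + 1))) ^ (\<alpha> - 2) *
     (3 + 2 / real b + (2 * real b + 1) / (real b - 1)))"
  proof (intro mult_left_mono)
    have "0 \<le> 1 / m ^ r" using m by simp
    thus "X \<ge> 0" using X by linarith
  qed (use fine_const_le_growth[OF assms(1,2,4)] in \<open>simp add: m_def\<close>)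
  also have "\<dots> = C_const \<alpha> b"
    by (simp add: C_const_def X_def m_def min_chord_def mult.assoc)
  finally show ?thesis by (simp add: m_def)
qed

lemma C_const_nonneg:
  assumes "prime b" and "2 \<le> \<alpha>"
  shows "0 \<le> C_const \<alpha> b"
proof -
  have "min_chord b > 0" using assms prime_ge_2_nat by (intro min_chord_pos) auto
  hence "0 \<le> fine_const (min_chord b / 2) 1 / min_chord b ^ 1"
    by (intro divide_nonneg_nonneg fine_const_nonneg) auto
  also have "\<dots> \<le> C_const \<alpha> b" using assms by (intro fine_const_le_C_const) auto
  finally show ?thesis .
qed

section \<open>From one coordinate to the cube\<close>

lemma sum_PiE_insert:
  assumes "x \<notin> S"
  shows "(\<Sum>f\<in>Pi\<^sub>E (insert x S) T. g f) = (\<Sum>y\<in>T x. \<Sum>f\<in>Pi\<^sub>E S T. g (f(x := y)))"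
proof -
  have "(\<Sum>f\<in>Pi\<^sub>E (insert x S) T. g f) = (\<Sum>(y, f)\<in>T x \<times> Pi\<^sub>E S T. g (f(x := y)))"
    unfolding PiE_insert_eq by (subst sum.reindex[OF inj_combinator[OF assms]]) (simp add: case_prod_unfold)
  thus ?thesis by (simp add: sum.cartesian_product)
qed

text \<open>
  The order of summation over the digits is free. It will be used to put the digits that are not
  exploited outside and the exploited ones, sorted by size, inside.
\<close>

lemma sum_digits_eq_digit_sum:
  fixes k :: "'p \<Rightarrow> 'b::prime_card mod_ring"
  assumes "distinct ts"
  shows "(\<Sum>\<xi>\<in>(\<Pi>\<^sub>E t\<in>set ts. UNIV). (\<Prod>t\<in>set ts. add_char (k t * \<xi> t)) *
      f (x + (\<Sum>t\<in>set ts. of_int (to_int_mod_ring (\<xi> t)) * h t))) =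
     of_nat CARD('b) ^ length ts * digit_sum (map (\<lambda>t. (h t, k t)) ts) f x"
  using assms
proof (induction ts arbitrary: x)
  case Nil
  thus ?case by simp
next
  case (Cons t ts)
  have t: "t \<notin> set ts" using Cons.prems by simp
  have b0: "(of_nat CARD('b) :: complex) \<noteq> 0" using card_prime_gt_1[where 'b='b] by simp
  define G where "G = (\<lambda>\<xi>. (\<Prod>u\<in>set ts. add_char (k u * \<xi> u)))"
  have "(\<Sum>\<xi>\<in>(\<Pi>\<^sub>E t\<in>set (t # ts). UNIV). (\<Prod>t\<in>set (t # ts). add_char (k t * \<xi> t)) *
      f (x + (\<Sum>t\<in>set (t # ts). of_int (to_int_mod_ring (\<xi> t)) * h t))) =
    (\<Sum>z\<in>UNIV. \<Sum>\<xi>\<in>(\<Pi>\<^sub>E t\<in>set ts. UNIV). add_char (k t * z) * (G \<xi> *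
      f (x + of_int (to_int_mod_ring z) * h t + (\<Sum>t\<in>set ts. of_int (to_int_mod_ring (\<xi> t)) * h t))))"
    unfolding list.set sum_PiE_insert[OF t]
  proof (intro sum.cong refl)
    fix z \<xi>
    have "(\<Prod>u\<in>insert t (set ts). add_char (k u * (\<xi>(t := z)) u)) = add_char (k t * z) * G \<xi>"
      using t by (simp add: G_def) (intro disjI2 prod.cong; auto)
    moreover have "(\<Sum>u\<in>insert t (set ts). of_int (to_int_mod_ring ((\<xi>(t := z)) u)) * h u) =
        of_int (to_int_mod_ring z) * h t + (\<Sum>t\<in>set ts. of_int (to_int_mod_ring (\<xi> t)) * h t)"
      using t by (simp, intro sum.cong) auto
    ultimately show "(\<Prod>u\<in>insert t (set ts). add_char (k u * (\<xi>(t := z)) u)) *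
        f (x + (\<Sum>u\<in>insert t (set ts). of_int (to_int_mod_ring ((\<xi>(t := z)) u)) * h u)) =
      add_char (k t * z) * (G \<xi> *
        f (x + of_int (to_int_mod_ring z) * h t + (\<Sum>t\<in>set ts. of_int (to_int_mod_ring (\<xi> t)) * h t)))"
      by (simp add: algebra_simps)
  qed
  also have "\<dots> = (\<Sum>z\<in>UNIV. add_char (k t * z) * (of_nat CARD('b) ^ length ts *
      digit_sum (map (\<lambda>t. (h t, k t)) ts) f (x + of_int (to_int_mod_ring z) * h t)))"
    using Cons by (simp add: sum_distrib_left [symmetric] G_def)
  also have "\<dots> = of_nat CARD('b) ^ length (t # ts) * digit_sum (map (\<lambda>t. (h t, k t)) (t # ts)) f x"
  proof -
    have "(\<Sum>z\<in>UNIV. add_char (k t * z) * (of_nat CARD('b) ^ length ts * D z)) =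
        of_nat CARD('b) ^ length ts * (\<Sum>z\<in>UNIV. add_char (k t * z) * D z)" for D :: "'b mod_ring \<Rightarrow> complex"
      by (simp add: sum_distrib_left mult_ac)
    thus ?thesis using b0 by simp
  qed
  finally show ?case .
qed

lemma span_of_append: "span_of (ds @ es) = span_of ds + span_of es"
  by (simp add: span_of_def)

lemma span_of_map:
  fixes k :: "'p \<Rightarrow> 'b::prime_card mod_ring"
  shows "distinct ts \<Longrightarrow> span_of (map (\<lambda>t. (h t, k t)) ts) = real (CARD('b) - 1) * (\<Sum>t\<in>set ts. h t)"
  by (induction ts) (auto simp: algebra_simps)

text \<open>
  Digits outside \<open>rs\<close> are averaged with absolute values, which costs nothing; only those in \<open>rs\<close> consume a
  derivative each.
\<close>

lemma coordinate_digit_sum_bound: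
  fixes k :: "'p \<Rightarrow> 'b::prime_card mod_ring"
  assumes "finite T" and h: "\<And>t. t \<in> T \<Longrightarrow> h t > 0"
    and span: "real (CARD('b) - 1) * (\<Sum>t\<in>T. h t) \<le> 1"
    and rs: "distinct rs" "set rs \<subseteq> T" "refining (map (\<lambda>t. (h t, k t)) rs)"
    and f: "deriv_chain {0..1} (length rs) f" "\<And>t. t \<in> {0..1} \<Longrightarrow> cmod (f (length rs) t) \<le> B"
  shows "cmod (\<Sum>\<xi>\<in>(\<Pi>\<^sub>E t\<in>T. UNIV). (\<Prod>t\<in>T. add_char (k t * \<xi> t)) *
      f 0 (\<Sum>t\<in>T. of_int (to_int_mod_ring (\<xi> t)) * h t)) \<le>
     real CARD('b) ^ card T *
     (fine_const (min_chord CARD('b) / 2) (length rs) * (\<Prod>t\<in>set rs. h t / min_chord CARD('b))) * B"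
proof -
  obtain us where us: "set us = T - set rs" "distinct us"
    using finite_distinct_list[of "T - set rs"] \<open>finite T\<close> by auto
  define ts where "ts = us @ rs"
  have ts: "distinct ts" "set ts = T" using us rs by (auto simp: ts_def)
  define ds where "ds = (\<lambda>ts. map (\<lambda>t. (h t, k t)) ts)"
  define C where "C = fine_const (min_chord CARD('b) / 2) (length rs) * (\<Prod>t\<in>set rs. h t / min_chord CARD('b)) * B"
  have sp: "span_of (ds us) + span_of (ds rs) \<le> 1"
    using span ts unfolding ds_def span_of_append [symmetric] map_append [symmetric] ts_def
    by (subst span_of_map) (auto simp: ts_def)
  have sp0: "span_of (ds rs) \<ge> 0" unfolding ds_def using h rs(2) by (intro span_of_nonneg) (auto intro!: less_imp_le)
  have "cmod (digit_sum (ds us) (digit_sum (ds rs) (f 0)) 0) \<le> C"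
  proof (rule digit_sum_bound)
    fix t assume t: "t \<in> {0..0 + span_of (ds us)}"
    have "cmod (digit_sum (ds rs) (f 0) t) \<le> fine_const (min_chord CARD('b) / 2) (length (ds rs)) *
        (\<Prod>d\<leftarrow>ds rs. fst d / min_chord CARD('b)) * B"
      using t sp f rs(3) by (intro digit_sum_derivative_bound[where lo=0 and hi=1]) (auto simp: ds_def)
    also have "(\<Prod>d\<leftarrow>ds rs. fst d / min_chord CARD('b)) = (\<Prod>t\<in>set rs. h t / min_chord CARD('b))"
      using rs(1) by (simp add: ds_def prod.distinct_set_conv_list o_def)
    finally show "cmod (digit_sum (ds rs) (f 0) t) \<le> C" by (simp add: C_def ds_def)
  qed (use h us in \<open>auto simp: ds_def intro: less_imp_le\<close>)
  hence "cmod (digit_sum (ds ts) (f 0) 0) \<le> C" by (simp add: ds_def ts_def digit_sum_append)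
  moreover have "length ts = card T" using ts distinct_card by metis
  ultimately show ?thesis
    using sum_digits_eq_digit_sum[OF ts(1), of k "f 0" 0 h] ts(2)
    by (simp add: norm_mult norm_power C_def ds_def mult.assoc mult_left_mono)
qed

lemma smooth_on_cube_partial_deriv:
  assumes "smooth_on_cube s F" and "j \<in> {1..s}"
  shows "smooth_on_cube s (partial_deriv j F)"
  unfolding smooth_on_cube_def
proof
  fix k
  have "Ck_on_cube s (Suc k) F" using assms(1) unfolding smooth_on_cube_def by blast
  thus "Ck_on_cube s k (partial_deriv j F)" using assms(2) by simp
qed

lemma smooth_on_cube_funpow_partial_deriv:
  "smooth_on_cube s F \<Longrightarrow> j \<in> {1..s} \<Longrightarrow> smooth_on_cube s ((partial_deriv j ^^ i) F)"
  by (induction i) (auto intro: smooth_on_cube_partial_deriv)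

lemma smooth_on_cube_has_partial_deriv:
  assumes "smooth_on_cube s F" and "j \<in> {1..s}" and "x \<in> unit_cube s"
  shows "((\<lambda>t. F (x(j := t))) has_vector_derivative partial_deriv j F x) (at (x j) within {0..1})"
proof -
  have "Ck_on_cube s (Suc 0) F" using assms(1) unfolding smooth_on_cube_def by blast
  hence "(\<lambda>t. F (x(j := t))) differentiable (at (x j) within {0..1})"
    using assms(2,3) by simp
  thus ?thesis by (simp add: partial_deriv_def vector_derivative_works)
qed

lemma unit_cube_upd: "x \<in> unit_cube s \<Longrightarrow> j \<in> {1..s} \<Longrightarrow> t \<in> {0..1} \<Longrightarrow> x(j := t) \<in> unit_cube s"
  unfolding unit_cube_def by (auto simp: PiE_iff extensional_def)

text \<open>
  If each of the functionals \<open>f \<mapsto> (\<Sum>i\<in>I j. c j i * f (g j i))\<close> in one variable is bounded by \<open>A j\<close> times the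
  supremum of the derivative of order \<open>\<nu> j\<close>, then their tensor product is bounded by the product of the \<open>A j\<close>
  times the supremum of the mixed derivative. In the induction the functional of the last coordinate is
  outermost: the inner sum is a smooth function of that coordinate whose derivatives are the inner sums of
  partial derivatives of \<open>F\<close>, and so the derivative in the last coordinate is applied to \<open>F\<close> first. This
  is the order in which \<open>mixed_deriv\<close> applies its derivatives.
\<close>

lemma tensor_functional_bound:
  fixes I :: "nat \<Rightarrow> 'i set" and c :: "nat \<Rightarrow> 'i \<Rightarrow> complex" and g :: "nat \<Rightarrow> 'i \<Rightarrow> real"
  assumes g: "\<And>j i. j \<in> {1..s} \<Longrightarrow> i \<in> I j \<Longrightarrow> g j i \<in> {0..1}"
    and bound: "\<And>j f B. j \<in> {1..s} \<Longrightarrow> deriv_chain {0..1} (\<nu> j) f \<Longrightarrow>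
        (\<And>t. t \<in> {0..1} \<Longrightarrow> cmod (f (\<nu> j) t) \<le> B) \<Longrightarrow>
        cmod (\<Sum>i\<in>I j. c j i * f 0 (g j i)) \<le> A j * B"
    and A: "\<And>j. j \<in> {1..s} \<Longrightarrow> A j \<ge> 0"
    and "n \<le> s" and "smooth_on_cube s F"
    and "\<And>x. x \<in> unit_cube s \<Longrightarrow> \<bar>foldr (\<lambda>j. partial_deriv j ^^ \<nu> j) [1..<Suc n] F x\<bar> \<le> K"
    and "x \<in> unit_cube s"
  shows "cmod (\<Sum>\<xi>\<in>Pi\<^sub>E {1..n} I. (\<Prod>j\<in>{1..n}. c j (\<xi> j)) *
      of_real (F (\<lambda>j. if j \<in> {1..n} then g j (\<xi> j) else x j))) \<le> (\<Prod>j\<in>{1..n}. A j) * K"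
  using assms(4-)
proof (induction n arbitrary: F x)
  case 0
  thus ?case by simp
next
  case (Suc n)
  define N where "N = Suc n"
  have N: "N \<in> {1..s}" "N \<notin> {1..n}" using Suc.prems by (auto simp: N_def)
  have ins: "{1..Suc n} = insert N {1..n}" by (auto simp: N_def)
  define pt where "pt = (\<lambda>(\<xi> :: nat \<Rightarrow> 'i) t. (\<lambda>j. if j \<in> {1..n} then g j (\<xi> j) else (x(N := t)) j))"
  define f where "f = (\<lambda>i t. \<Sum>\<xi>\<in>Pi\<^sub>E {1..n} I. (\<Prod>j\<in>{1..n}. c j (\<xi> j)) *
      complex_of_real (((partial_deriv N ^^ i) F) (pt \<xi> t)))"
  have pt_cube: "pt \<xi> t \<in> unit_cube s" if "\<xi> \<in> Pi\<^sub>E {1..n} I" "t \<in> {0..1}" for \<xi> t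
    using that Suc.prems(1,4) g unfolding pt_def unit_cube_def N_def
    by (auto simp: PiE_iff extensional_def Pi_iff)
  have pt_upd: "(pt \<xi> t)(N := u) = pt \<xi> u" for \<xi> t u
    using N by (auto simp: pt_def fun_eq_iff)
  have pt_N: "pt \<xi> t N = t" for \<xi> t using N by (simp add: pt_def)
  have chain: "deriv_chain {0..1} (\<nu> N) f"
    unfolding deriv_chain_def
  proof (intro allI impI ballI)
    fix i t assume t: "t \<in> {0..1::real}"
    have "((\<lambda>t. complex_of_real (((partial_deriv N ^^ i) F) (pt \<xi> t))) has_vector_derivative
        of_real (((partial_deriv N ^^ Suc i) F) (pt \<xi> t))) (at t within {0..1})"
      if "\<xi> \<in> Pi\<^sub>E {1..n} I" for \<xi>
    proof (intro has_vector_derivative_of_real)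
      have "smooth_on_cube s ((partial_deriv N ^^ i) F)"
        using Suc.prems(2) N by (intro smooth_on_cube_funpow_partial_deriv)
      from smooth_on_cube_has_partial_deriv[OF this N(1) pt_cube[OF that t]]
      show "((\<lambda>t. ((partial_deriv N ^^ i) F) (pt \<xi> t)) has_real_derivative
          ((partial_deriv N ^^ Suc i) F) (pt \<xi> t)) (at t within {0..1})"
        by (simp add: pt_upd pt_N has_real_derivative_iff_has_vector_derivative)
    qed
    thus "(f i has_vector_derivative f (Suc i) t) (at t within {0..1})"
      unfolding f_def by (intro has_vector_derivative_sum has_vector_derivative_mult_right)
  qed
  have "cmod (f (\<nu> N) t) \<le> (\<Prod>j\<in>{1..n}. A j) * K" if "t \<in> {0..1}" for t
    unfolding f_def pt_def
  proof (rule Suc.IH[where x = "x(N := t)"])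
    show "x(N := t) \<in> unit_cube s" using Suc.prems(4) N that by (intro unit_cube_upd)
    show "\<bar>foldr (\<lambda>j. partial_deriv j ^^ \<nu> j) [1..<Suc n] ((partial_deriv N ^^ \<nu> N) F) y\<bar> \<le> K"
      if "y \<in> unit_cube s" for y
      using Suc.prems(3)[OF that] by (simp add: N_def)
  qed (use Suc.prems N smooth_on_cube_funpow_partial_deriv in auto)
  hence main: "cmod (\<Sum>i\<in>I N. c N i * f 0 (g N i)) \<le> A N * ((\<Prod>j\<in>{1..n}. A j) * K)"
    by (intro bound N(1) chain)
  have eq: "(\<Sum>\<xi>\<in>Pi\<^sub>E {1..Suc n} I. (\<Prod>j\<in>{1..Suc n}. c j (\<xi> j)) *
      of_real (F (\<lambda>j. if j \<in> {1..Suc n} then g j (\<xi> j) else x j))) = (\<Sum>i\<in>I N. c N i * f 0 (g N i))"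
    unfolding ins sum_PiE_insert[OF N(2)] f_def sum_distrib_left
  proof (intro sum.cong refl)
    fix i \<xi>
    have "(\<Prod>j\<in>insert N {1..n}. c j ((\<xi>(N := i)) j)) = c N i * (\<Prod>j\<in>{1..n}. c j (\<xi> j))"
      using N by (subst prod.insert) (auto intro!: prod.cong)
    moreover have "(\<lambda>j. if j \<in> insert N {1..n} then g j ((\<xi>(N := i)) j) else x j) = pt \<xi> (g N i)"
      using N by (auto simp: pt_def fun_eq_iff)
    ultimately show "(\<Prod>j\<in>insert N {1..n}. c j ((\<xi>(N := i)) j)) *
        complex_of_real (F (\<lambda>j. if j \<in> insert N {1..n} then g j ((\<xi>(N := i)) j) else x j)) =
      c N i * ((\<Prod>j\<in>{1..n}. c j (\<xi> j)) * complex_of_real ((partial_deriv N ^^ 0) F (pt \<xi> (g N i))))"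
      by simp
  qed
  have "(\<Prod>j\<in>{1..Suc n}. A j) = A N * (\<Prod>j\<in>{1..n}. A j)"
    unfolding ins using N by simp
  thus ?case unfolding eq using main by (simp only: mult.assoc)
qed

text \<open>
  Derivatives of order zero are the identity, so coordinates that are not differentiated can be dropped.
\<close>

lemma foldr_partial_deriv_eq_mixed_deriv:
  assumes "v = {j \<in> {1..s}. \<nu> j \<noteq> 0}" and "\<And>j. j \<in> v \<Longrightarrow> \<mu> j = \<nu> j"
  shows "foldr (\<lambda>j. partial_deriv j ^^ \<nu> j) [1..<Suc s] F = mixed_deriv v \<mu> F"
proof -
  have *: "foldr (\<lambda>j. partial_deriv j ^^ \<nu> j) xs F =
      foldr (\<lambda>j. partial_deriv j ^^ \<nu> j) (filter (\<lambda>j. \<nu> j \<noteq> 0) xs) F" for xs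
    by (induction xs) auto
  have "sorted (filter (\<lambda>j. \<nu> j \<noteq> 0) [1..<Suc s])"
    by (rule sorted_wrt_filter) (rule sorted_upt)
  hence 1: "sorted_list_of_set v = filter (\<lambda>j. \<nu> j \<noteq> 0) [1..<Suc s]"
    by (intro sorted_distinct_set_unique) (auto simp: assms(1))
  have 2: "foldr (\<lambda>j. partial_deriv j ^^ \<nu> j) xs F = foldr (\<lambda>j. partial_deriv j ^^ \<mu> j) xs F"
    if "set xs \<subseteq> v" for xs
    using that assms(2) by (induction xs) auto
  have 3: "set (sorted_list_of_set v) \<subseteq> v"
    by (simp add: assms(1))
  show ?thesis
    unfolding mixed_deriv_def * [of "[1..<Suc s]"] 1 [symmetric] by (rule 2[OF 3])
qed

lemma gamma_coeff_pos: "\<forall>j\<ge>1. \<beta> j > 0 \<Longrightarrow> v \<subseteq> {1..s} \<Longrightarrow> gamma_coeff \<beta> v \<nu> > 0"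
  unfolding gamma_coeff_def by (intro mult_pos_pos prod_pos ballI zero_less_power) auto

lemma cube_norm_le_1_mixed_deriv_bound:
  assumes "cube_norm s \<alpha> \<beta> F \<le> 1" and "\<forall>j\<ge>1. \<beta> j > 0"
    and v: "v \<subseteq> {1..s}" and \<nu>: "\<nu> \<in> multi_indices \<alpha> v" and x: "x \<in> unit_cube s"
  shows "\<bar>mixed_deriv v \<nu> F x\<bar> \<le> gamma_coeff \<beta> v \<nu>"
proof -
  have \<gamma>: "gamma_coeff \<beta> v \<nu> > 0" using assms by (intro gamma_coeff_pos)
  have "ereal (inverse (gamma_coeff \<beta> v \<nu>)) * ereal \<bar>mixed_deriv v \<nu> F x\<bar> \<le>
      ereal (inverse (gamma_coeff \<beta> v \<nu>)) * (SUP x\<in>unit_cube s. ereal \<bar>mixed_deriv v \<nu> F x\<bar>)"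
    using \<gamma> x by (intro ereal_mult_left_mono SUP_upper) auto
  also have "\<dots> \<le> (SUP \<nu>\<in>multi_indices \<alpha> v. ereal (inverse (gamma_coeff \<beta> v \<nu>)) *
        (SUP x\<in>unit_cube s. ereal \<bar>mixed_deriv v \<nu> F x\<bar>))"
    using \<nu> by (intro SUP_upper)
  also have "\<dots> \<le> cube_norm s \<alpha> \<beta> F"
    unfolding cube_norm_def using v by (intro SUP_upper) auto
  also have "\<dots> \<le> 1" by fact
  finally show ?thesis using \<gamma> by (simp add: field_simps)
qed

section \<open>Fourier analysis on digit arrays\<close>

abbreviation digit_arrays :: "'i set \<Rightarrow> 'p set \<Rightarrow> ('i \<Rightarrow> 'p \<Rightarrow> 'b mod_ring) set" where
  "digit_arrays S Q \<equiv> (\<Pi>\<^sub>E j\<in>S. \<Pi>\<^sub>E t\<in>Q. UNIV)"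

text \<open>
  The Walsh function of frequency \<open>\<kappa>\<close> on the group of digit arrays.
\<close>

definition wal :: "'i set \<Rightarrow> 'p set \<Rightarrow> ('i \<Rightarrow> 'p \<Rightarrow> 'b::prime_card mod_ring) \<Rightarrow>
    ('i \<Rightarrow> 'p \<Rightarrow> 'b mod_ring) \<Rightarrow> complex" where
  "wal S Q \<kappa> \<xi> = (\<Prod>j\<in>S. \<Prod>t\<in>Q. add_char (\<kappa> j t * \<xi> j t))"

definition zero_array :: "'i set \<Rightarrow> 'p set \<Rightarrow> 'i \<Rightarrow> 'p \<Rightarrow> 'b::prime_card mod_ring" where
  "zero_array S Q = (\<lambda>j\<in>S. \<lambda>t\<in>Q. 0)"

lemma zero_array_in: "zero_array S Q \<in> digit_arrays S Q"
  by (auto simp: zero_array_def)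

lemma digit_arrays_eqI:
  assumes "\<xi> \<in> digit_arrays S Q" "\<eta> \<in> digit_arrays S Q" "\<And>j t. j \<in> S \<Longrightarrow> t \<in> Q \<Longrightarrow> \<xi> j t = \<eta> j t"
  shows "\<xi> = \<eta>"
proof (rule PiE_ext[OF assms(1,2)])
  fix j assume "j \<in> S"
  thus "\<xi> j = \<eta> j" using assms by (intro PiE_ext[of "\<xi> j" Q "\<lambda>_. UNIV"]) auto
qed

lemma finite_digit_arrays [simp]:
  "finite S \<Longrightarrow> finite Q \<Longrightarrow> finite (digit_arrays S Q :: ('i \<Rightarrow> 'p \<Rightarrow> 'b::prime_card mod_ring) set)"
  by (intro finite_PiE) auto

lemma wal_zero_array [simp]: "wal S Q (zero_array S Q) \<xi> = 1"
  by (simp add: wal_def zero_array_def)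

lemma sum_wal:
  fixes \<xi> :: "'i \<Rightarrow> 'p \<Rightarrow> 'b::prime_card mod_ring"
  assumes "finite S" "finite Q"
  shows "(\<Sum>\<kappa>\<in>digit_arrays S Q. wal S Q \<kappa> \<xi>) =
    (if \<forall>j\<in>S. \<forall>t\<in>Q. \<xi> j t = 0 then of_nat CARD('b) ^ (card S * card Q) else 0)"
proof -
  have "(\<Sum>\<kappa>\<in>digit_arrays S Q. wal S Q \<kappa> \<xi>) =
      (\<Prod>j\<in>S. \<Sum>k\<in>(\<Pi>\<^sub>E t\<in>Q. UNIV). \<Prod>t\<in>Q. add_char (k t * \<xi> j t))"
    unfolding wal_def using assms by (intro prod_sum_PiE[symmetric] finite_PiE) auto
  also have "\<dots> = (\<Prod>j\<in>S. \<Prod>t\<in>Q. \<Sum>z\<in>UNIV. add_char (z * \<xi> j t))"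
    using assms by (intro prod.cong refl prod_sum_PiE[symmetric]) auto
  also have "\<dots> = (\<Prod>j\<in>S. \<Prod>t\<in>Q. if \<xi> j t = 0 then of_nat CARD('b) else 0)"
    by (subst mult.commute) (simp only: sum_add_char)
  also have "\<dots> = (if \<forall>j\<in>S. \<forall>t\<in>Q. \<xi> j t = 0 then of_nat CARD('b) ^ (card S * card Q) else 0)"
  proof (cases "\<forall>j\<in>S. \<forall>t\<in>Q. \<xi> j t = 0")
    case True
    thus ?thesis by (simp add: power_mult [symmetric] mult.commute)
  next
    case False
    then obtain j t where "j \<in> S" "t \<in> Q" "\<xi> j t \<noteq> 0" by blast
    hence "(\<Prod>t\<in>Q. if \<xi> j t = 0 then of_nat CARD('b) else 0) = (0 :: complex)"
      using assms by (intro prod_zero) auto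
    thus ?thesis using False \<open>j \<in> S\<close> assms by (auto intro!: prod_zero)
  qed
  finally show ?thesis .
qed

definition fourier_coeff :: "'i set \<Rightarrow> 'p set \<Rightarrow> (('i \<Rightarrow> 'p \<Rightarrow> 'b::prime_card mod_ring) \<Rightarrow> complex) \<Rightarrow>
    ('i \<Rightarrow> 'p \<Rightarrow> 'b mod_ring) \<Rightarrow> complex" where
  "fourier_coeff S Q \<Phi> \<kappa> =
     (\<Sum>\<xi>\<in>digit_arrays S Q. (\<Prod>j\<in>S. \<Prod>t\<in>Q. add_char (- \<kappa> j t * \<xi> j t)) * \<Phi> \<xi>) / of_nat CARD('b) ^ (card S * card Q)"

lemma fourier_inversion:
  fixes \<Phi> :: "('i \<Rightarrow> 'p \<Rightarrow> 'b::prime_card mod_ring) \<Rightarrow> complex"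
  assumes "finite S" "finite Q" and \<eta>: "\<eta> \<in> digit_arrays S Q"
  shows "\<Phi> \<eta> = (\<Sum>\<kappa>\<in>digit_arrays S Q. fourier_coeff S Q \<Phi> \<kappa> * wal S Q \<kappa> \<eta>)"
proof -
  define c where "c = (of_nat CARD('b) ^ (card S * card Q) :: complex)"
  have c: "c \<noteq> 0" using card_prime_gt_1[where 'b='b] by (simp add: c_def)
  have "(\<Sum>\<kappa>\<in>digit_arrays S Q. fourier_coeff S Q \<Phi> \<kappa> * wal S Q \<kappa> \<eta>) =
      (\<Sum>\<kappa>\<in>digit_arrays S Q. \<Sum>\<xi>\<in>digit_arrays S Q. \<Phi> \<xi> / c * wal S Q \<kappa> (\<lambda>j t. \<eta> j t - \<xi> j t))"
  proof (intro sum.cong refl)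
    fix \<kappa>
    have "(\<Prod>j\<in>S. \<Prod>t\<in>Q. add_char (- \<kappa> j t * \<xi> j t)) * wal S Q \<kappa> \<eta> = wal S Q \<kappa> (\<lambda>j t. \<eta> j t - \<xi> j t)" for \<xi>
      unfolding wal_def prod.distrib [symmetric] add_char_add [symmetric] by (simp add: algebra_simps)
    thus "fourier_coeff S Q \<Phi> \<kappa> * wal S Q \<kappa> \<eta> =
        (\<Sum>\<xi>\<in>digit_arrays S Q. \<Phi> \<xi> / c * wal S Q \<kappa> (\<lambda>j t. \<eta> j t - \<xi> j t))"
      unfolding fourier_coeff_def sum_divide_distrib sum_distrib_right c_def
      by (intro sum.cong refl) (simp add: mult_ac)
  qed
  also have "\<dots> = (\<Sum>\<xi>\<in>digit_arrays S Q. \<Phi> \<xi> / c * (\<Sum>\<kappa>\<in>digit_arrays S Q. wal S Q \<kappa> (\<lambda>j t. \<eta> j t - \<xi> j t)))"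
    by (subst sum.swap) (simp add: sum_distrib_left)
  also have "\<dots> = (\<Sum>\<xi>\<in>digit_arrays S Q. if \<xi> = \<eta> then \<Phi> \<xi> else 0)"
  proof (intro sum.cong refl)
    fix \<xi> :: "'i \<Rightarrow> 'p \<Rightarrow> 'b mod_ring" assume \<xi>: "\<xi> \<in> digit_arrays S Q"
    have "(\<forall>j\<in>S. \<forall>t\<in>Q. \<eta> j t - \<xi> j t = 0) \<longleftrightarrow> \<xi> = \<eta>"
      using digit_arrays_eqI[OF \<xi> \<eta>] by auto
    thus "\<Phi> \<xi> / c * (\<Sum>\<kappa>\<in>digit_arrays S Q. wal S Q \<kappa> (\<lambda>j t. \<eta> j t - \<xi> j t)) = (if \<xi> = \<eta> then \<Phi> \<xi> else 0)"
      unfolding sum_wal[OF assms(1,2)] using c by (simp add: c_def)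
  qed
  also have "\<dots> = \<Phi> \<eta>" using \<eta> assms by simp
  finally show ?thesis ..
qed

lemma fourier_coeff_zero:
  fixes \<Phi> :: "('i \<Rightarrow> 'p \<Rightarrow> 'b::prime_card mod_ring) \<Rightarrow> complex"
  shows "fourier_coeff S Q \<Phi> (zero_array S Q) =
    (\<Sum>\<xi>\<in>digit_arrays S Q. \<Phi> \<xi>) / of_nat CARD('b) ^ (card S * card Q)"
  by (simp add: fourier_coeff_def zero_array_def)

text \<open>
  The mean over the whole group is the Fourier coefficient at the zero frequency, so Fourier inversion at the
  points \<open>\<eta> n\<close> leaves the other frequencies, each multiplied by the mean of its Walsh function over the points.
\<close>

lemma discrete_quadrature_error:
  fixes \<Phi> :: "('i \<Rightarrow> 'p \<Rightarrow> 'b::prime_card mod_ring) \<Rightarrow> complex"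
  assumes "finite S" "finite Q" and \<eta>: "\<And>n. n < N \<Longrightarrow> \<eta> n \<in> digit_arrays S Q" and "N > 0"
  shows "cmod ((\<Sum>n<N. \<Phi> (\<eta> n)) / of_nat N -
      (\<Sum>\<xi>\<in>digit_arrays S Q. \<Phi> \<xi>) / of_nat CARD('b) ^ (card S * card Q)) \<le>
    (\<Sum>\<kappa>\<in>digit_arrays S Q - {zero_array S Q}.
      cmod (fourier_coeff S Q \<Phi> \<kappa>) * cmod ((\<Sum>n<N. wal S Q \<kappa> (\<eta> n)) / of_nat N))"
proof -
  let ?z = "zero_array S Q :: 'i \<Rightarrow> 'p \<Rightarrow> 'b mod_ring"
  have "(\<Sum>n<N. \<Phi> (\<eta> n)) / of_nat N =
      (\<Sum>\<kappa>\<in>digit_arrays S Q. fourier_coeff S Q \<Phi> \<kappa> * ((\<Sum>n<N. wal S Q \<kappa> (\<eta> n)) / of_nat N))"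
  proof -
    have "(\<Sum>n<N. \<Phi> (\<eta> n)) = (\<Sum>n<N. \<Sum>\<kappa>\<in>digit_arrays S Q. fourier_coeff S Q \<Phi> \<kappa> * wal S Q \<kappa> (\<eta> n))"
      using assms by (intro sum.cong refl fourier_inversion) auto
    thus ?thesis
      by (subst (asm) sum.swap) (simp add: sum_distrib_left sum_divide_distrib)
  qed
  also have "\<dots> = fourier_coeff S Q \<Phi> ?z +
      (\<Sum>\<kappa>\<in>digit_arrays S Q - {?z}. fourier_coeff S Q \<Phi> \<kappa> * ((\<Sum>n<N. wal S Q \<kappa> (\<eta> n)) / of_nat N))"
    using assms zero_array_in[of S Q] by (subst sum.remove[of _ ?z]) auto
  finally have "cmod ((\<Sum>n<N. \<Phi> (\<eta> n)) / of_nat N - fourier_coeff S Q \<Phi> ?z) =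
      cmod (\<Sum>\<kappa>\<in>digit_arrays S Q - {?z}. fourier_coeff S Q \<Phi> \<kappa> * ((\<Sum>n<N. wal S Q \<kappa> (\<eta> n)) / of_nat N))"
    by simp
  also have "\<dots> \<le> (\<Sum>\<kappa>\<in>digit_arrays S Q - {?z}.
      cmod (fourier_coeff S Q \<Phi> \<kappa>) * cmod ((\<Sum>n<N. wal S Q \<kappa> (\<eta> n)) / of_nat N))"
    by (rule order_trans[OF norm_sum]) (simp add: norm_mult norm_divide)
  finally show ?thesis by (simp add: fourier_coeff_zero)
qed

section \<open>Interlaced digit positions\<close>

text \<open>
  The components \<open>\<alpha> * (j - 1) + 1, \<dots>, \<alpha> * j\<close> are the ones that are interlaced into coordinate \<open>j\<close>.
\<close>

lemma component_bij:
  fixes \<alpha> s :: nat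
  assumes "\<alpha> > 0"
  shows "bij_betw (\<lambda>(j, i). \<alpha> * (j - 1) + i) ({1..s} \<times> {1..\<alpha>}) {1..\<alpha> * s}"
proof (rule bij_betw_byWitness[where f' = "\<lambda>J. ((J - 1) div \<alpha> + 1, (J - 1) mod \<alpha> + 1)"])
  show "\<forall>a\<in>{1..s} \<times> {1..\<alpha>}. (\<lambda>J. ((J - 1) div \<alpha> + 1, (J - 1) mod \<alpha> + 1)) ((\<lambda>(j, i). \<alpha> * (j - 1) + i) a) = a"
  proof (clarsimp, intro conjI)
    fix j i assume "Suc 0 \<le> j" "Suc 0 \<le> i" "i \<le> \<alpha>"
    hence eq: "\<alpha> * (j - Suc 0) + i - Suc 0 = \<alpha> * (j - 1) + (i - 1)" and lt: "i - 1 < \<alpha>" by auto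
    show "Suc ((\<alpha> * (j - Suc 0) + i - Suc 0) div \<alpha>) = j"
      unfolding eq using lt \<open>Suc 0 \<le> j\<close> by simp
    show "Suc ((\<alpha> * (j - Suc 0) + i - Suc 0) mod \<alpha>) = i"
    proof -
      have "(\<alpha> * (j - 1) + (i - 1)) mod \<alpha> = i - 1" using lt by (simp only: mod_mult_self4 mod_less)
      thus ?thesis unfolding eq using \<open>Suc 0 \<le> i\<close> by simp
    qed
  qed
  show "\<forall>J\<in>{1..\<alpha> * s}. (\<lambda>(j, i). \<alpha> * (j - 1) + i) ((J - 1) div \<alpha> + 1, (J - 1) mod \<alpha> + 1) = J"
    by auto
  show "(\<lambda>(j, i). \<alpha> * (j - 1) + i) ` ({1..s} \<times> {1..\<alpha>}) \<subseteq> {1..\<alpha> * s}"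
  proof (rule image_subsetI)
    fix t assume "t \<in> {1..s} \<times> {1..\<alpha>}"
    then obtain j i where t: "t = (j, i)" and "1 \<le> j" "j \<le> s" "1 \<le> i" "i \<le> \<alpha>" by auto
    have "\<alpha> * (j - 1) + i \<le> \<alpha> * (j - 1) + \<alpha>" using \<open>i \<le> \<alpha>\<close> by simp
    also have "\<dots> = \<alpha> * j" using \<open>1 \<le> j\<close> by (cases j) auto
    also have "\<dots> \<le> \<alpha> * s" using \<open>j \<le> s\<close> by simp
    finally show "(case t of (j, i) \<Rightarrow> \<alpha> * (j - 1) + i) \<in> {1..\<alpha> * s}"
      using \<open>1 \<le> i\<close> by (simp add: t)
  qed
  show "(\<lambda>J. ((J - 1) div \<alpha> + 1, (J - 1) mod \<alpha> + 1)) ` {1..\<alpha> * s} \<subseteq> {1..s} \<times> {1..\<alpha>}"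
  proof clarsimp
    fix J assume J: "Suc 0 \<le> J" "J \<le> \<alpha> * s"
    hence "J - Suc 0 < s * \<alpha>" by (simp add: mult.commute)
    hence "(J - Suc 0) div \<alpha> < s" using less_mult_imp_div_less by blast
    moreover have "(J - Suc 0) mod \<alpha> < \<alpha>" using assms by simp
    ultimately show "Suc ((J - Suc 0) div \<alpha>) \<le> s \<and> Suc ((J - Suc 0) mod \<alpha>) \<le> \<alpha>" by simp
  qed
qed

lemma prod_components:
  fixes \<alpha> s :: nat
  assumes "\<alpha> > 0"
  shows "(\<Prod>J\<in>{1..\<alpha> * s}. f J) = (\<Prod>j\<in>{1..s}. \<Prod>i\<in>{1..\<alpha>}. f (\<alpha> * (j - 1) + i))"
  unfolding prod.cartesian_product prod.reindex_bij_betw[OF component_bij[OF assms], of f s, symmetric]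
  by (simp only: case_prod_unfold)

lemma block_of_component:
  fixes \<alpha> i j :: nat
  assumes "1 \<le> i" "i \<le> \<alpha>" "1 \<le> j"
  shows "nat \<lceil>real (\<alpha> * (j - 1) + i) / real \<alpha>\<rceil> = j"
proof -
  have "\<lceil>real (\<alpha> * (j - 1) + i) / real \<alpha>\<rceil> = int j"
  proof (rule ceiling_unique)
    have "real (\<alpha> * (j - 1) + i) = real \<alpha> * (real j - 1) + real i" using assms by (simp add: of_nat_diff)
    thus "real_of_int (int j) - 1 < real (\<alpha> * (j - 1) + i) / real \<alpha>"
      "real (\<alpha> * (j - 1) + i) / real \<alpha> \<le> real_of_int (int j)"
      using assms by (simp_all add: field_simps)
  qed
  thus ?thesis by simp
qed

abbreviation coord_positions :: "nat \<Rightarrow> nat \<Rightarrow> (nat \<times> nat) set" where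
  "coord_positions \<alpha> L \<equiv> {1..\<alpha>} \<times> {1..L}"

text \<open>
  The place after the point at which digit \<open>a\<close> of component \<open>i\<close> ends up in the interlaced coordinate, for
  \<open>t = (i, a)\<close>.
\<close>

definition position :: "nat \<Rightarrow> nat \<times> nat \<Rightarrow> nat" where
  "position \<alpha> t = fst t + (snd t - 1) * \<alpha>"

text \<open>
  Frequencies and points are indexed by component and digit, because the figure of merit treats components
  separately; the integrand needs them grouped by coordinate.
\<close>

definition group_digits :: "nat \<Rightarrow> nat \<Rightarrow> nat \<Rightarrow> (nat \<Rightarrow> nat \<Rightarrow> 'a) \<Rightarrow> nat \<Rightarrow> nat \<times> nat \<Rightarrow> 'a" where
  "group_digits \<alpha> L s \<xi> = (\<lambda>j\<in>{1..s}. \<lambda>t\<in>coord_positions \<alpha> L. \<xi> (\<alpha> * (j - 1) + fst t) (snd t))"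

lemma group_digits_bij:
  assumes "\<alpha> > 0"
  shows "bij_betw (group_digits \<alpha> L s) 
    (digit_arrays {1..\<alpha> * s} {1..L} :: (nat \<Rightarrow> nat \<Rightarrow> 'b::prime_card mod_ring) set) (digit_arrays {1..s} (coord_positions \<alpha> L))"
proof -
  note bij = component_bij[OF assms, of s]
  define e where "e = inv_into ({1..s} \<times> {1..\<alpha>}) (\<lambda>(j, i). \<alpha> * (j - 1) + i)"
  have e: "e (\<alpha> * (j - 1) + i) = (j, i)" if "j \<in> {1..s}" "i \<in> {1..\<alpha>}" for j i
    using bij_betw_inv_into_left[OF bij, of "(j, i)"] that by (simp add: e_def)
  have e': "\<alpha> * (fst (e J) - 1) + snd (e J) = J" "e J \<in> {1..s} \<times> {1..\<alpha>}" if "J \<in> {1..\<alpha> * s}" for J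
    using bij_betw_inv_into_right[OF bij that] bij_betwE[OF bij_betw_inv_into[OF bij]] that
    by (auto simp: e_def case_prod_unfold)
  define un where "un = (\<lambda>\<zeta> :: nat \<Rightarrow> nat \<times> nat \<Rightarrow> 'b mod_ring. \<lambda>J\<in>{1..\<alpha> * s}. \<lambda>a\<in>{1..L}. \<zeta> (fst (e J)) (snd (e J), a))"
  have J: "\<alpha> * (j - 1) + i \<in> {1..\<alpha> * s}" if "j \<in> {1..s}" "i \<in> {1..\<alpha>}" for j i
    using bij_betwE[OF bij] that by fastforce
  show ?thesis
  proof (rule bij_betw_byWitness[where f' = un])
    show "\<forall>\<xi>\<in>digit_arrays {1..\<alpha> * s} {1..L}. un (group_digits \<alpha> L s \<xi>) = \<xi>"
    proof
      fix \<xi> :: "nat \<Rightarrow> nat \<Rightarrow> 'b mod_ring" assume \<xi>: "\<xi> \<in> (\<Pi>\<^sub>E j\<in>{1..\<alpha> * s}. \<Pi>\<^sub>E t\<in>{1..L}. UNIV)"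
      show "un (group_digits \<alpha> L s \<xi>) = \<xi>"
      proof (rule PiE_ext[OF _ \<xi>])
        show "un (group_digits \<alpha> L s \<xi>) \<in> (\<Pi>\<^sub>E j\<in>{1..\<alpha> * s}. \<Pi>\<^sub>E t\<in>{1..L}. UNIV)"
          by (auto simp: un_def)
        fix J assume "J \<in> {1..\<alpha> * s}"
        show "un (group_digits \<alpha> L s \<xi>) J = \<xi> J"
        proof (rule PiE_ext[of _ "{1..L}" "\<lambda>_. UNIV"])
          show "\<xi> J \<in> {1..L} \<rightarrow>\<^sub>E UNIV" using \<xi> \<open>J \<in> _\<close> by auto
          show "un (group_digits \<alpha> L s \<xi>) J \<in> {1..L} \<rightarrow>\<^sub>E UNIV" using \<open>J \<in> _\<close> by (auto simp: un_def)
          fix a assume "a \<in> {1..L}"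
          thus "un (group_digits \<alpha> L s \<xi>) J a = \<xi> J a"
            using e'[OF \<open>J \<in> _\<close>] \<open>J \<in> _\<close> by (auto simp: un_def group_digits_def mem_Times_iff)
        qed
      qed
    qed
    show "\<forall>\<zeta>\<in>digit_arrays {1..s} (coord_positions \<alpha> L). group_digits \<alpha> L s (un \<zeta>) = \<zeta>"
    proof
      fix \<zeta> :: "nat \<Rightarrow> nat \<times> nat \<Rightarrow> 'b mod_ring" assume \<zeta>: "\<zeta> \<in> (\<Pi>\<^sub>E j\<in>{1..s}. \<Pi>\<^sub>E t\<in>coord_positions \<alpha> L. UNIV)"
      show "group_digits \<alpha> L s (un \<zeta>) = \<zeta>"
      proof (rule PiE_ext[OF _ \<zeta>])
        show "group_digits \<alpha> L s (un \<zeta>) \<in> (\<Pi>\<^sub>E j\<in>{1..s}. \<Pi>\<^sub>E t\<in>coord_positions \<alpha> L. UNIV)"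
          by (auto simp: group_digits_def)
        fix j assume j: "j \<in> {1..s}"
        show "group_digits \<alpha> L s (un \<zeta>) j = \<zeta> j"
        proof (rule PiE_ext[of _ "coord_positions \<alpha> L" "\<lambda>_. UNIV"])
          show "\<zeta> j \<in> coord_positions \<alpha> L \<rightarrow>\<^sub>E UNIV" using PiE_mem[OF \<zeta> j] .
          show "group_digits \<alpha> L s (un \<zeta>) j \<in> coord_positions \<alpha> L \<rightarrow>\<^sub>E UNIV"
            using j by (auto simp: group_digits_def)
          fix t assume t: "t \<in> coord_positions \<alpha> L"
          have 1: "fst t \<in> {1..\<alpha>}" "snd t \<in> {1..L}" using t by auto
          show "group_digits \<alpha> L s (un \<zeta>) j t = \<zeta> j t"
            using e[OF j 1(1)] J[OF j 1(1)] t j 1 by (simp add: un_def group_digits_def)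
        qed
      qed
    qed
    show "group_digits \<alpha> L s ` digit_arrays {1..\<alpha> * s} {1..L} \<subseteq> digit_arrays {1..s} (coord_positions \<alpha> L)"
      by (rule image_subsetI) (simp add: group_digits_def restrict_PiE_iff)
    show "un ` digit_arrays {1..s} (coord_positions \<alpha> L) \<subseteq> digit_arrays {1..\<alpha> * s} {1..L}"
      by (rule image_subsetI) (simp add: un_def restrict_PiE_iff)
  qed
qed

lemma position_inj: "inj_on (position \<alpha>) (coord_positions \<alpha> L)"
proof (rule inj_onI)
  fix t u assume t: "t \<in> coord_positions \<alpha> L" and u: "u \<in> coord_positions \<alpha> L"
    and eq: "position \<alpha> t = position \<alpha> u"
  have *: "(position \<alpha> t - 1) mod \<alpha> = fst t - 1 \<and> (position \<alpha> t - 1) div \<alpha> = snd t - 1"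
    if "t \<in> coord_positions \<alpha> L" for t
  proof -
    have "position \<alpha> t - 1 = (fst t - 1) + (snd t - 1) * \<alpha>" "fst t - 1 < \<alpha>"
      using that by (auto simp: position_def)
    thus ?thesis by simp
  qed
  have "fst t - 1 = fst u - 1 \<and> snd t - 1 = snd u - 1" using *[OF t] *[OF u] eq by metis
  thus "t = u" using t u by (auto simp: prod_eq_iff)
qed

lemma sorted_by_key_list:
  fixes pos :: "'p \<Rightarrow> nat"
  assumes "finite T" and "inj_on pos T"
  obtains ts where "set ts = T" "distinct ts" "sorted_wrt (<) (map pos ts)"
proof -
  define ts where "ts = map (inv_into T pos) (sorted_list_of_set (pos ` T))"
  have map: "map pos ts = sorted_list_of_set (pos ` T)"
    unfolding ts_def map_map using assms(1)
    by (intro map_idI) (auto simp: f_inv_into_f inv_into_f_f assms(2))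
  have "set ts = T"
    unfolding ts_def using assms by (simp add: inv_into_image_cancel)
  moreover have "sorted_wrt (<) (map pos ts)" unfolding map by (rule strict_sorted_list_of_set)
  moreover have "distinct ts" using map by (metis distinct_map distinct_sorted_list_of_set)
  ultimately show ?thesis using that by blast
qed

lemma span_of_increasing_positions:
  fixes k :: "'p \<Rightarrow> 'b::prime_card mod_ring" and pos :: "'p \<Rightarrow> nat"
  assumes "sorted_wrt (<) (map pos ts)" and "\<forall>t\<in>set ts. p < pos t"
  shows "span_of (map (\<lambda>t. (1 / real CARD('b) ^ pos t, k t)) ts) \<le> 1 / real CARD('b) ^ p"
  using assms
proof (induction ts arbitrary: p)
  case Nil
  thus ?case by simp
next
  case (Cons t ts)
  let ?b = "real CARD('b)"
  have b: "?b > 1" using card_prime_gt_1[where 'b='b] by simp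
  have "span_of (map (\<lambda>t. (1 / ?b ^ pos t, k t)) ts) \<le> 1 / ?b ^ pos t"
    using Cons.prems by (intro Cons.IH) auto
  hence "span_of (map (\<lambda>t. (1 / ?b ^ pos t, k t)) (t # ts)) \<le> (?b - 1) * (1 / ?b ^ pos t) + 1 / ?b ^ pos t"
    using b by (simp add: of_nat_diff)
  also have "\<dots> = ?b / ?b ^ pos t" by (simp add: field_simps)
  also have "\<dots> \<le> 1 / ?b ^ p"
  proof -
    have "?b ^ Suc p \<le> ?b ^ pos t" using b Cons.prems by (intro power_increasing) auto
    thus ?thesis using b by (simp add: field_simps)
  qed
  finally show ?case .
qed

lemma refining_increasing_positions:
  fixes k :: "'p \<Rightarrow> 'b::prime_card mod_ring" and pos :: "'p \<Rightarrow> nat"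
  assumes "sorted_wrt (<) (map pos ts)" and "\<forall>t\<in>set ts. k t \<noteq> 0"
  shows "refining (map (\<lambda>t. (1 / real CARD('b) ^ pos t, k t)) ts)"
  using assms
proof (induction ts)
  case (Cons t ts)
  have "span_of (map (\<lambda>t. (1 / real CARD('b) ^ pos t, k t)) ts) \<le> 1 / real CARD('b) ^ pos t"
    using Cons.prems by (intro span_of_increasing_positions) auto
  thus ?case using Cons by simp
qed simp

text \<open>
  The index of the last nonzero digit, and \<open>0\<close> for the zero vector. For a Walsh frequency this is the number
  of base-\<open>b\<close> digits.
\<close>

definition level :: "nat \<Rightarrow> (nat \<Rightarrow> 'b::prime_card mod_ring) \<Rightarrow> nat" where
  "level L k = Max (insert 0 {a \<in> {1..L}. k a \<noteq> 0})"

lemma level_eq_0_iff: "level L k = 0 \<longleftrightarrow> (\<forall>a\<in>{1..L}. k a = 0)"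
proof -
  have "level L k \<le> 0 \<longleftrightarrow> (\<forall>a\<in>insert 0 {a \<in> {1..L}. k a \<noteq> 0}. a \<le> 0)"
    unfolding level_def by (rule Max_le_iff) auto
  thus ?thesis by auto
qed

lemma level_nonzero:
  assumes "level L k \<noteq> 0"
  shows "level L k \<in> {1..L}" "k (level L k) \<noteq> 0"
proof -
  have "level L k \<in> insert 0 {a \<in> {1..L}. k a \<noteq> 0}" unfolding level_def by (intro Max_in) auto
  thus "level L k \<in> {1..L}" "k (level L k) \<noteq> 0" using assms by auto
qed

text \<open>
  Digit \<open>a\<close> of component \<open>i\<close> sits at place \<open>\<alpha> * a - (\<alpha> - i)\<close>. The shifts \<open>\<alpha> - i\<close> are what interlacing loses
  against the ideal decay, and their total explains the power of \<open>b\<close> in the interlaced weights.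
\<close>

lemma sum_interlacing_shift:
  fixes \<alpha> :: nat
  assumes "w \<subseteq> {1..\<alpha>}"
  shows "(\<Sum>i\<in>w. \<alpha> - i) \<le> \<alpha> * (\<alpha> - 1) div 2"
proof -
  have "(\<Sum>i\<in>w. \<alpha> - i) \<le> (\<Sum>i\<in>{1..\<alpha>}. \<alpha> - i)" using assms by (intro sum_mono2) auto
  also have "\<dots> = (\<Sum>i<\<alpha>. i)"
    by (rule sum.reindex_bij_witness[where i = "\<lambda>i. \<alpha> - i" and j = "\<lambda>i. \<alpha> - i"]) auto
  also have "\<dots> = \<alpha> * (\<alpha> - 1) div 2"
    by (simp add: lessThan_atLeast0 Sum_Ico_nat)
  finally show ?thesis .
qed

text \<open>
  The exploited digits are the leading ones of the nonzero components. There are at most \<open>\<alpha>\<close> of them, so no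
  derivative beyond the order covered by the norm is needed, and their places are distinct, so they can be
  sorted from coarse to fine.
\<close>

lemma interlaced_coordinate_bound:
  fixes k :: "nat \<times> nat \<Rightarrow> 'b::prime_card mod_ring" and \<alpha> L :: nat
  defines "lev \<equiv> (\<lambda>i. level L (\<lambda>a. k (i, a)))"
  defines "w \<equiv> {i \<in> {1..\<alpha>}. lev i \<noteq> 0}"
  assumes "\<alpha> \<ge> 2" and f: "deriv_chain {0..1} (card w) f" "\<And>t. t \<in> {0..1} \<Longrightarrow> cmod (f (card w) t) \<le> B"
  shows "cmod (\<Sum>\<xi>\<in>(\<Pi>\<^sub>E t\<in>coord_positions \<alpha> L. UNIV). (\<Prod>t\<in>coord_positions \<alpha> L. add_char (k t * \<xi> t)) *
      f 0 (\<Sum>t\<in>coord_positions \<alpha> L. of_int (to_int_mod_ring (\<xi> t)) * (1 / real CARD('b) ^ position \<alpha> t))) \<le>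
     real CARD('b) ^ (\<alpha> * L) *
     (if w = {} then 1 else C_const \<alpha> CARD('b) * real CARD('b) ^ (\<alpha> * (\<alpha> - 1) div 2) *
        (\<Prod>i\<in>w. 1 / real CARD('b) ^ (\<alpha> * lev i))) * B"
proof -
  let ?b = "real CARD('b)"
  let ?T = "coord_positions \<alpha> L"
  have b: "?b > 1" using card_prime_gt_1[where 'b='b] by simp
  define m where "m = min_chord CARD('b)"
  have m: "m > 0" unfolding m_def using card_prime_gt_1[where 'b='b] by (intro min_chord_pos) auto
  define h where "h = (\<lambda>t. 1 / ?b ^ position \<alpha> t)"
  have B0: "B \<ge> 0" using order_trans[OF norm_ge_zero f(2)[of 0]] by simp
  define R where "R = (\<lambda>i. (i, lev i)) ` w"
  have lev: "lev i \<in> {1..L}" "k (i, lev i) \<noteq> 0" if "i \<in> w" for i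
    using level_nonzero[of L "\<lambda>a. k (i, a)"] that by (auto simp: w_def lev_def)
  have RT: "R \<subseteq> ?T" using lev by (auto simp: R_def w_def)
  have fin: "finite w" "finite ?T" by (auto simp: w_def)
  obtain rs where rs: "set rs = R" "distinct rs" "sorted_wrt (<) (map (position \<alpha>) rs)"
    using sorted_by_key_list[of R "position \<alpha>"] inj_on_subset[OF position_inj RT] finite_subset[OF RT fin(2)]
    by blast
  obtain ts where ts: "set ts = ?T" "distinct ts" "sorted_wrt (<) (map (position \<alpha>) ts)"
    using sorted_by_key_list[OF fin(2) position_inj] by blast
  have len: "length rs = card w"
    using distinct_card[OF rs(2)] unfolding rs(1) R_def by (simp add: card_image inj_on_def)
  have span: "real (CARD('b) - 1) * (\<Sum>t\<in>?T. h t) \<le> 1"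
    using span_of_increasing_positions[OF ts(3), of 0 k] ts(1,2)
    by (simp add: span_of_map h_def position_def)
  have ref: "refining (map (\<lambda>t. (h t, k t)) rs)"
    unfolding h_def using rs lev by (intro refining_increasing_positions) (auto simp: R_def)
  have main: "cmod (\<Sum>\<xi>\<in>(\<Pi>\<^sub>E t\<in>?T. UNIV). (\<Prod>t\<in>?T. add_char (k t * \<xi> t)) *
      f 0 (\<Sum>t\<in>?T. of_int (to_int_mod_ring (\<xi> t)) * h t)) \<le>
     ?b ^ card ?T * (fine_const (m / 2) (length rs) * (\<Prod>t\<in>set rs. h t / m)) * B"
    unfolding m_def
    by (rule coordinate_digit_sum_bound) (use fin rs RT span ref f b len in \<open>auto simp: h_def\<close>)
  have "fine_const (m / 2) (length rs) * (\<Prod>t\<in>set rs. h t / m) \<le>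
      (if w = {} then 1 else C_const \<alpha> CARD('b) * ?b ^ (\<alpha> * (\<alpha> - 1) div 2) * (\<Prod>i\<in>w. 1 / ?b ^ (\<alpha> * lev i)))"
  proof (cases "w = {}")
    case True
    thus ?thesis using len rs(1) by (simp add: R_def)
  next
    case False
    have cw: "1 \<le> card w" "card w \<le> \<alpha>"
    proof -
      have "w \<subseteq> {1..\<alpha>}" by (auto simp: w_def)
      from card_mono[OF _ this] show "card w \<le> \<alpha>" by simp
      show "1 \<le> card w" using False fin by (simp add: Suc_le_eq card_gt_0_iff)
    qed
    have h_lev: "h (i, lev i) = ?b ^ (\<alpha> - i) * (1 / ?b ^ (\<alpha> * lev i))" if "i \<in> w" for i
    proof -
      have eq: "position \<alpha> (i, lev i) + (\<alpha> - i) = \<alpha> * lev i"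
        using that lev(1)[OF that] by (cases "lev i") (auto simp: position_def w_def)
      have "?b ^ (\<alpha> * lev i) = ?b ^ position \<alpha> (i, lev i) * ?b ^ (\<alpha> - i)"
        unfolding eq [symmetric] power_add ..
      thus ?thesis using b by (simp add: h_def)
    qed
    define P where "P = (\<Prod>i\<in>w. 1 / ?b ^ (\<alpha> * lev i))"
    have P0: "P \<ge> 0" unfolding P_def by (intro prod_nonneg) auto
    have "(\<Prod>t\<in>set rs. h t / m) = (\<Prod>i\<in>w. h (i, lev i) / m)"
      unfolding rs(1) R_def by (subst prod.reindex) (auto simp: inj_on_def)
    also have "\<dots> = (\<Prod>i\<in>w. h (i, lev i)) / m ^ card w"
      by (simp only: prod_dividef prod_constant)
    also have "(\<Prod>i\<in>w. h (i, lev i)) = (\<Prod>i\<in>w. ?b ^ (\<alpha> - i)) * P"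
      unfolding P_def prod.distrib [symmetric] by (intro prod.cong refl h_lev)
    also have "(\<Prod>i\<in>w. ?b ^ (\<alpha> - i)) = ?b ^ (\<Sum>i\<in>w. \<alpha> - i)"
      by (rule power_sum [symmetric])
    finally have "fine_const (m / 2) (length rs) * (\<Prod>t\<in>set rs. h t / m) =
        fine_const (m / 2) (card w) / m ^ card w * ?b ^ (\<Sum>i\<in>w. \<alpha> - i) * P"
      by (simp only: len times_divide_eq_right times_divide_eq_left mult.assoc)
    also have "\<dots> \<le> C_const \<alpha> CARD('b) * ?b ^ (\<alpha> * (\<alpha> - 1) div 2) * P"
    proof (rule mult_right_mono[OF mult_mono P0])
      show "fine_const (m / 2) (card w) / m ^ card w \<le> C_const \<alpha> CARD('b)"
        unfolding m_def by (rule fine_const_le_C_const[OF prime_card assms(3) cw])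
      show "?b ^ (\<Sum>i\<in>w. \<alpha> - i) \<le> ?b ^ (\<alpha> * (\<alpha> - 1) div 2)"
        using b by (intro power_increasing sum_interlacing_shift) (auto simp: w_def)
      show "0 \<le> C_const \<alpha> CARD('b)" by (rule C_const_nonneg[OF prime_card assms(3)])
    qed simp
    finally show ?thesis using False by (simp add: P_def)
  qed
  hence "?b ^ card ?T * (fine_const (m / 2) (length rs) * (\<Prod>t\<in>set rs. h t / m)) * B \<le>
     ?b ^ (\<alpha> * L) * (if w = {} then 1 else C_const \<alpha> CARD('b) * ?b ^ (\<alpha> * (\<alpha> - 1) div 2) *
        (\<Prod>i\<in>w. 1 / ?b ^ (\<alpha> * lev i))) * B"
    using b B0 by (intro mult_right_mono) (auto intro!: mult_left_mono simp: card_cartesian_product)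
  thus ?thesis using main unfolding h_def by linarith
qed

section \<open>Fourier coefficients of smooth integrands\<close>

lemma coord_span_le_1:
  "real (CARD('b::prime_card) - 1) * (\<Sum>t\<in>coord_positions \<alpha> L. 1 / real CARD('b) ^ position \<alpha> t) \<le> 1"
proof -
  obtain ts where ts: "set ts = coord_positions \<alpha> L" "distinct ts" "sorted_wrt (<) (map (position \<alpha>) ts)"
    using sorted_by_key_list[OF _ position_inj, of \<alpha> L] by blast
  have "span_of (map (\<lambda>t. (1 / real CARD('b) ^ position \<alpha> t, 0 :: 'b mod_ring)) ts) \<le> 1 / real CARD('b) ^ 0"
    using ts(1) by (intro span_of_increasing_positions[OF ts(3)]) (auto simp: position_def)
  thus ?thesis using ts by (simp add: span_of_map)
qed

definition coord_value :: "nat \<Rightarrow> nat \<Rightarrow> (nat \<times> nat \<Rightarrow> 'b::prime_card mod_ring) \<Rightarrow> real" where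
  "coord_value \<alpha> L \<zeta> = (\<Sum>t\<in>coord_positions \<alpha> L. of_int (to_int_mod_ring (\<zeta> t)) * (1 / real CARD('b) ^ position \<alpha> t))"

definition array_point :: "nat \<Rightarrow> nat \<Rightarrow> nat \<Rightarrow> (nat \<Rightarrow> nat \<Rightarrow> 'b::prime_card mod_ring) \<Rightarrow> nat \<Rightarrow> real" where
  "array_point \<alpha> L s \<xi> = (\<lambda>j\<in>{1..s}. coord_value \<alpha> L (group_digits \<alpha> L s \<xi> j))"

lemma coord_value_range: "coord_value \<alpha> L (\<zeta> :: nat \<times> nat \<Rightarrow> 'b::prime_card mod_ring) \<in> {0..1}"
proof -
  have "coord_value \<alpha> L \<zeta> \<le> (\<Sum>t\<in>coord_positions \<alpha> L. real (CARD('b) - 1) * (1 / real CARD('b) ^ position \<alpha> t))"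
    unfolding coord_value_def by (intro sum_mono digit_step_bounds) auto
  also have "\<dots> \<le> 1" using coord_span_le_1[where 'b='b] by (simp add: sum_distrib_left)
  finally have "coord_value \<alpha> L \<zeta> \<le> 1" .
  moreover have "0 \<le> coord_value \<alpha> L \<zeta>"
    unfolding coord_value_def by (intro sum_nonneg digit_step_bounds) simp
  ultimately show ?thesis by simp
qed

definition support :: "nat \<Rightarrow> nat \<Rightarrow> (nat \<Rightarrow> nat \<Rightarrow> 'b::prime_card mod_ring) \<Rightarrow> nat set" where
  "support L d \<kappa> = {J \<in> {1..d}. level L (\<kappa> J) \<noteq> 0}"

text \<open>
  The size of a Fourier coefficient up to the weight of the support of its frequency.
\<close>

definition decay :: "nat \<Rightarrow> nat \<Rightarrow> nat \<Rightarrow> (nat \<Rightarrow> nat \<Rightarrow> 'b::prime_card mod_ring) \<Rightarrow> real" where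
  "decay \<alpha> L d \<kappa> = (\<Prod>J\<in>support L d \<kappa>. 1 / real CARD('b) ^ (\<alpha> * level L (\<kappa> J)))"

lemma level_uminus: "level L (\<lambda>a. - k a) = level L k"
  by (simp add: level_def)

text \<open>
  In coordinate \<open>j\<close> as many derivatives are used as there are nonzero components in the \<open>j\<close>-th block. The norm
  bounds the resulting mixed derivative by a single summand of the weight of the block set.
\<close>

lemma fourier_coeff_bound:
  fixes \<kappa> :: "nat \<Rightarrow> nat \<Rightarrow> 'b::prime_card mod_ring"
  assumes F: "smooth_on_cube s F" "cube_norm s \<alpha> \<beta> F \<le> 1" and \<beta>: "\<forall>j\<ge>1. \<beta> j > 0" and "\<alpha> \<ge> 2"
  shows "cmod (fourier_coeff {1..\<alpha> * s} {1..L} (\<lambda>\<xi>. of_real (F (array_point \<alpha> L s \<xi>))) \<kappa>) \<le>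
    interlaced_weight CARD('b) \<alpha> (spod_weight \<alpha> \<beta>) (support L (\<alpha> * s) \<kappa>) * decay \<alpha> L (\<alpha> * s) \<kappa>"
proof -
  let ?b = "real CARD('b)"
  let ?T = "coord_positions \<alpha> L"
  have \<alpha>0: "\<alpha> > 0" using assms by simp
  have b: "?b > 1" using card_prime_gt_1[where 'b='b] by simp
  define c where "c = C_const \<alpha> CARD('b) * ?b ^ (\<alpha> * (\<alpha> - 1) div 2)"
  have c0: "c \<ge> 0" unfolding c_def using C_const_nonneg[OF prime_card[where 'a='b] \<open>\<alpha> \<ge> 2\<close>] by simp
  define lev where "lev = (\<lambda>j i. level L (\<kappa> (\<alpha> * (j - 1) + i)))"
  define w where "w = (\<lambda>j. {i \<in> {1..\<alpha>}. lev j i \<noteq> 0})"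
  define \<nu> where "\<nu> = (\<lambda>j. card (w j))"
  define v where "v = {j \<in> {1..s}. \<nu> j \<noteq> 0}"
  define k where "k = (\<lambda>j (i, a). - \<kappa> (\<alpha> * (j - 1) + i) a)"
  define r where "r = (\<lambda>j. \<Prod>i\<in>w j. 1 / ?b ^ (\<alpha> * lev j i))"
  define A where "A = (\<lambda>j. ?b ^ (\<alpha> * L) * (if w j = {} then 1 else c * r j))"
  define I where "I = (\<lambda>j :: nat. ?T \<rightarrow>\<^sub>E (UNIV :: 'b mod_ring set))"
  define cc where "cc = (\<lambda>j (\<zeta> :: nat \<times> nat \<Rightarrow> 'b mod_ring). \<Prod>t\<in>?T. add_char (k j t * \<zeta> t))"
  define x0 where "x0 = (\<lambda>j\<in>{1..s}. 0 :: real)"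
  have finw: "finite (w j)" for j by (simp add: w_def)
  have r0: "r j \<ge> 0" for j unfolding r_def by (intro prod_nonneg) auto
  define \<mu> where "\<mu> = restrict \<nu> v"
  have \<mu>: "\<mu> \<in> multi_indices \<alpha> v"
  proof -
    have "card (w j) \<le> \<alpha>" for j
    proof -
      have "w j \<subseteq> {1..\<alpha>}" by (auto simp: w_def)
      from card_mono[OF _ this] show ?thesis by simp
    qed
    thus ?thesis by (auto simp: \<mu>_def multi_indices_def v_def \<nu>_def Suc_le_eq)
  qed
  have v: "v \<subseteq> {1..s}" by (auto simp: v_def)
  have "cmod (\<Sum>\<zeta>\<in>Pi\<^sub>E {1..s} I. (\<Prod>j\<in>{1..s}. cc j (\<zeta> j)) *
      of_real (F (\<lambda>j. if j \<in> {1..s} then coord_value \<alpha> L (\<zeta> j) else x0 j))) \<le> (\<Prod>j\<in>{1..s}. A j) * gamma_coeff \<beta> v \<mu>"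
  proof (rule tensor_functional_bound[where s = s and \<nu> = \<nu>])
    show "x0 \<in> unit_cube s" by (auto simp: x0_def unit_cube_def)
    show "A j \<ge> 0" for j using c0 r0 b by (auto simp: A_def)
    show "coord_value \<alpha> L i \<in> {0..1}" for i :: "nat \<times> nat \<Rightarrow> 'b mod_ring" by (rule coord_value_range)
    show "\<bar>foldr (\<lambda>j. partial_deriv j ^^ \<nu> j) [1..<Suc s] F x\<bar> \<le> gamma_coeff \<beta> v \<mu>" if "x \<in> unit_cube s" for x
    proof -
      have "foldr (\<lambda>j. partial_deriv j ^^ \<nu> j) [1..<Suc s] F = mixed_deriv v \<mu> F"
        by (rule foldr_partial_deriv_eq_mixed_deriv) (auto simp: v_def \<mu>_def)
      thus ?thesis using cube_norm_le_1_mixed_deriv_bound[OF F(2) \<beta> v \<mu> that] by simp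
    qed
    fix j f B
    assume f: "deriv_chain {0..1} (\<nu> j) f" "\<And>t. t \<in> {0..1} \<Longrightarrow> cmod (f (\<nu> j) t) \<le> B"
    have lev_k: "level L (\<lambda>a. k j (i, a)) = lev j i" for i
      by (simp add: k_def lev_def level_uminus)
    have wj: "{i \<in> {1..\<alpha>}. lev j i \<noteq> 0} = w j" by (simp add: w_def)
    show "cmod (\<Sum>i\<in>I j. cc j i * f 0 (coord_value \<alpha> L i)) \<le> A j * B"
      using interlaced_coordinate_bound[OF \<open>\<alpha> \<ge> 2\<close>, of L "k j" f B, unfolded lev_k wj, OF f[unfolded \<nu>_def]]
      unfolding A_def I_def cc_def coord_value_def c_def r_def .
  qed (use F in auto)
  also have "(\<Sum>\<zeta>\<in>Pi\<^sub>E {1..s} I. (\<Prod>j\<in>{1..s}. cc j (\<zeta> j)) *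
      of_real (F (\<lambda>j. if j \<in> {1..s} then coord_value \<alpha> L (\<zeta> j) else x0 j))) =
    (\<Sum>\<xi>\<in>digit_arrays {1..\<alpha> * s} {1..L}. (\<Prod>J\<in>{1..\<alpha> * s}. \<Prod>a\<in>{1..L}. add_char (- \<kappa> J a * \<xi> J a)) *
      of_real (F (array_point \<alpha> L s \<xi>)))"
    unfolding I_def sum.reindex_bij_betw[OF group_digits_bij[OF \<alpha>0, of L s], symmetric]
  proof (intro sum.cong refl arg_cong2[of _ _ _ _ "(*)"])
    fix \<xi> :: "nat \<Rightarrow> nat \<Rightarrow> 'b mod_ring"
    show "(\<Prod>j\<in>{1..s}. cc j (group_digits \<alpha> L s \<xi> j)) = (\<Prod>J\<in>{1..\<alpha> * s}. \<Prod>a\<in>{1..L}. add_char (- \<kappa> J a * \<xi> J a))"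
      unfolding prod_components[OF \<alpha>0] cc_def
    proof (intro prod.cong refl)
      fix j assume "j \<in> {1..s}"
      thus "(\<Prod>t\<in>?T. add_char (k j t * group_digits \<alpha> L s \<xi> j t)) =
          (\<Prod>i\<in>{1..\<alpha>}. \<Prod>a\<in>{1..L}. add_char (- \<kappa> (\<alpha> * (j - 1) + i) a * \<xi> (\<alpha> * (j - 1) + i) a))"
        unfolding prod.cartesian_product by (intro prod.cong refl) (auto simp: k_def group_digits_def)
    qed
    show "complex_of_real (F (\<lambda>j. if j \<in> {1..s} then coord_value \<alpha> L (group_digits \<alpha> L s \<xi> j) else x0 j)) =
        complex_of_real (F (array_point \<alpha> L s \<xi>))"
      by (intro arg_cong[where f = of_real] arg_cong[where f = F]) (auto simp: array_point_def x0_def fun_eq_iff)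
  qed
  finally have main: "cmod (\<Sum>\<xi>\<in>digit_arrays {1..\<alpha> * s} {1..L}. (\<Prod>J\<in>{1..\<alpha> * s}. \<Prod>a\<in>{1..L}. add_char (- \<kappa> J a * \<xi> J a)) *
      of_real (F (array_point \<alpha> L s \<xi>))) \<le> (\<Prod>j\<in>{1..s}. A j) * gamma_coeff \<beta> v \<mu>" .
  have w_ne: "w j = {} \<longleftrightarrow> \<nu> j = 0" for j using finw by (simp add: \<nu>_def)
  have "(\<Prod>j\<in>{1..s}. A j) = ?b ^ (\<alpha> * s * L) * (\<Prod>j\<in>{1..s}. if \<nu> j \<noteq> 0 then c * r j else 1)"
  proof -
    have "A j = ?b ^ (\<alpha> * L) * (if \<nu> j \<noteq> 0 then c * r j else 1)" for j
      by (simp add: A_def w_ne)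
    thus ?thesis by (simp only: prod.distrib) (simp add: power_mult [symmetric] mult_ac)
  qed
  also have "(\<Prod>j\<in>{1..s}. if \<nu> j \<noteq> 0 then c * r j else 1) = (\<Prod>j\<in>v. c * r j)"
    unfolding v_def by (rule prod.inter_filter [symmetric]) simp
  also have "\<dots> = c ^ card v * (\<Prod>j\<in>v. r j)" by (simp add: prod.distrib)
  also have "(\<Prod>j\<in>v. r j) = (\<Prod>j\<in>{1..s}. r j)"
    by (rule prod.mono_neutral_left) (auto simp: v_def r_def w_ne [symmetric])
  also have "\<dots> = (\<Prod>j\<in>{1..s}. \<Prod>i\<in>{1..\<alpha>}. if lev j i \<noteq> 0 then 1 / ?b ^ (\<alpha> * lev j i) else 1)"
    unfolding r_def w_def by (intro prod.cong refl prod.inter_filter) simp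
  also have "\<dots> = (\<Prod>J\<in>{1..\<alpha> * s}. if level L (\<kappa> J) \<noteq> 0 then 1 / ?b ^ (\<alpha> * level L (\<kappa> J)) else 1)"
    unfolding prod_components[OF \<alpha>0] lev_def ..
  also have "\<dots> = decay \<alpha> L (\<alpha> * s) \<kappa>"
    unfolding decay_def support_def by (rule prod.inter_filter [symmetric]) simp
  finally have prodA: "(\<Prod>j\<in>{1..s}. A j) = ?b ^ (\<alpha> * s * L) * (c ^ card v * decay \<alpha> L (\<alpha> * s) \<kappa>)" .
  have block: "block_set \<alpha> (support L (\<alpha> * s) \<kappa>) = v"
  proof -
    have "support L (\<alpha> * s) \<kappa> = (\<lambda>(j, i). \<alpha> * (j - 1) + i) ` {(j, i) \<in> {1..s} \<times> {1..\<alpha>}. lev j i \<noteq> 0}"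
      unfolding support_def bij_betw_imp_surj_on[OF component_bij[OF \<alpha>0, of s], symmetric]
      by (auto simp: lev_def)
    hence "block_set \<alpha> (support L (\<alpha> * s) \<kappa>) =
        (\<lambda>(j, i). nat \<lceil>real (\<alpha> * (j - 1) + i) / real \<alpha>\<rceil>) ` {(j, i) \<in> {1..s} \<times> {1..\<alpha>}. lev j i \<noteq> 0}"
      unfolding block_set_def by (simp add: image_image case_prod_unfold)
    also have "\<dots> = (\<lambda>(j, i). j) ` {(j, i) \<in> {1..s} \<times> {1..\<alpha>}. lev j i \<noteq> 0}"
      by (intro image_cong refl) (auto simp del: of_nat_add of_nat_mult intro!: block_of_component[unfolded One_nat_def])
    also have "\<dots> = v" unfolding v_def w_ne [symmetric] by (auto simp: w_def image_iff)
    finally show ?thesis .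
  qed
  have \<gamma>: "gamma_coeff \<beta> v \<mu> \<le> spod_weight \<alpha> \<beta> v"
    unfolding spod_weight_def
  proof (rule member_le_sum[OF \<mu>])
    show "finite (multi_indices \<alpha> v)"
      unfolding multi_indices_def using finite_subset[OF v] by (intro finite_PiE) auto
  qed (use gamma_coeff_pos[OF \<beta> v] in \<open>auto intro: less_imp_le\<close>)
  have d0: "decay \<alpha> L (\<alpha> * s) \<kappa> \<ge> 0" unfolding decay_def by (intro prod_nonneg) auto
  have "cmod (fourier_coeff {1..\<alpha> * s} {1..L} (\<lambda>\<xi>. of_real (F (array_point \<alpha> L s \<xi>))) \<kappa>) \<le>
      (\<Prod>j\<in>{1..s}. A j) * gamma_coeff \<beta> v \<mu> / ?b ^ (\<alpha> * s * L)"
    unfolding fourier_coeff_def norm_divide norm_power norm_of_nat card_atLeastAtMost diff_Suc_1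
    using main by (intro divide_right_mono) auto
  also have "\<dots> = c ^ card v * decay \<alpha> L (\<alpha> * s) \<kappa> * gamma_coeff \<beta> v \<mu>"
    unfolding prodA using b by simp
  also have "\<dots> \<le> c ^ card v * decay \<alpha> L (\<alpha> * s) \<kappa> * spod_weight \<alpha> \<beta> v"
    using \<gamma> c0 d0 by (intro mult_left_mono) auto
  also have "\<dots> = interlaced_weight CARD('b) \<alpha> (spod_weight \<alpha> \<beta>) (support L (\<alpha> * s) \<kappa>) * decay \<alpha> L (\<alpha> * s) \<kappa>"
    unfolding interlaced_weight_def block c_def by simp
  finally show ?thesis .
qed

section \<open>Grid means converge to the integral\<close>

lemma partial_deriv_bound:
  assumes "cube_norm s \<alpha> \<beta> F \<le> 1" and "\<forall>j\<ge>1. \<beta> j > 0" and "\<alpha> \<ge> 1" and "j \<in> {1..s}" and "x \<in> unit_cube s"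
  shows "\<bar>partial_deriv j F x\<bar> \<le> \<beta> j"
proof -
  have "(\<lambda>_\<in>{j}. 1) \<in> multi_indices \<alpha> {j}" using assms(3) by (auto simp: multi_indices_def)
  from cube_norm_le_1_mixed_deriv_bound[OF assms(1,2) _ this assms(5)] assms(4)
  show ?thesis by (simp add: mixed_deriv_def gamma_coeff_def)
qed

text \<open>
  The coordinates are exchanged one after the other, with the mean value theorem in each step.
\<close>

lemma cube_Lipschitz:
  assumes F: "smooth_on_cube s F" and K: "\<And>j x. j \<in> {1..s} \<Longrightarrow> x \<in> unit_cube s \<Longrightarrow> \<bar>partial_deriv j F x\<bar> \<le> K j"
    and x: "x \<in> unit_cube s" and y: "y \<in> unit_cube s"
  shows "\<bar>F x - F y\<bar> \<le> (\<Sum>j\<in>{1..s}. K j * \<bar>x j - y j\<bar>)"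
proof -
  define z where "z = (\<lambda>n j. if j \<le> n then x j else y j)"
  have xy: "x j \<in> {0..1}" "y j \<in> {0..1}" if "j \<in> {1..s}" for j
    using x y that by (auto simp: unit_cube_def)
  have z: "z n \<in> unit_cube s" for n
    using x y by (auto simp: z_def unit_cube_def PiE_iff extensional_def)
  have "\<bar>F (z n) - F (z 0)\<bar> \<le> (\<Sum>j\<in>{1..n}. K j * \<bar>x j - y j\<bar>)" if "n \<le> s" for n
    using that
  proof (induction n)
    case (Suc n)
    define N where "N = Suc n"
    have N: "N \<in> {1..s}" using Suc.prems by (simp add: N_def)
    have z1: "z (Suc n) = (z n)(N := x N)" and z2: "z n = (z n)(N := y N)"
      by (auto simp: z_def N_def fun_eq_iff le_Suc_eq)
    have "norm (F ((z n)(N := x N)) - F ((z n)(N := y N))) \<le> K N * norm (x N - y N)"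
    proof (rule differentiable_bound[where S = "{0..1}" and f = "\<lambda>t. F ((z n)(N := t))"])
      fix t :: real assume t: "t \<in> {0..1}"
      have zt: "(z n)(N := t) \<in> unit_cube s" using z N t by (intro unit_cube_upd)
      show "((\<lambda>t. F ((z n)(N := t))) has_derivative (\<lambda>h. h *\<^sub>R partial_deriv N F ((z n)(N := t)))) (at t within {0..1})"
        using smooth_on_cube_has_partial_deriv[OF F N zt] by (simp add: has_vector_derivative_def)
      show "onorm (\<lambda>h. h *\<^sub>R partial_deriv N F ((z n)(N := t))) \<le> K N"
        using K[OF N zt] by (intro onorm_le) (simp add: abs_mult mult.commute[of "K N"] mult_left_mono)
    qed (use xy[OF N] in auto)
    hence "\<bar>F (z (Suc n)) - F (z n)\<bar> \<le> K N * \<bar>x N - y N\<bar>"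
      unfolding z1 using z2 by simp
    thus ?case using Suc by (simp add: N_def)
  qed auto
  from this[of s] have "\<bar>F (z s) - F (z 0)\<bar> \<le> (\<Sum>j\<in>{1..s}. K j * \<bar>x j - y j\<bar>)" by simp
  moreover have "z s = x" using x y by (auto simp: z_def unit_cube_def PiE_iff extensional_def fun_eq_iff)
  moreover have "z 0 = y" using x y by (auto simp: z_def unit_cube_def PiE_iff extensional_def fun_eq_iff)
  ultimately show ?thesis by simp
qed

text \<open>
  The last cell is closed, so that the cells partition the closed unit interval.
\<close>

definition cell :: "nat \<Rightarrow> nat \<Rightarrow> real set" where
  "cell n i = (if i = n - 1 then {real i / real n..1} else {real i / real n..<real (Suc i) / real n})"

lemma cell_properties:
  assumes "n \<ge> 1" and "i < n"
  shows "cell n i \<in> sets lborel" "emeasure lborel (cell n i) = ennreal (1 / real n)" "cell n i \<subseteq> {0..1}"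
    "x \<in> cell n i \<Longrightarrow> \<bar>x - real i / real n\<bar> \<le> 1 / real n"
proof -
  have n: "real n > 0" using assms by simp
  have len: "real (Suc i) / real n - real i / real n = 1 / real n"
    by (simp add: add_divide_distrib)
  have last: "i = n - 1 \<Longrightarrow> real (Suc i) / real n = 1" using assms by simp
  have le1: "real (Suc i) / real n \<le> 1" using assms by simp
  have ge0: "real i / real n \<ge> 0" by simp
  show "cell n i \<in> sets lborel" by (simp add: cell_def)
  show "emeasure lborel (cell n i) = ennreal (1 / real n)"
  proof (cases "i = n - 1")
    case True
    have "emeasure lborel {real i / real n..1} = ennreal (1 - real i / real n)"
      using assms by (intro emeasure_lborel_Icc) simp
    also have "1 - real i / real n = 1 / real n" using last[OF True] len by linarith
    finally show ?thesis unfolding cell_def if_P[OF True] .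
  next
    case False
    have "emeasure lborel {real i / real n..<real (Suc i) / real n} = ennreal (real (Suc i) / real n - real i / real n)"
      using n by (intro emeasure_lborel_Ico divide_right_mono) auto
    thus ?thesis unfolding cell_def if_not_P[OF False] len .
  qed
  show "cell n i \<subseteq> {0..1}"
  proof
    fix x assume "x \<in> cell n i"
    hence "real i / real n \<le> x" "x \<le> 1" using le1 unfolding cell_def by (auto split: if_splits simp del: of_nat_Suc)
    thus "x \<in> {0..1}" using order_trans[OF ge0] by simp
  qed
  show "x \<in> cell n i \<Longrightarrow> \<bar>x - real i / real n\<bar> \<le> 1 / real n"
  proof (cases "i = n - 1")
    case True
    assume "x \<in> cell n i"
    hence "real i / real n \<le> x" "x \<le> 1" unfolding cell_def if_P[OF True] by auto
    thus ?thesis using len last[OF True] by linarith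
  next
    case False
    assume "x \<in> cell n i"
    hence "real i / real n \<le> x" "x < real (Suc i) / real n" unfolding cell_def if_not_P[OF False] by auto
    thus ?thesis using len by linarith
  qed
qed

lemma cells_cover:
  assumes "n \<ge> 1" and "x \<in> {0..1}"
  shows "\<exists>!i. i < n \<and> x \<in> cell n i"
proof -
  have n: "real n > 0" using assms by simp
  define k where "k = nat \<lfloor>x * real n\<rfloor>"
  have k: "real k \<le> x * real n" "x * real n < real k + 1"
    using assms(2) n unfolding k_def by (auto simp: of_nat_nat)
  have mem: "x \<in> cell n i \<longleftrightarrow> (if i = n - 1 then n - 1 \<le> k else i = k)" if "i < n" for i
  proof (cases "i = n - 1")
    case True
    have "x \<in> cell n i \<longleftrightarrow> real i \<le> x * real n"
      using True assms n by (auto simp: cell_def field_simps)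
    also have "\<dots> \<longleftrightarrow> i \<le> k"
    proof
      assume "real i \<le> x * real n"
      hence "real i < real (Suc k)" using k by simp
      thus "i \<le> k" by simp
    next
      assume "i \<le> k"
      hence "real i \<le> real k" by simp
      thus "real i \<le> x * real n" using k by linarith
    qed
    finally show ?thesis using True by simp
  next
    case False
    have "x \<in> cell n i \<longleftrightarrow> real i \<le> x * real n \<and> x * real n < real i + 1"
      using False n by (auto simp: cell_def field_simps)
    also have "\<dots> \<longleftrightarrow> i = k" using k by auto
    finally show ?thesis using False by simp
  qed
  have k_le: "k \<le> n" 
  proof -
    have "x * real n \<le> 1 * real n" using assms(2) by (intro mult_right_mono) auto
    hence "real k \<le> real n" using k by linarith
    thus ?thesis by simp
  qed
  show ?thesis
  proof (rule ex1I[of _ "min k (n - 1)"])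
    show "min k (n - 1) < n \<and> x \<in> cell n (min k (n - 1))"
      using assms k_le mem[of "min k (n - 1)"] by (auto simp: min_def)
    fix i assume "i < n \<and> x \<in> cell n i"
    thus "i = min k (n - 1)" using mem[of i] by (auto split: if_splits)
  qed
qed

text \<open>
  The step functions with the values of \<open>F\<close> at the corners of the cells differ from \<open>F\<close> by at most the right-hand
  side. This also shows that \<open>F\<close> is measurable on the product space, as a pointwise limit of step functions.
\<close>

lemma riemann_sum_cube:
  fixes F :: "(nat \<Rightarrow> real) \<Rightarrow> real"
  assumes Lip: "\<And>x y. x \<in> unit_cube s \<Longrightarrow> y \<in> unit_cube s \<Longrightarrow> \<bar>F x - F y\<bar> \<le> (\<Sum>j\<in>{1..s}. K j * \<bar>x j - y j\<bar>)"
    and K: "\<And>j. j \<in> {1..s} \<Longrightarrow> K j \<ge> 0" and n: "n \<ge> 1"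
  shows "\<bar>(\<Sum>g\<in>{1..s} \<rightarrow>\<^sub>E {..<n}. F (\<lambda>j\<in>{1..s}. real (g j) / real n)) / real n ^ s - cube_integral s F\<bar>
    \<le> (\<Sum>j\<in>{1..s}. K j) / real n"
proof -
  define M where "M = (\<Pi>\<^sub>M j\<in>{1..s}. lborel :: real measure)"
  interpret P: product_sigma_finite "\<lambda>_ :: nat. lborel :: real measure" ..
  define pt where "pt = (\<lambda>(n :: nat) (g :: nat \<Rightarrow> nat). (\<lambda>j\<in>{1..s}. real (g j) / real n))"
  define box where "box = (\<lambda>(n :: nat) (g :: nat \<Rightarrow> nat). (\<Pi>\<^sub>E j\<in>{1..s}. cell n (g j)))"
  define G where "G = (\<lambda>n :: nat. {1..s} \<rightarrow>\<^sub>E {..<n})"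
  define app where "app = (\<lambda>n x. \<Sum>g\<in>G n. F (pt n g) * indicator (box n g) x)"
  define f where "f = (\<lambda>x. indicator (unit_cube s) x * F x)"
  define KK where "KK = (\<Sum>j\<in>{1..s}. K j)"
  have KK0: "KK \<ge> 0" unfolding KK_def using K by (intro sum_nonneg)
  have finG: "finite (G n)" for n unfolding G_def by (intro finite_PiE) auto
  have G_lt: "g j < n" if "g \<in> G n" "j \<in> {1..s}" for g j n using that by (auto simp: G_def)
  have box_sets: "box n g \<in> sets M" if "n \<ge> 1" "g \<in> G n" for n g
    unfolding box_def M_def using that by (intro sets_PiM_I_finite cell_properties) (auto intro: G_lt)
  have box_emeasure: "emeasure M (box n g) = ennreal (1 / real n ^ s)" if "n \<ge> 1" "g \<in> G n" for n g
  proof -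
    have "emeasure M (box n g) = (\<Prod>j\<in>{1..s}. emeasure lborel (cell n (g j)))"
      unfolding box_def M_def using that by (intro P.emeasure_PiM cell_properties) (auto intro: G_lt)
    also have "\<dots> = (\<Prod>j\<in>{1..s}. ennreal (1 / real n))"
      using that by (intro prod.cong refl cell_properties) (auto intro: G_lt)
    also have "\<dots> = ennreal (1 / real n ^ s)" by (simp add: ennreal_power power_one_over)
    finally show ?thesis .
  qed
  have pt_cube: "pt n g \<in> unit_cube s" if "n \<ge> 1" "g \<in> G n" for n g
    using G_lt[OF that(2)] that(1) unfolding pt_def unit_cube_def by (fastforce simp: field_simps)
  have box_cube: "box n g \<subseteq> unit_cube s" if "n \<ge> 1" "g \<in> G n" for n g
    unfolding box_def unit_cube_def using cell_properties(3)[OF that(1) G_lt[OF that(2)]]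
    by (intro PiE_mono) auto
  have cover: "\<exists>!g. g \<in> G n \<and> x \<in> box n g" if "n \<ge> 1" "x \<in> unit_cube s" for n x
  proof -
    have "\<exists>!i. i < n \<and> x j \<in> cell n i" if "j \<in> {1..s}" for j
      using that \<open>x \<in> _\<close> \<open>n \<ge> 1\<close> by (intro cells_cover) (auto simp: unit_cube_def)
    then obtain e where e: "\<And>j. j \<in> {1..s} \<Longrightarrow> e j < n \<and> x j \<in> cell n (e j)"
      and u: "\<And>j i. j \<in> {1..s} \<Longrightarrow> i < n \<Longrightarrow> x j \<in> cell n i \<Longrightarrow> i = e j" by metis
    show ?thesis
    proof (rule ex1I[of _ "restrict e {1..s}"])
      show "restrict e {1..s} \<in> G n \<and> x \<in> box n (restrict e {1..s})"
        using e \<open>x \<in> unit_cube s\<close> by (auto simp: G_def box_def unit_cube_def PiE_iff)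
      fix g assume g: "g \<in> G n \<and> x \<in> box n g"
      show "g = restrict e {1..s}"
        using g u by (intro PiE_ext[of g "{1..s}" "\<lambda>_. {..<n}"]) (auto simp: G_def box_def PiE_iff e)
    qed
  qed
  have app_eq: "app n x = F (pt n g)" if "n \<ge> 1" "g \<in> G n" "x \<in> box n g" for n x g
  proof -
    have x: "x \<in> unit_cube s" using box_cube that by blast
    have "app n x = (\<Sum>g'\<in>G n. if g' = g then F (pt n g') else 0)"
      unfolding app_def using cover[OF that(1) x] that by (intro sum.cong refl) (auto simp: indicator_def)
    thus ?thesis using finG that by simp
  qed
  have close: "\<bar>app n x - f x\<bar> \<le> KK / real n * indicator (unit_cube s) x" if "n \<ge> 1" for n x
  proof (cases "x \<in> unit_cube s")
    case True
    then obtain g where g: "g \<in> G n" "x \<in> box n g" using cover[OF \<open>n \<ge> 1\<close> True] by blast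
    have "\<bar>app n x - f x\<bar> = \<bar>F (pt n g) - F x\<bar>" using app_eq[OF that g] True by (simp add: f_def)
    also have "\<dots> \<le> (\<Sum>j\<in>{1..s}. K j * \<bar>pt n g j - x j\<bar>)" by (intro Lip pt_cube that g True)
    also have "\<dots> \<le> (\<Sum>j\<in>{1..s}. K j * (1 / real n))"
    proof (intro sum_mono mult_left_mono K)
      fix j assume j: "j \<in> {1..s}"
      have "x j \<in> cell n (g j)" using g(2) j by (auto simp: box_def)
      from cell_properties(4)[OF that G_lt[OF g(1) j] this] show "\<bar>pt n g j - x j\<bar> \<le> 1 / real n"
        using j by (simp add: pt_def abs_minus_commute)
    qed
    also have "\<dots> = KK / real n" by (simp add: KK_def sum_divide_distrib)
    finally show ?thesis using True by simp
  next
    case False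
    hence "app n x = 0" unfolding app_def using box_cube[OF that] by (intro sum.neutral) (auto simp: indicator_def)
    thus ?thesis using False by (simp add: f_def)
  qed
  have app_int: "integrable M (app n)" "integral\<^sup>L M (app n) = (\<Sum>g\<in>G n. F (pt n g)) / real n ^ s" if "n \<ge> 1" for n
  proof -
    have i: "integrable M (\<lambda>x. F (pt n g) * indicator (box n g) x)" if "g \<in> G n" for g
      using box_sets[OF \<open>n \<ge> 1\<close> that] box_emeasure[OF \<open>n \<ge> 1\<close> that]
      by (intro integrable_mult_right integrable_real_indicator) auto
    show "integrable M (app n)" unfolding app_def using i by (intro Bochner_Integration.integrable_sum)
    have "integral\<^sup>L M (app n) = (\<Sum>g\<in>G n. F (pt n g) * measure M (box n g))"
      unfolding app_def using i box_sets[OF \<open>n \<ge> 1\<close>] by (subst Bochner_Integration.integral_sum) (auto intro!: sum.cong)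
    also have "\<dots> = (\<Sum>g\<in>G n. F (pt n g) * (1 / real n ^ s))"
      using box_emeasure[OF that] by (intro sum.cong refl) (simp add: measure_def)
    finally show "integral\<^sup>L M (app n) = (\<Sum>g\<in>G n. F (pt n g)) / real n ^ s" by (simp add: sum_divide_distrib)
  qed
  have cube: "unit_cube s \<in> sets M" "emeasure M (unit_cube s) = 1"
  proof -
    show "unit_cube s \<in> sets M" unfolding unit_cube_def M_def by (intro sets_PiM_I_finite) auto
    have "emeasure M (unit_cube s) = (\<Prod>j\<in>{1..s}. emeasure lborel {0..1::real})"
      unfolding unit_cube_def M_def by (intro P.emeasure_PiM) auto
    thus "emeasure M (unit_cube s) = 1" by simp
  qed
  have ind_int: "integrable M (\<lambda>x. KK / real n * indicator (unit_cube s) x)"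
    using cube by (intro integrable_mult_right integrable_real_indicator) auto
  have f_meas: "f \<in> borel_measurable M"
  proof (rule borel_measurable_LIMSEQ_real)
    fix x
    have "(\<lambda>i. app (Suc i) x - f x) \<longlonglongrightarrow> 0"
    proof (rule Lim_null_comparison)
      show "(\<lambda>i. KK / real (Suc i) * indicator (unit_cube s) x) \<longlonglongrightarrow> 0"
        by (intro tendsto_mult_left_zero LIMSEQ_Suc[OF lim_const_over_n])
      show "\<forall>\<^sub>F i in sequentially. norm (app (Suc i) x - f x) \<le> KK / real (Suc i) * indicator (unit_cube s) x"
      proof (intro always_eventually allI)
        fix i
        show "norm (app (Suc i) x - f x) \<le> KK / real (Suc i) * indicator (unit_cube s) x"
          using close[of "Suc i" x] by (simp del: of_nat_Suc)
      qed
    qed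
    thus "(\<lambda>i. app (Suc i) x) \<longlonglongrightarrow> f x" by (rule LIM_zero_cancel)
    show "app (Suc i) \<in> borel_measurable M" for i
      using app_int(1)[of "Suc i"] by simp
  qed
  have diff_int: "integrable M (\<lambda>x. app n x - f x)"
  proof (rule Bochner_Integration.integrable_bound[OF ind_int])
    show "AE x in M. norm (app n x - f x) \<le> norm (KK / real n * indicator (unit_cube s) x :: real)"
    proof (rule AE_I2)
      fix x
      show "norm (app n x - f x) \<le> norm (KK / real n * indicator (unit_cube s) x :: real)"
        using close[OF n, of x] unfolding real_norm_def by linarith
    qed
  qed (use f_meas app_int(1)[OF n] in auto)
  have f_int: "integrable M f"
    using Bochner_Integration.integrable_diff[OF app_int(1)[OF n] diff_int] by simp
  have "\<bar>integral\<^sup>L M (app n) - integral\<^sup>L M f\<bar> = \<bar>LINT x|M. app n x - f x\<bar>"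
    using app_int(1)[OF n] f_int by simp
  also have "\<dots> \<le> (LINT x|M. \<bar>app n x - f x\<bar>)"
    using integral_norm_bound[of M "\<lambda>x. app n x - f x"] by simp
  also have "\<dots> \<le> (LINT x|M. KK / real n * indicator (unit_cube s) x)"
    using diff_int ind_int close[OF n] by (intro integral_mono) auto
  also have "\<dots> = KK / real n" using cube by (simp add: measure_def)
  finally have "\<bar>integral\<^sup>L M (app n) - integral\<^sup>L M f\<bar> \<le> KK / real n" .
  thus ?thesis
    unfolding app_int(2)[OF n]
    unfolding KK_def cube_integral_def set_lebesgue_integral_def f_def M_def G_def pt_def
    by simp
qed

text \<open>
  The lowest \<open>M\<close> digits of a number represent its residue modulo \<open>b ^ M\<close>.
\<close>

lemma base_digits_sum: "(\<Sum>l<M. (i div b ^ l mod b) * b ^ l) = i mod b ^ M" for b i :: nat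
proof (induction M)
  case (Suc M)
  have "i mod b ^ Suc M = b ^ M * (i div b ^ M mod b) + i mod b ^ M"
    by (metis mod_mult2_eq power_Suc2)
  thus ?case using Suc by simp
qed simp

lemma sum_positions:
  assumes "\<alpha> > 0"
  shows "(\<Sum>t\<in>coord_positions \<alpha> L. f (position \<alpha> t)) = (\<Sum>l\<in>{1..\<alpha> * L}. f l)"
proof -
  have "(\<Sum>t\<in>coord_positions \<alpha> L. f (position \<alpha> t)) = (\<Sum>(j, i)\<in>{1..L} \<times> {1..\<alpha>}. f (\<alpha> * (j - 1) + i))"
    by (rule sum.reindex_bij_witness[where i = "\<lambda>(j, i). (i, j)" and j = "\<lambda>(i, j). (j, i)"])
      (auto simp: position_def algebra_simps)
  also have "\<dots> = (\<Sum>l\<in>{1..\<alpha> * L}. f l)"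
    unfolding sum.reindex_bij_betw[OF component_bij[OF assms, of L], of f, symmetric]
    by (simp only: case_prod_unfold)
  finally show ?thesis .
qed

text \<open>
  The numerator of a coordinate over the common denominator \<open>b ^ (\<alpha> * L)\<close>.
\<close>

definition coord_code :: "nat \<Rightarrow> nat \<Rightarrow> (nat \<times> nat \<Rightarrow> 'b::prime_card mod_ring) \<Rightarrow> nat" where
  "coord_code \<alpha> L \<zeta> = (\<Sum>t\<in>coord_positions \<alpha> L. nat (to_int_mod_ring (\<zeta> t)) * CARD('b) ^ (\<alpha> * L - position \<alpha> t))"

lemma position_range:
  assumes "t \<in> coord_positions \<alpha> L"
  shows "position \<alpha> t \<in> {1..\<alpha> * L}"
proof -
  obtain i a where t: "t = (i, a)" by (cases t)
  have "i \<le> \<alpha>" "1 \<le> a" "a \<le> L" using assms by (auto simp: t)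
  have "i + (a - 1) * \<alpha> \<le> \<alpha> + (a - 1) * \<alpha>" using \<open>i \<le> \<alpha>\<close> by simp
  also have "\<dots> = a * \<alpha>" using \<open>1 \<le> a\<close> by (cases a) auto
  also have "\<dots> \<le> L * \<alpha>" using \<open>a \<le> L\<close> by simp
  finally show ?thesis using assms by (auto simp: t position_def mult.commute)
qed

lemma coord_value_eq_code:
  "coord_value \<alpha> L \<zeta> = real (coord_code \<alpha> L (\<zeta> :: nat \<times> nat \<Rightarrow> 'b::prime_card mod_ring)) / real (CARD('b) ^ (\<alpha> * L))"
proof -
  have b: "real CARD('b) > 0" using card_prime_gt_1[where 'b='b] by simp
  show ?thesis
    unfolding coord_value_def coord_code_def of_nat_sum sum_divide_distrib
  proof (intro sum.cong refl)
    fix t assume "t \<in> coord_positions \<alpha> L"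
    hence "position \<alpha> t \<le> \<alpha> * L" using position_range by fastforce
    hence "real CARD('b) ^ (\<alpha> * L) = real CARD('b) ^ position \<alpha> t * real CARD('b) ^ (\<alpha> * L - position \<alpha> t)"
      by (simp flip: power_add)
    thus "real_of_int (to_int_mod_ring (\<zeta> t)) * (1 / real CARD('b) ^ position \<alpha> t) =
        real (nat (to_int_mod_ring (\<zeta> t)) * CARD('b) ^ (\<alpha> * L - position \<alpha> t)) / real (CARD('b) ^ (\<alpha> * L))"
      using b to_int_mod_ring_range(1)[of "\<zeta> t"] by (simp add: of_nat_nat)
  qed
qed

text \<open>
  Every numerator has a digit expansion, and there are as many digit vectors as numerators.
\<close>

lemma coord_code_bij:
  assumes "\<alpha> > 0"
  shows "bij_betw (coord_code \<alpha> L) (coord_positions \<alpha> L \<rightarrow>\<^sub>E (UNIV :: 'b::prime_card mod_ring set)) {..<CARD('b) ^ (\<alpha> * L)}"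
proof -
  define b where "b = CARD('b)"
  define M where "M = \<alpha> * L"
  define A where "A = (coord_positions \<alpha> L \<rightarrow>\<^sub>E (UNIV :: 'b mod_ring set))"
  have b: "b > 1" unfolding b_def by (rule card_prime_gt_1)
  have finA: "finite A" unfolding A_def by (intro finite_PiE) auto
  have cardA: "card A = b ^ M"
    unfolding A_def b_def M_def by (simp add: card_PiE CARD_mod_ring card_cartesian_product)
  have sub: "{..<b ^ M} \<subseteq> coord_code \<alpha> L ` A"
  proof
    fix i assume "i \<in> {..<b ^ M}"
    define \<zeta> where "\<zeta> = (\<lambda>t\<in>coord_positions \<alpha> L. of_int_mod_ring (int (i div b ^ (M - position \<alpha> t) mod b)) :: 'b mod_ring)"
    have "coord_code \<alpha> L \<zeta> = (\<Sum>t\<in>coord_positions \<alpha> L. (i div b ^ (M - position \<alpha> t) mod b) * b ^ (M - position \<alpha> t))"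
      unfolding coord_code_def M_def [symmetric] b_def [symmetric]
    proof (intro sum.cong refl)
      fix t assume t: "t \<in> coord_positions \<alpha> L"
      have "to_int_mod_ring (\<zeta> t) = int (i div b ^ (M - position \<alpha> t) mod b)"
        unfolding \<zeta>_def restrict_apply'[OF t] using b by (intro to_int_mod_ring_of_int_mod_ring) (auto simp: b_def)
      thus "nat (to_int_mod_ring (\<zeta> t)) * b ^ (M - position \<alpha> t) =
          (i div b ^ (M - position \<alpha> t) mod b) * b ^ (M - position \<alpha> t)" by simp
    qed
    also have "\<dots> = (\<Sum>l\<in>{1..M}. (i div b ^ (M - l) mod b) * b ^ (M - l))"
      unfolding M_def by (rule sum_positions[OF assms])
    also have "\<dots> = (\<Sum>l<M. (i div b ^ l mod b) * b ^ l)"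
      by (rule sum.reindex_bij_witness[where i = "\<lambda>l. M - l" and j = "\<lambda>l. M - l"]) auto
    also have "\<dots> = i" using \<open>i \<in> {..<b ^ M}\<close> by (simp add: base_digits_sum)
    finally have "i = coord_code \<alpha> L \<zeta>" ..
    moreover have "\<zeta> \<in> A" by (simp add: A_def \<zeta>_def)
    ultimately show "i \<in> coord_code \<alpha> L ` A" by blast
  qed
  have le: "card (coord_code \<alpha> L ` A) \<le> card {..<b ^ M}"
    using card_image_le[OF finA, of "coord_code \<alpha> L"] cardA by simp
  have eq: "coord_code \<alpha> L ` A = {..<b ^ M}"
    using card_seteq[OF _ sub le] finA by simp
  have "inj_on (coord_code \<alpha> L) A"
    using finA cardA eq by (intro eq_card_imp_inj_on) simp_all
  thus ?thesis using eq unfolding bij_betw_def A_def b_def M_def by blast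
qed

lemma bij_betw_PiE_const:
  assumes "bij_betw \<phi> A B"
  shows "bij_betw (\<lambda>\<zeta>. \<lambda>j\<in>S. \<phi> (\<zeta> j)) (S \<rightarrow>\<^sub>E A) (S \<rightarrow>\<^sub>E B)"
proof (rule bij_betw_byWitness[where f' = "\<lambda>g. \<lambda>j\<in>S. inv_into A \<phi> (g j)"])
  show "\<forall>\<zeta>\<in>S \<rightarrow>\<^sub>E A. (\<lambda>j\<in>S. inv_into A \<phi> ((\<lambda>j\<in>S. \<phi> (\<zeta> j)) j)) = \<zeta>"
  proof
    fix \<zeta> assume \<zeta>: "\<zeta> \<in> S \<rightarrow>\<^sub>E A"
    have "inv_into A \<phi> (\<phi> (\<zeta> j)) = \<zeta> j" if "j \<in> S" for j
      by (rule bij_betw_inv_into_left[OF assms PiE_mem[OF \<zeta> that]])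
    thus "(\<lambda>j\<in>S. inv_into A \<phi> ((\<lambda>j\<in>S. \<phi> (\<zeta> j)) j)) = \<zeta>"
      using PiE_arb[OF \<zeta>] by (auto simp: fun_eq_iff restrict_def)
  qed
  show "\<forall>g\<in>S \<rightarrow>\<^sub>E B. (\<lambda>j\<in>S. \<phi> ((\<lambda>j\<in>S. inv_into A \<phi> (g j)) j)) = g"
  proof
    fix g assume g: "g \<in> S \<rightarrow>\<^sub>E B"
    have "\<phi> (inv_into A \<phi> (g j)) = g j" if "j \<in> S" for j
      by (rule bij_betw_inv_into_right[OF assms PiE_mem[OF g that]])
    thus "(\<lambda>j\<in>S. \<phi> ((\<lambda>j\<in>S. inv_into A \<phi> (g j)) j)) = g"
      using PiE_arb[OF g] by (auto simp: fun_eq_iff restrict_def)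
  qed
  show "(\<lambda>\<zeta>. \<lambda>j\<in>S. \<phi> (\<zeta> j)) ` (S \<rightarrow>\<^sub>E A) \<subseteq> S \<rightarrow>\<^sub>E B"
    using bij_betwE[OF assms] by (intro image_subsetI restrict_PiE_iff[THEN iffD2] ballI) (auto dest: PiE_mem)
  show "(\<lambda>g. \<lambda>j\<in>S. inv_into A \<phi> (g j)) ` (S \<rightarrow>\<^sub>E B) \<subseteq> S \<rightarrow>\<^sub>E A"
    using bij_betwE[OF bij_betw_inv_into[OF assms]]
    by (intro image_subsetI restrict_PiE_iff[THEN iffD2] ballI) (auto dest: PiE_mem)
qed

lemma array_mean_approx:
  fixes F :: "(nat \<Rightarrow> real) \<Rightarrow> real"
  assumes F: "smooth_on_cube s F" "cube_norm s \<alpha> \<beta> F \<le> 1" and \<beta>: "\<forall>j\<ge>1. \<beta> j > 0" and \<alpha>: "\<alpha> > 0"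
  shows "\<bar>(\<Sum>\<xi>\<in>digit_arrays {1..\<alpha> * s} {1..L}. F (array_point \<alpha> L s (\<xi> :: nat \<Rightarrow> nat \<Rightarrow> 'b::prime_card mod_ring))) /
      real CARD('b) ^ (\<alpha> * s * L) - cube_integral s F\<bar> \<le> (\<Sum>j\<in>{1..s}. \<beta> j) / real CARD('b) ^ (\<alpha> * L)"
proof -
  define n where "n = CARD('b) ^ (\<alpha> * L)"
  have n: "n \<ge> 1" unfolding n_def using card_prime_gt_1[where 'b='b] by simp
  have "(\<Sum>\<xi>\<in>digit_arrays {1..\<alpha> * s} {1..L}. F (array_point \<alpha> L s (\<xi> :: nat \<Rightarrow> nat \<Rightarrow> 'b mod_ring))) =
      (\<Sum>\<zeta>\<in>digit_arrays {1..s} (coord_positions \<alpha> L). F (\<lambda>j\<in>{1..s}. coord_value \<alpha> L ((\<zeta> :: nat \<Rightarrow> nat \<times> nat \<Rightarrow> 'b mod_ring) j)))"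
    unfolding array_point_def by (rule sum.reindex_bij_betw[OF group_digits_bij[OF \<alpha>]])
  also have "\<dots> = (\<Sum>\<zeta>\<in>digit_arrays {1..s} (coord_positions \<alpha> L).
      F (\<lambda>j\<in>{1..s}. real ((\<lambda>j\<in>{1..s}. coord_code \<alpha> L ((\<zeta> :: nat \<Rightarrow> nat \<times> nat \<Rightarrow> 'b mod_ring) j)) j) / real n))"
    by (intro sum.cong refl arg_cong[where f = F]) (auto simp: coord_value_eq_code n_def fun_eq_iff)
  also have "\<dots> = (\<Sum>g\<in>{1..s} \<rightarrow>\<^sub>E {..<n}. F (\<lambda>j\<in>{1..s}. real (g j) / real n))"
    unfolding n_def by (rule sum.reindex_bij_betw[OF bij_betw_PiE_const[OF coord_code_bij[OF \<alpha>]]])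
  finally have eq: "(\<Sum>\<xi>\<in>digit_arrays {1..\<alpha> * s} {1..L}. F (array_point \<alpha> L s (\<xi> :: nat \<Rightarrow> nat \<Rightarrow> 'b mod_ring))) =
      (\<Sum>g\<in>{1..s} \<rightarrow>\<^sub>E {..<n}. F (\<lambda>j\<in>{1..s}. real (g j) / real n))" .
  have pow: "real CARD('b) ^ (\<alpha> * s * L) = real n ^ s"
    by (simp add: n_def power_mult [symmetric] mult_ac)
  have "\<bar>(\<Sum>g\<in>{1..s} \<rightarrow>\<^sub>E {..<n}. F (\<lambda>j\<in>{1..s}. real (g j) / real n)) / real n ^ s - cube_integral s F\<bar> \<le>
      (\<Sum>j\<in>{1..s}. \<beta> j) / real n"
  proof (rule riemann_sum_cube[OF _ _ n])
    show "\<bar>F x - F y\<bar> \<le> (\<Sum>j\<in>{1..s}. \<beta> j * \<bar>x j - y j\<bar>)" if "x \<in> unit_cube s" "y \<in> unit_cube s" for x y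
      using partial_deriv_bound[OF F(2) \<beta>] \<alpha> that by (intro cube_Lipschitz[OF F(1)]) auto
    show "\<beta> j \<ge> 0" if "j \<in> {1..s}" for j using \<beta> that by (auto intro: less_imp_le)
  qed
  thus ?thesis unfolding eq pow by (simp add: n_def)
qed

section \<open>Laurent digits of rational functions and the dual net\<close>

lemma laurent_of_poly_0 [simp]: "laurent_of_poly 0 = 0"
  by (simp add: laurent_of_poly_def)

lemma laurent_of_poly_pCons: "laurent_of_poly (pCons a p) = fls_const a + fls_X_inv * laurent_of_poly p"
  by (simp add: laurent_of_poly_def Polynomial.map_poly_pCons)

lemma laurent_of_poly_add: "laurent_of_poly (p + q) = laurent_of_poly p + laurent_of_poly q"
proof (induction p arbitrary: q)
  case (pCons a p)
  obtain c r where q: "q = pCons c r" by (cases q)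
  show ?case
    by (simp add: q laurent_of_poly_pCons pCons.IH algebra_simps fls_plus_const [symmetric])
qed simp

lemma laurent_of_poly_smult: "laurent_of_poly (Polynomial.smult a p) = fls_const a * laurent_of_poly p"
proof (induction p)
  case (pCons c p)
  show ?case
    unfolding smult_pCons laurent_of_poly_pCons pCons.IH fls_const_mult_const [symmetric]
    by (simp only: distrib_left ac_simps)
qed simp

lemma laurent_of_poly_mult: "laurent_of_poly (p * q) = laurent_of_poly p * laurent_of_poly q"
proof (induction p)
  case (pCons a p)
  have "laurent_of_poly (pCons a p * q) = laurent_of_poly (Polynomial.smult a q + pCons 0 (p * q))" by simp
  thus ?case
    by (simp add: laurent_of_poly_add laurent_of_poly_smult laurent_of_poly_pCons pCons.IH algebra_simps)
qed simp

text \<open>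
  The variable of the Laurent series stands for \<open>1 / x\<close>, so a polynomial has its coefficients at the
  nonpositive places.
\<close>

lemma laurent_of_poly_nth: "fls_nth (laurent_of_poly q) n = (if n \<le> 0 then Polynomial.coeff q (nat (- n)) else 0)"
proof (induction q arbitrary: n)
  case (pCons a p)
  have eq: "fls_nth (laurent_of_poly (pCons a p)) n = (if n = 0 then a else 0) + fls_nth (laurent_of_poly p) (n + 1)"
    unfolding laurent_of_poly_pCons fls_X_inv_times_conv_shift by simp
  consider "n > 0" | "n = 0" | "n < 0" by linarith
  thus ?case
  proof cases
    case 3
    have "nat (- n) = Suc (nat (- (n + 1)))" using 3 by simp
    thus ?thesis using 3 unfolding eq pCons.IH by simp
  next
    case 2
    thus ?thesis unfolding eq pCons.IH by simp
  qed (simp_all add: eq [unfolded pCons.IH])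
qed simp

lemma laurent_of_poly_eq_0_iff [simp]: "laurent_of_poly q = 0 \<longleftrightarrow> q = 0"
proof
  assume "laurent_of_poly q = 0"
  hence "Polynomial.coeff q n = 0" for n using laurent_of_poly_nth[of q "- int n"] by simp
  thus "q = 0" by (simp add: poly_eq_iff)
qed simp

lemma fls_subdegree_laurent_of_poly: "q \<noteq> 0 \<Longrightarrow> fls_subdegree (laurent_of_poly q) = - int (Polynomial.degree q)"
  by (rule fls_subdegree_eqI) (auto simp: laurent_of_poly_nth coeff_eq_0)

text \<open>
  The coefficient of \<open>x ^ (- l)\<close> in the expansion of \<open>f / P\<close>.
\<close>

definition quot_digit :: "'b::prime_card mod_ring poly \<Rightarrow> 'b mod_ring poly \<Rightarrow> nat \<Rightarrow> 'b mod_ring" where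
  "quot_digit P f l = fls_nth (laurent_of_poly f / laurent_of_poly P) (int l)"

lemma quot_digit_0 [simp]: "quot_digit P 0 l = 0"
  by (simp add: quot_digit_def)

lemma quot_digit_add: "quot_digit P (f + g) l = quot_digit P f l + quot_digit P g l"
  by (simp add: quot_digit_def laurent_of_poly_add add_divide_distrib)

lemma quot_digit_sum: "quot_digit P (\<Sum>i\<in>A. f i) l = (\<Sum>i\<in>A. quot_digit P (f i) l)"
  by (induction A rule: infinite_finite_induct) (auto simp: quot_digit_add)

lemma quot_digit_smult: "quot_digit P (Polynomial.smult c f) l = c * quot_digit P f l"
  by (simp add: quot_digit_def laurent_of_poly_smult flip: times_divide_eq_right)

lemma quot_digit_shift: "quot_digit P (Polynomial.monom c k * f) l = c * quot_digit P f (l + k)"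
proof -
  have "quot_digit P (Polynomial.monom 1 k * f) l = quot_digit P f (l + k)" for l
  proof (induction k arbitrary: l)
    case (Suc k)
    have "Polynomial.monom 1 (Suc k) * f = pCons 0 (Polynomial.monom 1 k * f)"
      by (simp add: monom_Suc)
    hence "quot_digit P (Polynomial.monom 1 (Suc k) * f) l = quot_digit P (Polynomial.monom 1 k * f) (Suc l)"
    proof -
      have "laurent_of_poly (pCons 0 (Polynomial.monom 1 k * f)) / laurent_of_poly P =
          fls_X_inv * (laurent_of_poly (Polynomial.monom 1 k * f) / laurent_of_poly P)"
        by (simp add: laurent_of_poly_pCons)
      thus ?thesis unfolding quot_digit_def \<open>Polynomial.monom 1 (Suc k) * f = _\<close> fls_X_inv_times_conv_shift
        by (simp add: add.commute)
    qed
    thus ?case using Suc by simp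
  qed (simp add: monom_0)
  moreover have "Polynomial.monom c k * f = Polynomial.smult c (Polynomial.monom 1 k * f)"
    by (simp add: smult_monom flip: mult_smult_left)
  ultimately show ?thesis by (simp only: quot_digit_smult)
qed

lemma quot_digit_multiple:
  assumes "P \<noteq> 0" and "l \<ge> 1"
  shows "quot_digit P (P * g) l = 0"
  using assms by (simp add: quot_digit_def laurent_of_poly_mult laurent_of_poly_nth)

text \<open>
  A nonzero remainder of degree \<open>e < m\<close> has its leading Laurent coefficient at place \<open>m - e\<close>, which is one
  of the first \<open>m\<close> places.
\<close>

lemma quot_digits_zero_iff_dvd:
  assumes P: "Polynomial.degree P = m" "m \<ge> 1"
  shows "(\<forall>l\<in>{1..m}. quot_digit P f l = 0) \<longleftrightarrow> P dvd f"
proof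
  have P0: "P \<noteq> 0" using P by auto
  assume z: "\<forall>l\<in>{1..m}. quot_digit P f l = 0"
  define r where "r = f mod P"
  have f: "f = P * (f div P) + r" by (simp add: r_def)
  have r: "quot_digit P r l = 0" if "l \<in> {1..m}" for l
    using z that quot_digit_multiple[OF P0, of l "f div P"] quot_digit_add[of P "P * (f div P)" r l] f by auto
  have "r = 0"
  proof (rule ccontr)
    assume "r \<noteq> 0"
    have deg: "Polynomial.degree r < m" using degree_mod_less'[OF P0, of f] \<open>r \<noteq> 0\<close> P by (simp add: r_def)
    define l where "l = m - Polynomial.degree r"
    have "fls_subdegree (laurent_of_poly r / laurent_of_poly P) = int l"
      using \<open>r \<noteq> 0\<close> P0 deg P by (simp add: fls_divide_subdegree fls_subdegree_laurent_of_poly l_def of_nat_diff)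
    moreover have "laurent_of_poly r / laurent_of_poly P \<noteq> 0" using \<open>r \<noteq> 0\<close> P0 by simp
    ultimately have "quot_digit P r l \<noteq> 0" unfolding quot_digit_def by (metis nth_fls_subdegree_nonzero)
    moreover have "l \<in> {1..m}" using deg unfolding l_def atLeastAtMost_iff by linarith
    ultimately show False using r[of l] by simp
  qed
  thus "P dvd f" by (simp add: r_def mod_eq_0_iff_dvd)
next
  have P0: "P \<noteq> 0" using P by auto
  assume "P dvd f"
  thus "\<forall>l\<in>{1..m}. quot_digit P f l = 0" using quot_digit_multiple[OF P0] by (auto elim!: dvdE)
qed

lemma sum_lessThan_power_digits:
  fixes g :: "nat \<Rightarrow> nat \<Rightarrow> 'a::comm_semiring_1"
  assumes "b > 0"
  shows "(\<Sum>n<b ^ m. \<Prod>r<m. g r (n div b ^ r mod b)) = (\<Prod>r<m. \<Sum>z<b. g r z)"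
proof (induction m)
  case (Suc m)
  have "(\<Sum>n<b ^ Suc m. \<Prod>r<Suc m. g r (n div b ^ r mod b)) =
      (\<Sum>z<b. \<Sum>n\<in>{z * b ^ m..<z * b ^ m + b ^ m}. \<Prod>r<Suc m. g r (n div b ^ r mod b))"
    by (subst sum.nat_group) simp
  also have "\<dots> = (\<Sum>z<b. \<Sum>n<b ^ m. g m z * (\<Prod>r<m. g r (n div b ^ r mod b)))"
  proof (rule sum.cong[OF refl])
    fix z assume z: "z \<in> {..<b}"
    have "(\<Sum>n\<in>{z * b ^ m..<z * b ^ m + b ^ m}. \<Prod>r<Suc m. g r (n div b ^ r mod b)) =
        (\<Sum>n<b ^ m. \<Prod>r<Suc m. g r ((n + z * b ^ m) div b ^ r mod b))"
      by (rule sum.reindex_bij_witness[where i = "\<lambda>n. n + z * b ^ m" and j = "\<lambda>n. n - z * b ^ m"]) auto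
    also have "\<dots> = (\<Sum>n<b ^ m. g m z * (\<Prod>r<m. g r (n div b ^ r mod b)))"
    proof (intro sum.cong refl)
      fix n assume n: "n \<in> {..<b ^ m}"
      have "(n + z * b ^ m) div b ^ r mod b = n div b ^ r mod b" if "r < m" for r
      proof -
        have "b ^ m = b ^ r * (b * b ^ (m - Suc r))"
          using that by (metis Suc_diff_Suc add_diff_inverse_nat less_imp_le_nat not_less power_Suc power_add le_add_diff_inverse)
        hence "(n + z * b ^ m) div b ^ r = n div b ^ r + z * b ^ (m - Suc r) * b"
        proof -
          have eq: "n + z * b ^ m = n + z * b ^ (m - Suc r) * b * b ^ r"
            unfolding \<open>b ^ m = _\<close> by (simp only: mult_ac)
          show ?thesis unfolding eq using assms by simp
        qed
        thus ?thesis by simp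
      qed
      moreover have "(n + z * b ^ m) div b ^ m mod b = z" using n z assms by simp
      ultimately show "(\<Prod>r<Suc m. g r ((n + z * b ^ m) div b ^ r mod b)) = g m z * (\<Prod>r<m. g r (n div b ^ r mod b))"
        by (simp add: mult.commute)
    qed
    finally show "(\<Sum>n\<in>{z * b ^ m..<z * b ^ m + b ^ m}. \<Prod>r<Suc m. g r (n div b ^ r mod b)) =
        (\<Sum>n<b ^ m. g m z * (\<Prod>r<m. g r (n div b ^ r mod b)))" .
  qed
  also have "\<dots> = (\<Sum>z<b. g m z) * (\<Prod>r<m. \<Sum>z<b. g r z)"
    by (simp add: Suc sum_distrib_left [symmetric] sum_distrib_right)
  finally show ?case by (simp add: mult.commute)
qed simp

lemma sum_mod_ring_lessThan:
  "(\<Sum>z<CARD('b). f (of_nat z :: 'b::prime_card mod_ring)) = (\<Sum>z\<in>UNIV. f z)"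
proof (rule sum.reindex_bij_witness[where i = "\<lambda>z. nat (to_int_mod_ring z)" and j = of_nat])
  fix z assume "z \<in> {..<CARD('b)}"
  hence "to_int_mod_ring (of_nat z :: 'b mod_ring) = int z"
    by (metis lessThan_iff of_int_of_int_mod_ring of_int_of_nat_eq of_nat_0_le_iff of_nat_less_iff to_int_mod_ring_of_int_mod_ring)
  thus "nat (to_int_mod_ring (of_nat z :: 'b mod_ring)) = z" by simp
next
  fix z :: "'b mod_ring"
  have "of_nat (nat (to_int_mod_ring z)) = (of_int (to_int_mod_ring z) :: 'b mod_ring)"
    using to_int_mod_ring_range(1)[of z] by (metis nat_0_le of_int_of_nat_eq)
  thus "of_nat (nat (to_int_mod_ring z)) = z"
    by (simp add: of_int_of_int_mod_ring)
  show "nat (to_int_mod_ring z) \<in> {..<CARD('b)}" using to_int_mod_ring_range[of z] by (simp add: nat_less_iff)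
qed auto

text \<open>
  Orthogonality on the polynomials \<open>n\<close> of degree below \<open>m\<close>: the first digit of \<open>n * f / P\<close> is a linear form in
  the coefficients of \<open>n\<close> whose own coefficients are the first \<open>m\<close> digits of \<open>f / P\<close>.
\<close>

lemma sum_add_char_quot_digit:
  fixes P f :: "'b::prime_card mod_ring poly"
  assumes P: "Polynomial.degree P = m" "m \<ge> 1"
  shows "(\<Sum>n<CARD('b) ^ m. add_char (quot_digit P (poly_of_index m n * f) 1)) =
    (if P dvd f then of_nat (CARD('b) ^ m) else 0)"
proof -
  let ?b = "CARD('b)"
  have "quot_digit P (poly_of_index m n * f) 1 = (\<Sum>r<m. of_nat (n div ?b ^ r mod ?b) * quot_digit P f (Suc r))" for n
    unfolding poly_of_index_def sum_distrib_right quot_digit_sum quot_digit_shift by simp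
  hence "(\<Sum>n<?b ^ m. add_char (quot_digit P (poly_of_index m n * f) 1)) =
      (\<Sum>n<?b ^ m. \<Prod>r<m. add_char (of_nat (n div ?b ^ r mod ?b) * quot_digit P f (Suc r)))"
    by (simp add: add_char_sum)
  also have "\<dots> = (\<Prod>r<m. \<Sum>z<?b. add_char (of_nat z * quot_digit P f (Suc r)))"
    by (rule sum_lessThan_power_digits) simp
  also have "\<dots> = (\<Prod>r<m. \<Sum>z\<in>UNIV. add_char (quot_digit P f (Suc r) * z))"
    by (subst sum_mod_ring_lessThan) (simp add: mult.commute)
  also have "\<dots> = (\<Prod>r<m. if quot_digit P f (Suc r) = 0 then of_nat ?b else 0)"
    by (simp only: sum_add_char)
  also have "\<dots> = (if \<forall>r<m. quot_digit P f (Suc r) = 0 then of_nat (?b ^ m) else 0)"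
  proof (cases "\<forall>r<m. quot_digit P f (Suc r) = 0")
    case False
    then obtain r where "r < m" "quot_digit P f (Suc r) \<noteq> 0" by blast
    hence "(\<Prod>r<m. if quot_digit P f (Suc r) = 0 then of_nat ?b else 0) = (0 :: complex)"
      by (intro prod_zero) auto
    thus ?thesis using False by simp
  qed simp
  also have "(\<forall>r<m. quot_digit P f (Suc r) = 0) \<longleftrightarrow> (\<forall>l\<in>{1..m}. quot_digit P f l = 0)"
    by (metis Suc_le_eq atLeastAtMost_iff One_nat_def Suc_pred' le_add1 plus_1_eq_Suc less_le_trans zero_less_Suc)
  also have "\<dots> \<longleftrightarrow> P dvd f" by (rule quot_digits_zero_iff_dvd[OF P])
  finally show ?thesis .
qed

text \<open>
  The digits of the lattice points. All digits after the first \<open>m\<close> vanish, by the truncation of the Laurent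
  series.
\<close>

definition net_array :: "nat \<Rightarrow> nat \<Rightarrow> nat \<Rightarrow> 'b::prime_card mod_ring poly \<Rightarrow> (nat \<Rightarrow> 'b mod_ring poly) \<Rightarrow>
    nat \<Rightarrow> nat \<Rightarrow> nat \<Rightarrow> 'b mod_ring" where
  "net_array d L m P q n = (\<lambda>J\<in>{1..d}. \<lambda>a\<in>{1..L}. if a \<le> m then quot_digit P (poly_of_index m n * q J) a else 0)"

definition digit_poly :: "nat \<Rightarrow> (nat \<Rightarrow> 'b::prime_card mod_ring) \<Rightarrow> 'b mod_ring poly" where
  "digit_poly m k = (\<Sum>a\<in>{1..m}. Polynomial.monom (k a) (a - 1))"

text \<open>
  A frequency belongs to the dual net if and only if \<open>P\<close> divides this polynomial. Only the first \<open>m\<close> digits of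
  each component enter.
\<close>

definition dual_poly :: "nat \<Rightarrow> nat \<Rightarrow> (nat \<Rightarrow> nat \<Rightarrow> 'b::prime_card mod_ring) \<Rightarrow> (nat \<Rightarrow> 'b mod_ring poly) \<Rightarrow> 'b mod_ring poly" where
  "dual_poly d m \<kappa> q = (\<Sum>J\<in>{1..d}. digit_poly m (\<kappa> J) * q J)"

lemma net_array_in: "net_array d L m P q n \<in> digit_arrays {1..d} {1..L}"
  by (simp add: net_array_def restrict_PiE_iff)

text \<open>
  Multiplication by \<open>x ^ (a - 1)\<close> moves digit \<open>a\<close> to the first place, so the sum of all products of frequency
  and point digits is the first digit of one rational function.
\<close>

lemma net_character_sum:
  fixes P :: "'b::prime_card mod_ring poly"
  assumes P: "Polynomial.degree P = m" "m \<ge> 1" and L: "m \<le> L"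
  shows "(\<Sum>n<CARD('b) ^ m. wal {1..d} {1..L} \<kappa> (net_array d L m P q n)) / of_nat (CARD('b) ^ m) =
    (if P dvd dual_poly d m \<kappa> q then 1 else 0)"
proof -
  have "wal {1..d} {1..L} \<kappa> (net_array d L m P q n) = add_char (quot_digit P (poly_of_index m n * dual_poly d m \<kappa> q) 1)" for n
  proof -
    have "wal {1..d} {1..L} \<kappa> (net_array d L m P q n) =
        add_char (\<Sum>J\<in>{1..d}. \<Sum>a\<in>{1..L}. \<kappa> J a * net_array d L m P q n J a)"
      by (simp add: wal_def add_char_sum)
    also have "(\<Sum>J\<in>{1..d}. \<Sum>a\<in>{1..L}. \<kappa> J a * net_array d L m P q n J a) =
        (\<Sum>J\<in>{1..d}. \<Sum>a\<in>{1..m}. \<kappa> J a * quot_digit P (poly_of_index m n * q J) a)"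
    proof (rule sum.cong[OF refl])
      fix J assume J: "J \<in> {1..d}"
      show "(\<Sum>a\<in>{1..L}. \<kappa> J a * net_array d L m P q n J a) =
          (\<Sum>a\<in>{1..m}. \<kappa> J a * quot_digit P (poly_of_index m n * q J) a)"
        using J L by (intro sum.mono_neutral_cong_right) (auto simp: net_array_def)
    qed
    also have "\<dots> = quot_digit P (poly_of_index m n * dual_poly d m \<kappa> q) 1"
    proof -
      have "poly_of_index m n * dual_poly d m \<kappa> q =
          (\<Sum>J\<in>{1..d}. \<Sum>a\<in>{1..m}. Polynomial.monom (\<kappa> J a) (a - 1) * (poly_of_index m n * q J))"
        unfolding dual_poly_def digit_poly_def sum_distrib_left sum_distrib_right
        by (intro sum.cong refl) (simp add: mult_ac)
      thus ?thesis unfolding quot_digit_sum quot_digit_shift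
        by (simp add: quot_digit_sum quot_digit_shift)
    qed
    finally show ?thesis .
  qed
  thus ?thesis using sum_add_char_quot_digit[OF P, of "dual_poly d m \<kappa> q"] by simp
qed

section \<open>Digits of the quadrature points\<close>

lemma digits_tail_bounds:
  fixes D :: "nat \<Rightarrow> int"
  assumes "\<And>l. 0 \<le> D l" "\<And>l. D l < int b" "b > 0"
  shows "0 \<le> (\<Sum>l\<in>{a<..a + k}. real_of_int (D l) / real b ^ l)"
    "(\<Sum>l\<in>{a<..a + k}. real_of_int (D l) / real b ^ l) \<le> 1 / real b ^ a - 1 / real b ^ (a + k)"
proof -
  show "0 \<le> (\<Sum>l\<in>{a<..a + k}. real_of_int (D l) / real b ^ l)"
    using assms by (intro sum_nonneg) auto
  show "(\<Sum>l\<in>{a<..a + k}. real_of_int (D l) / real b ^ l) \<le> 1 / real b ^ a - 1 / real b ^ (a + k)"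
  proof (induction k)
    case (Suc k)
    have "{a<..a + Suc k} = insert (a + Suc k) {a<..a + k}" by auto
    hence "(\<Sum>l\<in>{a<..a + Suc k}. real_of_int (D l) / real b ^ l) =
        real_of_int (D (a + Suc k)) / real b ^ (a + Suc k) + (\<Sum>l\<in>{a<..a + k}. real_of_int (D l) / real b ^ l)"
      by simp
    also have "real_of_int (D (a + Suc k)) \<le> real b - 1" using assms(2)[of "a + Suc k"] by linarith
    hence "real_of_int (D (a + Suc k)) / real b ^ (a + Suc k) \<le> (real b - 1) / real b ^ (a + Suc k)"
      using assms by (intro divide_right_mono) auto
    also have "(real b - 1) / real b ^ (a + Suc k) = 1 / real b ^ (a + k) - 1 / real b ^ (a + Suc k)"
      using assms by (simp add: field_simps)
    finally show ?case using Suc by linarith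
  qed simp
qed

text \<open>
  Multiplication by \<open>b ^ a\<close> puts the first \<open>a\<close> digits in front of the point. Finite expansions with digits
  below \<open>b\<close> leave a fractional part less than one.
\<close>

lemma frac_digit_expansion:
  fixes D :: "nat \<Rightarrow> int"
  assumes D: "\<And>l. 0 \<le> D l" "\<And>l. D l < int b" and b: "b > 0" and "a \<ge> 1"
    and zero: "\<And>l. l > m \<Longrightarrow> D l = 0"
  shows "frac_digit b (\<Sum>l\<in>{1..m}. real_of_int (D l) / real b ^ l) a = D a"
proof -
  define T where "T = (\<Sum>l\<in>{a<..a + m}. real_of_int (D l) / real b ^ l)"
  define I where "I = (\<Sum>l\<in>{1..a}. D l * int b ^ (a - l))"
  have "(\<Sum>l\<in>{1..m}. real_of_int (D l) / real b ^ l) = (\<Sum>l\<in>{1..a + m}. real_of_int (D l) / real b ^ l)"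
    using zero by (intro sum.mono_neutral_left) auto
  also have "{1..a + m} = {1..a} \<union> {a<..a + m}" by auto
  also have "(\<Sum>l\<in>{1..a} \<union> {a<..a + m}. real_of_int (D l) / real b ^ l) = (\<Sum>l\<in>{1..a}. real_of_int (D l) / real b ^ l) + T"
    unfolding T_def by (intro sum.union_disjoint) auto
  finally have "(\<Sum>l\<in>{1..m}. real_of_int (D l) / real b ^ l) * real b ^ a =
      (\<Sum>l\<in>{1..a}. real_of_int (D l) / real b ^ l) * real b ^ a + T * real b ^ a"
    by (simp add: distrib_right)
  also have "(\<Sum>l\<in>{1..a}. real_of_int (D l) / real b ^ l) * real b ^ a = real_of_int I"
    unfolding I_def of_int_sum sum_distrib_right
  proof (intro sum.cong refl)
    fix l assume "l \<in> {1..a}"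
    hence "real b ^ a = real b ^ (a - l) * real b ^ l" by (simp flip: power_add)
    thus "real_of_int (D l) / real b ^ l * real b ^ a = real_of_int (D l * int b ^ (a - l))" using b by simp
  qed
  finally have eq: "(\<Sum>l\<in>{1..m}. real_of_int (D l) / real b ^ l) * real b ^ a = real_of_int I + T * real b ^ a" .
  have "0 \<le> T" "T \<le> 1 / real b ^ a - 1 / real b ^ (a + m)"
    using digits_tail_bounds[OF D b] by (auto simp: T_def)
  moreover have "1 / real b ^ (a + m) > 0" using b by simp
  ultimately have "0 \<le> T" "T < 1 / real b ^ a" by linarith+
  hence "0 \<le> T * real b ^ a" "T * real b ^ a < 1" using b by (auto simp: field_simps)
  hence "\<lfloor>(\<Sum>l\<in>{1..m}. real_of_int (D l) / real b ^ l) * real b ^ a\<rfloor> = I"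
    unfolding eq by (intro floor_unique) auto
  moreover have "I mod int b = D a"
  proof -
    have "{1..a} = insert a {1..<a}" using \<open>a \<ge> 1\<close> by auto
    hence "I = D a + (\<Sum>l\<in>{1..<a}. D l * int b ^ (a - l))" by (simp add: I_def)
    also have "(\<Sum>l\<in>{1..<a}. D l * int b ^ (a - l)) = int b * (\<Sum>l\<in>{1..<a}. D l * int b ^ (a - l - 1))"
      unfolding sum_distrib_left
    proof (intro sum.cong refl)
      fix l assume "l \<in> {1..<a}"
      hence "a - l = Suc (a - l - 1)" by auto
      hence "int b ^ (a - l) = int b * int b ^ (a - l - 1)" by (metis power_Suc)
      thus "D l * int b ^ (a - l) = int b * (D l * int b ^ (a - l - 1))" by simp
    qed
    finally show ?thesis using D by simp
  qed
  ultimately show ?thesis by (simp add: frac_digit_def)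
qed

lemma frac_digit_lattice_coord:
  assumes "a \<ge> 1"
  shows "frac_digit CARD('b) (lattice_coord m P n (q :: 'b::prime_card mod_ring poly)) a =
    to_int_mod_ring (if a \<le> m then quot_digit P (poly_of_index m n * q) a else 0)"
proof -
  define D where "D = (\<lambda>a. to_int_mod_ring (if a \<le> m then quot_digit P (poly_of_index m n * q) a else 0))"
  have "lattice_coord m P n q = (\<Sum>l\<in>{1..m}. real_of_int (D l) / real CARD('b) ^ l)"
    unfolding lattice_coord_def v_trunc_def D_def quot_digit_def by (intro sum.cong) auto
  moreover have "frac_digit CARD('b) (\<Sum>l\<in>{1..m}. real_of_int (D l) / real CARD('b) ^ l) a = D a"
    using assms by (intro frac_digit_expansion) (auto simp: D_def to_int_mod_ring_range)
  ultimately show ?thesis by (simp add: D_def)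
qed

lemma interlaced_point_eq_array_point:
  assumes "m \<le> L" and "\<alpha> > 0"
  shows "interlaced_point \<alpha> s m P q n = array_point \<alpha> L s (net_array (\<alpha> * s) L m P (q :: nat \<Rightarrow> 'b::prime_card mod_ring poly) n)"
  unfolding interlaced_point_def array_point_def
proof (rule restrict_ext)
  fix j assume j: "j \<in> {1..s}"
  let ?b = "real CARD('b)"
  let ?y = "\<lambda>i. lattice_coord m P n (q (\<alpha> * (j - 1) + i))"
  define X where "X = (\<lambda>i a. real_of_int (to_int_mod_ring (if a \<le> m then quot_digit P (poly_of_index m n * q (\<alpha> * (j - 1) + i)) a else 0)))"
  have "interlace CARD('b) \<alpha> ?y = (\<Sum>a. \<Sum>i=1..\<alpha>. X i (Suc a) / ?b ^ (i + a * \<alpha>))"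
    unfolding interlace_def by (subst frac_digit_lattice_coord) (auto simp: X_def)
  also have "\<dots> = (\<Sum>a<L. \<Sum>i=1..\<alpha>. X i (Suc a) / ?b ^ (i + a * \<alpha>))"
    using assms by (intro suminf_finite) (auto simp: X_def)
  also have "\<dots> = (\<Sum>a\<in>{1..L}. \<Sum>i\<in>{1..\<alpha>}. X i a / ?b ^ (i + (a - 1) * \<alpha>))"
    by (rule sum.reindex_bij_witness[where i = "\<lambda>a. a - 1" and j = Suc]) auto
  also have "\<dots> = (\<Sum>t\<in>coord_positions \<alpha> L. X (fst t) (snd t) * (1 / ?b ^ position \<alpha> t))"
    by (subst sum.swap) (simp add: sum.cartesian_product case_prod_unfold position_def)
  also have "\<dots> = coord_value \<alpha> L (group_digits \<alpha> L s (net_array (\<alpha> * s) L m P q n) j)"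
    unfolding coord_value_def
  proof (intro sum.cong refl)
    fix t assume t: "t \<in> coord_positions \<alpha> L"
    have "\<alpha> * (j - 1) + fst t \<in> {1..\<alpha> * s}"
      using bij_betwE[OF component_bij[OF assms(2), of s]] j t by fastforce
    thus "X (fst t) (snd t) * (1 / ?b ^ position \<alpha> t) =
        real_of_int (to_int_mod_ring (group_digits \<alpha> L s (net_array (\<alpha> * s) L m P q n) j t)) * (1 / ?b ^ position \<alpha> t)"
      using j t by (auto simp: X_def group_digits_def net_array_def)
  qed
  finally show "interlace CARD('b) \<alpha> ?y = coord_value \<alpha> L (group_digits \<alpha> L s (net_array (\<alpha> * s) L m P q n) j)" .
qed

section \<open>Character sums over digit vectors of a given level\<close>

abbreviation digit_vectors :: "nat \<Rightarrow> (nat \<Rightarrow> 'b mod_ring) set" where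
  "digit_vectors L \<equiv> {1..L} \<rightarrow>\<^sub>E UNIV"

lemma finite_digit_vectors [simp]: "finite Q \<Longrightarrow> finite (Q \<rightarrow>\<^sub>E (UNIV :: 'b::prime_card mod_ring set))"
  by (intro finite_PiE) auto

lemma level_set_eq_PiE:
  assumes "a \<in> {1..L}"
  shows "{k \<in> digit_vectors L. level L (k :: nat \<Rightarrow> 'b::prime_card mod_ring) = a} =
    (\<Pi>\<^sub>E c\<in>{1..L}. if c < a then UNIV else if c = a then UNIV - {0} else {0})" (is "?A = ?B")
proof (intro equalityI subsetI)
  fix k assume "k \<in> ?A"
  hence k: "k \<in> digit_vectors L" "level L k = a" by auto
  have "k c = 0" if "c \<in> {1..L}" "c > a" for c
  proof (rule ccontr)
    assume "k c \<noteq> 0"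
    hence "c \<le> level L k" unfolding level_def using that by (intro Max_ge) auto
    thus False using k that by simp
  qed
  moreover have "k a \<noteq> 0" using level_nonzero(2)[of L k] k assms by auto
  ultimately show "k \<in> ?B" using k(1) by (auto simp: PiE_iff)
next
  fix k assume k: "k \<in> ?B"
  hence k0: "k a \<noteq> 0" using assms PiE_mem[OF k, of a] by auto
  have kc: "k c = 0" if "c \<in> {1..L}" "c > a" for c using PiE_mem[OF k that(1)] that by auto
  have "level L k = a"
    unfolding level_def
  proof (rule Max_eqI)
    fix c assume "c \<in> insert 0 {c \<in> {1..L}. k c \<noteq> 0}"
    thus "c \<le> a" using kc[of c] by (cases "c \<le> a") auto
  qed (use k0 assms in auto)
  moreover have "k \<in> digit_vectors L" using k by (auto simp: PiE_iff)
  ultimately show "k \<in> ?A" by simp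
qed

definition zero_vector :: "nat \<Rightarrow> nat \<Rightarrow> 'b::prime_card mod_ring" where
  "zero_vector L = (\<lambda>a\<in>{1..L}. 0)"

lemma level_eq_0_iff_zero_vector: "k \<in> digit_vectors L \<Longrightarrow> level L k = 0 \<longleftrightarrow> k = zero_vector L"
  unfolding level_eq_0_iff zero_vector_def
  by (auto simp: fun_eq_iff PiE_iff extensional_def)

lemma level_zero_vector [simp]: "level L (zero_vector L) = 0"
  by (simp add: level_eq_0_iff zero_vector_def)

lemma zero_vector_in [simp]: "zero_vector L \<in> digit_vectors L"
  by (simp add: zero_vector_def restrict_PiE_iff)

lemma sum_level_sets:
  fixes f :: "(nat \<Rightarrow> 'b::prime_card mod_ring) \<Rightarrow> 'c::comm_monoid_add"
  shows "(\<Sum>k\<in>digit_vectors L - {zero_vector L}. f k) = (\<Sum>a\<in>{1..L}. \<Sum>k\<in>{k \<in> digit_vectors L. level L k = a}. f k)"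
proof -
  have "(\<Sum>a\<in>{1..L}. \<Sum>k\<in>{k \<in> digit_vectors L. level L k = a}. f k) =
      (\<Sum>a\<in>{1..L}. \<Sum>k\<in>{k \<in> digit_vectors L - {zero_vector L}. level L k = a}. f k)"
    by (intro sum.cong refl) (auto simp: level_eq_0_iff_zero_vector[symmetric])
  also have "\<dots> = (\<Sum>k\<in>digit_vectors L - {zero_vector L}. f k)"
  proof (rule sum.group)
    show "level L ` (digit_vectors L - {zero_vector L} :: (nat \<Rightarrow> 'b mod_ring) set) \<subseteq> {1..L}"
    proof (rule image_subsetI)
      fix k :: "nat \<Rightarrow> 'b mod_ring" assume "k \<in> digit_vectors L - {zero_vector L}"
      hence "level L k \<noteq> 0" using level_eq_0_iff_zero_vector by blast
      thus "level L k \<in> {1..L}" by (rule level_nonzero)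
    qed
  qed auto
  finally show ?thesis ..
qed

text \<open>
  On the vectors of level \<open>a\<close> the digits before \<open>a\<close> are free, digit \<open>a\<close> is nonzero, and the later ones vanish,
  so the character sum is a product of sums over single digits.
\<close>

lemma level_character_sum:
  fixes \<xi> :: "nat \<Rightarrow> 'b::prime_card mod_ring"
  assumes a: "a \<in> {1..L}"
  shows "(\<Sum>k\<in>{k \<in> digit_vectors L. level L k = a}. \<Prod>c\<in>{1..L}. add_char (k c * \<xi> c)) =
    (if \<forall>c\<in>{1..<a}. \<xi> c = 0 then of_nat CARD('b) ^ (a - 1) * (if \<xi> a = 0 then of_nat CARD('b) - 1 else - 1) else 0)"
proof -
  let ?B = "\<lambda>c. if c < a then UNIV else if c = a then UNIV - {0} else {0 :: 'b mod_ring}"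
  define S where "S = (\<lambda>c. \<Sum>z\<in>?B c. add_char (z * \<xi> c))"
  have all: "(\<Sum>z\<in>UNIV. add_char (z * \<xi> c)) = (if \<xi> c = 0 then of_nat CARD('b) else 0)" for c
    by (subst mult.commute) (rule sum_add_char)
  have S1: "S c = (if \<xi> c = 0 then of_nat CARD('b) else 0)" if "c < a" for c
    using that all by (simp add: S_def)
  have S2: "S a = (if \<xi> a = 0 then of_nat CARD('b) - 1 else - 1)"
    using all[of a] by (simp add: S_def sum_diff1)
  have S3: "S c = 1" if "c > a" for c using that by (simp add: S_def)
  have "(\<Sum>k\<in>{k \<in> digit_vectors L. level L k = a}. \<Prod>c\<in>{1..L}. add_char (k c * \<xi> c)) = (\<Prod>c\<in>{1..L}. S c)"
    unfolding level_set_eq_PiE[OF a] S_def by (rule prod_sum_PiE [symmetric]) auto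
  also have "\<dots> = (\<Prod>c\<in>{1..<a}. S c) * S a"
  proof -
    have "{1..L} = {1..<a} \<union> ({a} \<union> {a<..L})" using a by auto
    moreover have "(\<Prod>c\<in>{1..<a} \<union> ({a} \<union> {a<..L}). S c) = (\<Prod>c\<in>{1..<a}. S c) * S a"
      by (subst prod.union_disjoint; (simp add: S3)?; auto)
    ultimately show ?thesis by metis
  qed
  also have "(\<Prod>c\<in>{1..<a}. S c) = (\<Prod>c\<in>{1..<a}. if \<xi> c = 0 then of_nat CARD('b) else 0)"
    by (intro prod.cong refl S1) auto
  also have "\<dots> = (if \<forall>c\<in>{1..<a}. \<xi> c = 0 then of_nat CARD('b) ^ (a - 1) else 0)"
  proof (cases "\<forall>c\<in>{1..<a}. \<xi> c = 0")
    case False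
    hence "(\<Prod>c\<in>{1..<a}. if \<xi> c = 0 then of_nat CARD('b) else 0) = (0 :: complex)"
      by (intro prod_zero) auto
    thus ?thesis using False by simp
  qed simp
  finally show ?thesis unfolding S2 by simp
qed

lemma card_level_set:
  assumes "a \<in> {1..L}"
  shows "card {k \<in> digit_vectors L. level L (k :: nat \<Rightarrow> 'b::prime_card mod_ring) = a} = CARD('b) ^ (a - 1) * (CARD('b) - 1)"
proof -
  have "complex_of_nat (card {k \<in> digit_vectors L. level L (k :: nat \<Rightarrow> 'b mod_ring) = a}) =
      of_nat (CARD('b) ^ (a - 1) * (CARD('b) - 1))"
    using level_character_sum[OF assms, of "\<lambda>_. 0 :: 'b mod_ring"] card_prime_gt_1[where 'b='b]
    by (simp add: of_nat_diff)
  thus ?thesis using of_nat_eq_iff by blast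
qed

text \<open>
  Expanding a product over the components into the choice, for each component, of the zero vector or of a
  nonzero one; the set of components with a nonzero choice is the support.
\<close>

lemma sum_by_support:
  fixes h :: "nat \<Rightarrow> (nat \<Rightarrow> 'b::prime_card mod_ring) \<Rightarrow> 'c::comm_semiring_1"
  assumes h: "\<And>J. h J (zero_vector L) = 1"
  shows "(\<Sum>\<kappa>\<in>digit_arrays {1..d} {1..L}. c (support L d \<kappa>) * (\<Prod>J\<in>{1..d}. h J (\<kappa> J))) =
    (\<Sum>w\<in>Pow {1..d}. c w * (\<Prod>J\<in>w. \<Sum>k\<in>digit_vectors L - {zero_vector L}. h J k))"
proof -
  let ?K = "digit_arrays {1..d} {1..L} :: (nat \<Rightarrow> nat \<Rightarrow> 'b mod_ring) set"
  let ?V = "digit_vectors L :: (nat \<Rightarrow> 'b mod_ring) set"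
  have finK: "finite ?K" by (rule finite_digit_arrays) auto
  have "(\<Sum>\<kappa>\<in>?K. c (support L d \<kappa>) * (\<Prod>J\<in>{1..d}. h J (\<kappa> J))) =
      (\<Sum>w\<in>Pow {1..d}. \<Sum>\<kappa>\<in>{\<kappa> \<in> ?K. support L d \<kappa> = w}. c (support L d \<kappa>) * (\<Prod>J\<in>{1..d}. h J (\<kappa> J)))"
  proof (rule sum.group [symmetric])
    show "support L d ` ?K \<subseteq> Pow {1..d}" by (auto simp: support_def)
  qed (use finK in auto)
  also have "\<dots> = (\<Sum>w\<in>Pow {1..d}. c w * (\<Prod>J\<in>w. \<Sum>k\<in>?V - {zero_vector L}. h J k))"
  proof (rule sum.cong[OF refl])
    fix w assume w: "w \<in> Pow {1..d}"
    let ?B = "\<lambda>J. if J \<in> w then ?V - {zero_vector L} else {zero_vector L}"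
    have set: "{\<kappa> \<in> ?K. support L d \<kappa> = w} = (\<Pi>\<^sub>E J\<in>{1..d}. ?B J)"
    proof (intro equalityI subsetI)
      fix \<kappa> assume "\<kappa> \<in> {\<kappa> \<in> ?K. support L d \<kappa> = w}"
      hence \<kappa>: "\<kappa> \<in> ?K" "support L d \<kappa> = w" by auto
      show "\<kappa> \<in> (\<Pi>\<^sub>E J\<in>{1..d}. ?B J)"
      proof (rule PiE_I)
        fix J assume J: "J \<in> {1..d}"
        have V: "\<kappa> J \<in> ?V" using PiE_mem[OF \<kappa>(1) J] .
        have "J \<in> w \<longleftrightarrow> level L (\<kappa> J) \<noteq> 0" using \<kappa>(2) J by (auto simp: support_def)
        thus "\<kappa> J \<in> ?B J" using V level_eq_0_iff_zero_vector[OF V] by auto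
      qed (use PiE_arb[OF \<kappa>(1)] in blast)
    next
      fix \<kappa> assume \<kappa>: "\<kappa> \<in> (\<Pi>\<^sub>E J\<in>{1..d}. ?B J)"
      have B: "\<kappa> J \<in> ?B J" if "J \<in> {1..d}" for J using PiE_mem[OF \<kappa> that] .
      have V: "\<kappa> J \<in> ?V" if "J \<in> {1..d}" for J
        using B[OF that] by (cases "J \<in> w") (auto simp: zero_vector_def restrict_PiE_iff)
      have "\<kappa> \<in> ?K" by (rule PiE_I) (use V PiE_arb[OF \<kappa>] in blast)+
      moreover have "J \<in> support L d \<kappa> \<longleftrightarrow> J \<in> w" for J
      proof (cases "J \<in> {1..d}")
        case True
        have "level L (\<kappa> J) = 0 \<longleftrightarrow> \<kappa> J = zero_vector L" using V[OF True] by (rule level_eq_0_iff_zero_vector)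
        thus ?thesis using B[OF True] True by (auto simp: support_def split: if_splits)
      next
        case False
        thus ?thesis using w by (auto simp: support_def)
      qed
      ultimately show "\<kappa> \<in> {\<kappa> \<in> ?K. support L d \<kappa> = w}" by blast
    qed
    have "(\<Sum>\<kappa>\<in>{\<kappa> \<in> ?K. support L d \<kappa> = w}. c (support L d \<kappa>) * (\<Prod>J\<in>{1..d}. h J (\<kappa> J))) =
        (\<Sum>\<kappa>\<in>{\<kappa> \<in> ?K. support L d \<kappa> = w}. c w * (\<Prod>J\<in>{1..d}. h J (\<kappa> J)))"
      by (rule sum.cong) auto
    also have "\<dots> = c w * (\<Sum>\<kappa>\<in>(\<Pi>\<^sub>E J\<in>{1..d}. ?B J). \<Prod>J\<in>{1..d}. h J (\<kappa> J))"
      unfolding set sum_distrib_left ..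
    also have "(\<Sum>\<kappa>\<in>(\<Pi>\<^sub>E J\<in>{1..d}. ?B J). \<Prod>J\<in>{1..d}. h J (\<kappa> J)) = (\<Prod>J\<in>{1..d}. \<Sum>k\<in>?B J. h J k)"
      by (rule prod_sum_PiE [symmetric]) auto
    also have "\<dots> = (\<Prod>J\<in>{1..d}. if J \<in> w then \<Sum>k\<in>?V - {zero_vector L}. h J k else 1)"
      by (intro prod.cong refl) (auto simp: h)
    also have "\<dots> = (\<Prod>J\<in>{J \<in> {1..d}. J \<in> w}. \<Sum>k\<in>?V - {zero_vector L}. h J k)"
      by (rule prod.inter_filter [symmetric]) simp
    also have "{J \<in> {1..d}. J \<in> w} = w" using w by auto
    finally show "(\<Sum>\<kappa>\<in>{\<kappa> \<in> ?K. support L d \<kappa> = w}. c (support L d \<kappa>) * (\<Prod>J\<in>{1..d}. h J (\<kappa> J))) =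
        c w * (\<Prod>J\<in>w. \<Sum>k\<in>?V - {zero_vector L}. h J k)" .
  qed
  finally show ?thesis .
qed

lemma decay_eq: "decay \<alpha> L d \<kappa> = (\<Prod>J\<in>{1..d}. 1 / real CARD('b) ^ (\<alpha> * level L (\<kappa> J :: nat \<Rightarrow> 'b::prime_card mod_ring)))"
  unfolding decay_def support_def by (rule prod.mono_neutral_left) auto

section \<open>The figure of merit as a sum over the dual net\<close>

text \<open>
  The character series of \<open>omega\<close> restricted to frequencies with at most \<open>L\<close> digits.
\<close>

definition omega_trunc :: "nat \<Rightarrow> nat \<Rightarrow> (nat \<Rightarrow> 'b::prime_card mod_ring) \<Rightarrow> complex" where
  "omega_trunc \<alpha> L \<xi> = (\<Sum>k\<in>digit_vectors L - {zero_vector L}.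
     of_real (1 / real CARD('b) ^ (\<alpha> * level L k)) * (\<Prod>a\<in>{1..L}. add_char (k a * \<xi> a)))"

text \<open>
  The sum of the bounds on the Fourier coefficients over the nonzero part of the dual net, again for
  frequencies with at most \<open>L\<close> digits per component.
\<close>

definition merit_trunc :: "nat \<Rightarrow> (nat set \<Rightarrow> real) \<Rightarrow> nat \<Rightarrow> nat \<Rightarrow> 'b::prime_card mod_ring poly \<Rightarrow> nat \<Rightarrow>
    (nat \<Rightarrow> 'b mod_ring poly) \<Rightarrow> real" where
  "merit_trunc \<alpha> \<gamma> L m P d q = (\<Sum>\<kappa>\<in>digit_arrays {1..d} {1..L} - {zero_array {1..d} {1..L}}.
     interlaced_weight CARD('b) \<alpha> \<gamma> (support L d \<kappa>) * decay \<alpha> L d \<kappa> * of_bool (P dvd dual_poly d m \<kappa> q))"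

lemma support_zero_array [simp]: "support L d (zero_array {Suc 0..d} {Suc 0..L}) = {}"
  by (simp add: support_def level_eq_0_iff zero_array_def)

lemma support_empty_iff:
  assumes "\<kappa> \<in> digit_arrays {1..d} {1..L}"
  shows "support L d \<kappa> = {} \<longleftrightarrow> \<kappa> = zero_array {1..d} {1..L}"
proof
  assume "support L d \<kappa> = {}"
  thus "\<kappa> = zero_array {1..d} {1..L}"
    by (intro digit_arrays_eqI[OF assms zero_array_in]) (auto simp: support_def level_eq_0_iff zero_array_def)
qed simp

lemma merit_trunc_eq_omega_trunc:
  fixes P :: "'b::prime_card mod_ring poly"
  assumes P: "Polynomial.degree P = m" "m \<ge> 1" and L: "m \<le> L"
  shows "complex_of_real (merit_trunc \<alpha> \<gamma> L m P d q) =
    (\<Sum>n<CARD('b) ^ m. \<Sum>w\<in>Pow {1..d} - {{}}. of_real (interlaced_weight CARD('b) \<alpha> \<gamma> w) *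
      (\<Prod>J\<in>w. omega_trunc \<alpha> L (net_array d L m P q n J))) / of_nat (CARD('b) ^ m)"
proof -
  let ?K = "digit_arrays {1..d} {1..L} :: (nat \<Rightarrow> nat \<Rightarrow> 'b mod_ring) set"
  let ?z = "zero_array {1..d} {1..L} :: nat \<Rightarrow> nat \<Rightarrow> 'b mod_ring"
  define c where "c = (\<lambda>w. if w = {} then 0 else complex_of_real (interlaced_weight CARD('b) \<alpha> \<gamma> w))"
  define N where "N = (of_nat (CARD('b) ^ m) :: complex)"
  have finK: "finite ?K" by (rule finite_digit_arrays) auto
  have "complex_of_real (merit_trunc \<alpha> \<gamma> L m P d q) =
      (\<Sum>\<kappa>\<in>?K - {?z}. c (support L d \<kappa>) * of_real (decay \<alpha> L d \<kappa>) * (if P dvd dual_poly d m \<kappa> q then 1 else 0))"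
    unfolding merit_trunc_def of_real_sum
    by (intro sum.cong refl) (auto simp: c_def support_empty_iff)
  also have "\<dots> = (\<Sum>\<kappa>\<in>?K. c (support L d \<kappa>) * of_real (decay \<alpha> L d \<kappa>) * (if P dvd dual_poly d m \<kappa> q then 1 else 0))"
    using finK by (intro sum.mono_neutral_left) (auto simp: c_def)
  also have "\<dots> = (\<Sum>\<kappa>\<in>?K. \<Sum>n<CARD('b) ^ m. c (support L d \<kappa>) * of_real (decay \<alpha> L d \<kappa>) *
      wal {1..d} {1..L} \<kappa> (net_array d L m P q n)) / N"
    unfolding net_character_sum[OF P L, symmetric] N_def sum_divide_distrib sum_distrib_left
    by (intro sum.cong refl) simp
  also have "(\<Sum>\<kappa>\<in>?K. \<Sum>n<CARD('b) ^ m. c (support L d \<kappa>) * of_real (decay \<alpha> L d \<kappa>) *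
      wal {1..d} {1..L} \<kappa> (net_array d L m P q n)) =
    (\<Sum>n<CARD('b) ^ m. \<Sum>\<kappa>\<in>?K. c (support L d \<kappa>) * (\<Prod>J\<in>{1..d}. of_real (1 / real CARD('b) ^ (\<alpha> * level L (\<kappa> J))) *
      (\<Prod>a\<in>{1..L}. add_char (\<kappa> J a * net_array d L m P q n J a))))"
    by (subst sum.swap) (simp only: decay_eq wal_def prod.distrib of_real_prod mult.assoc)
  also have "\<dots> = (\<Sum>n<CARD('b) ^ m. \<Sum>w\<in>Pow {1..d}. c w * (\<Prod>J\<in>w. omega_trunc \<alpha> L (net_array d L m P q n J)))"
    unfolding omega_trunc_def
  proof (intro sum.cong[OF refl] sum_by_support)
    fix n J
    have "(\<Prod>a\<in>{1..L}. add_char (zero_vector L a * net_array d L m P q n J a)) = 1"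
      by (simp add: zero_vector_def)
    thus "of_real (1 / real CARD('b) ^ (\<alpha> * level L (zero_vector L :: nat \<Rightarrow> 'b mod_ring))) *
        (\<Prod>a\<in>{1..L}. add_char (zero_vector L a * net_array d L m P q n J a)) = 1"
      by (simp only: level_zero_vector) simp
  qed
  also have "\<dots> = (\<Sum>n<CARD('b) ^ m. \<Sum>w\<in>Pow {1..d} - {{}}. c w * (\<Prod>J\<in>w. omega_trunc \<alpha> L (net_array d L m P q n J)))"
    by (intro sum.cong[OF refl] sum.mono_neutral_right) (auto simp: c_def)
  also have "\<dots> = (\<Sum>n<CARD('b) ^ m. \<Sum>w\<in>Pow {1..d} - {{}}. of_real (interlaced_weight CARD('b) \<alpha> \<gamma> w) *
      (\<Prod>J\<in>w. omega_trunc \<alpha> L (net_array d L m P q n J)))"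
    by (intro sum.cong[OF refl]) (auto simp: c_def)
  finally show ?thesis by (simp add: N_def)
qed

lemma omega_trunc_levels:
  fixes \<xi> :: "nat \<Rightarrow> 'b::prime_card mod_ring"
  shows "omega_trunc \<alpha> L \<xi> = (\<Sum>a\<in>{1..L}. of_real (1 / real CARD('b) ^ (\<alpha> * a)) *
    (if \<forall>c\<in>{1..<a}. \<xi> c = 0 then of_nat CARD('b) ^ (a - 1) * (if \<xi> a = 0 then of_nat CARD('b) - 1 else - 1) else 0))"
  unfolding omega_trunc_def sum_level_sets
proof (rule sum.cong[OF refl])
  fix a assume a: "a \<in> {1..L}"
  have "(\<Sum>k\<in>{k \<in> digit_vectors L. level L k = a}. of_real (1 / real CARD('b) ^ (\<alpha> * level L k)) * (\<Prod>a\<in>{1..L}. add_char (k a * \<xi> a))) =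
      of_real (1 / real CARD('b) ^ (\<alpha> * a)) * (\<Sum>k\<in>{k \<in> digit_vectors L. level L k = a}. \<Prod>a\<in>{1..L}. add_char (k a * \<xi> a))"
    unfolding sum_distrib_left by (rule sum.cong[OF refl]) auto
  thus "(\<Sum>k\<in>{k \<in> digit_vectors L. level L k = a}. of_real (1 / real CARD('b) ^ (\<alpha> * level L k)) * (\<Prod>a\<in>{1..L}. add_char (k a * \<xi> a))) =
      of_real (1 / real CARD('b) ^ (\<alpha> * a)) *
      (if \<forall>c\<in>{1..<a}. \<xi> c = 0 then of_nat CARD('b) ^ (a - 1) * (if \<xi> a = 0 then of_nat CARD('b) - 1 else - 1) else 0)"
    by (simp only: level_character_sum[OF a])
qed

text \<open>
  The integer part of the logarithm of a number in the unit interval is determined by the place of its first nonzero digit.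
\<close>

lemma floor_log_first_digit:
  fixes D :: "nat \<Rightarrow> int"
  assumes D: "\<And>l. 0 \<le> D l" "\<And>l. D l < int b" and b: "b > 1" and c: "c \<in> {1..m}" "D c \<noteq> 0"
    and zero: "\<And>l. l \<in> {1..<c} \<Longrightarrow> D l = 0"
  defines "y \<equiv> (\<Sum>l\<in>{1..m}. real_of_int (D l) / real b ^ l)"
  shows "y > 0" "\<lfloor>log (real b) y\<rfloor> = - int c"
proof -
  have b0: "b > 0" using b by simp
  have "1 / real b ^ c \<le> real_of_int (D c) / real b ^ c"
    using c(2) D(1)[of c] by (intro divide_right_mono) auto
  also have "\<dots> \<le> y"
    unfolding y_def using c D by (intro member_le_sum[of c "{1..m}" "\<lambda>l. real_of_int (D l) / real b ^ l"]) auto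
  finally have lower: "1 / real b ^ c \<le> y" .
  moreover have "1 / real b ^ c > 0" using b by simp
  ultimately show y0: "y > 0" by linarith
  have c1: "c - 1 + (m + 1 - c) = m" using c by auto
  have "y = (\<Sum>l\<in>{c - 1<..m}. real_of_int (D l) / real b ^ l)"
    unfolding y_def using zero by (intro sum.mono_neutral_right) auto
  also have "\<dots> \<le> 1 / real b ^ (c - 1) - 1 / real b ^ m"
    using digits_tail_bounds(2)[OF D b0, where a = "c - 1" and k = "m + 1 - c"] unfolding c1 .
  also have "\<dots> < 1 / real b ^ (c - 1)" using b by simp
  finally have upper: "y < 1 / real b ^ (c - 1)" .
  show "\<lfloor>log (real b) y\<rfloor> = - int c"
  proof (rule floor_unique)
    have "real b powr (- real c) = 1 / real b ^ c"
      using b by (simp add: powr_minus powr_realpow divide_inverse)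
    thus "real_of_int (- int c) \<le> log (real b) y"
      using lower y0 b by (simp add: le_log_iff)
    obtain e where e: "c = Suc e" using c by (cases c) auto
    have "real b powr (- real e) = 1 / real b ^ e"
      using b by (simp add: powr_minus powr_realpow divide_inverse)
    hence "y < real b powr (- real e)" using upper by (simp add: e)
    hence "log (real b) y < - real e" using y0 b by (subst log_less_iff) auto
    thus "log (real b) y < real_of_int (- int c) + 1" by (simp add: e)
  qed
qed

lemma geometric_sum_from_1: "(1 - x) * (\<Sum>a\<in>{1..n}. x ^ a) = x - x ^ Suc n" for x :: real
proof (induction n)
  case (Suc n)
  have "(1 - x) * (\<Sum>a\<in>{1..Suc n}. x ^ a) = (1 - x) * (\<Sum>a\<in>{1..n}. x ^ a) + (1 - x) * x ^ Suc n"
    by (simp add: distrib_left)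
  thus ?case unfolding Suc by (simp add: left_diff_distrib)
qed simp

text \<open>
  Only levels up to the first nonzero digit of the argument contribute: the levels before it give a geometric
  sum and its own level a single negative term. If all digits vanish, the whole geometric series remains, which
  is the value of \<open>omega\<close> at zero.
\<close>

lemma omega_trunc_tendsto:
  fixes \<xi> :: "nat \<Rightarrow> 'b::prime_card mod_ring"
  assumes \<alpha>: "\<alpha> \<ge> 2" and zero: "\<And>l. l > m \<Longrightarrow> \<xi> l = 0"
  shows "(\<lambda>L. omega_trunc \<alpha> L \<xi>) \<longlonglongrightarrow>
    of_real (omega CARD('b) \<alpha> (\<Sum>l\<in>{1..m}. real_of_int (to_int_mod_ring (\<xi> l)) / real CARD('b) ^ l))"
proof -
  define b where "b = real CARD('b)"
  define B where "B = b ^ (\<alpha> - 1)"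
  define x where "x = 1 / B"
  define y where "y = (\<Sum>l\<in>{1..m}. real_of_int (to_int_mod_ring (\<xi> l)) / b ^ l)"
  have b: "b > 1" using card_prime_gt_1[where 'b='b] by (simp add: b_def)
  have B: "B > 1" unfolding B_def using b \<alpha> by (intro one_less_power) auto
  have bB: "b ^ \<alpha> = b * B" using \<alpha> by (simp add: B_def flip: power_Suc)
  have x: "0 < x" "x < 1" using B by (auto simp: x_def)
  have shell: "1 / b ^ (\<alpha> * a) * b ^ (a - 1) = x ^ a / b" if "a \<ge> 1" for a
  proof -
    have "b ^ (\<alpha> * a) = b ^ a * B ^ a" by (simp add: power_mult bB power_mult_distrib)
    moreover have "b ^ a = b * b ^ (a - 1)" using that by (simp flip: power_Suc)
    ultimately show ?thesis using b B by (simp add: x_def field_simps)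
  qed
  have x_div: "x / (1 - x) = 1 / (B - 1)" using B by (simp add: x_def field_simps)
  show ?thesis
  proof (cases "\<forall>c\<in>{1..m}. \<xi> c = 0")
    case True
    hence z: "\<xi> c = 0" if "c \<ge> 1" for c using zero[of c] that by (cases "c \<le> m") auto
    have e1: "omega_trunc \<alpha> L \<xi> = of_real ((b - 1) / b * ((x - x ^ Suc L) / (1 - x)))" for L
    proof -
      have "omega_trunc \<alpha> L \<xi> = (\<Sum>a\<in>{1..L}. of_real ((1 / b ^ (\<alpha> * a) * b ^ (a - 1)) * (b - 1)))"
        unfolding omega_trunc_levels by (intro sum.cong refl) (auto simp: z b_def)
      also have "\<dots> = of_real ((b - 1) / b * (\<Sum>a\<in>{1..L}. x ^ a))"
        unfolding of_real_sum [symmetric] sum_distrib_left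
        by (intro arg_cong[where f = of_real] sum.cong refl, subst shell) auto
      also have "(\<Sum>a\<in>{1..L}. x ^ a) = (x - x ^ Suc L) / (1 - x)"
        using geometric_sum_from_1[of x L] x by (simp add: field_simps)
      finally show ?thesis .
    qed
    have e2: "(\<lambda>L. complex_of_real ((b - 1) / b * ((x - x ^ Suc L) / (1 - x)))) \<longlonglongrightarrow>
        of_real ((b - 1) / b * ((x - 0) / (1 - x)))"
      using x by (intro tendsto_intros LIMSEQ_Suc[OF LIMSEQ_realpow_zero]) auto
    have e3: "(b - 1) / b * ((x - 0) / (1 - x)) = omega CARD('b) \<alpha> y"
    proof -
      have "y = 0" unfolding y_def using True by (intro sum.neutral) auto
      hence "omega CARD('b) \<alpha> y = (b - 1) / (b * B - b)" by (simp add: omega_def b_def bB[unfolded b_def])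
      moreover have "b * B - b = b * (B - 1)" by (simp add: algebra_simps)
      ultimately show ?thesis using x_div by simp
    qed
    have "(\<lambda>L. omega_trunc \<alpha> L \<xi>) \<longlonglongrightarrow> of_real (omega CARD('b) \<alpha> y)"
      using e2 unfolding e3 e1 .
    thus ?thesis unfolding y_def b_def .
  next
    case False
    define c where "c = (LEAST c. c \<in> {1..m} \<and> \<xi> c \<noteq> 0)"
    have "\<exists>c. c \<in> {1..m} \<and> \<xi> c \<noteq> 0" using False by blast
    from LeastI_ex[OF this] have c: "c \<in> {1..m}" "\<xi> c \<noteq> 0" unfolding c_def by blast+
    have less: "\<xi> l = 0" if "l \<in> {1..<c}" for l
    proof (rule ccontr)
      assume "\<xi> l \<noteq> 0"
      hence "l \<in> {1..m} \<and> \<xi> l \<noteq> 0" using that c(1) by simp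
      hence "c \<le> l" unfolding c_def by (rule Least_le)
      thus False using that by simp
    qed
    have "to_int_mod_ring (\<xi> c) \<noteq> 0" using c(2) by simp
    moreover have "to_int_mod_ring (\<xi> l) = 0" if "l \<in> {1..<c}" for l using less[OF that] by simp
    ultimately have y: "y > 0" "\<lfloor>log b y\<rfloor> = - int c"
      unfolding y_def b_def
      using floor_log_first_digit[of "\<lambda>l. to_int_mod_ring (\<xi> l)" "CARD('b)" c m, OF to_int_mod_ring_range card_prime_gt_1 c(1)]
      by blast+
    have S: "(\<Sum>a\<in>{1..<c}. x ^ a) = (x - x ^ c) / (1 - x)"
    proof -
      have "{1..<c} = {1..c - 1}" using c by auto
      thus ?thesis using geometric_sum_from_1[of x "c - 1"] x c by (simp add: field_simps del: power_Suc)
    qed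
    have eq: "omega_trunc \<alpha> L \<xi> = of_real (omega CARD('b) \<alpha> y)" if L: "L \<ge> c" for L
    proof -
      define T where "T = (\<lambda>a. complex_of_real (1 / b ^ (\<alpha> * a)) *
        (if \<forall>c\<in>{1..<a}. \<xi> c = 0 then of_nat CARD('b) ^ (a - 1) * (if \<xi> a = 0 then of_nat CARD('b) - 1 else - 1) else 0))"
      have "omega_trunc \<alpha> L \<xi> = (\<Sum>a\<in>{1..L}. T a)" unfolding omega_trunc_levels T_def b_def ..
      also have "\<dots> = (\<Sum>a\<in>{1..c}. T a)"
      proof (rule sum.mono_neutral_right)
        show "\<forall>a\<in>{1..L} - {1..c}. T a = 0"
        proof
          fix a assume "a \<in> {1..L} - {1..c}"
          hence "c \<in> {1..<a}" using c by auto
          thus "T a = 0" using c(2) by (auto simp: T_def)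
        qed
      qed (use L in auto)
      also have "{1..c} = insert c {1..<c}" using c by auto
      also have "(\<Sum>a\<in>insert c {1..<c}. T a) = T c + (\<Sum>a\<in>{1..<c}. T a)" by simp
      also have "T c = of_real (- (1 / b ^ (\<alpha> * c) * b ^ (c - 1)))"
        using less c by (simp add: T_def b_def)
      also have "1 / b ^ (\<alpha> * c) * b ^ (c - 1) = x ^ c / b" using c by (intro shell) auto
      also have "(\<Sum>a\<in>{1..<c}. T a) = (\<Sum>a\<in>{1..<c}. of_real ((1 / b ^ (\<alpha> * a) * b ^ (a - 1)) * (b - 1)))"
        using less by (intro sum.cong refl) (auto simp: T_def b_def)
      also have "\<dots> = of_real ((b - 1) / b * (\<Sum>a\<in>{1..<c}. x ^ a))"
        unfolding of_real_sum [symmetric] sum_distrib_left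
        by (intro arg_cong[where f = of_real] sum.cong refl, subst shell) auto
      also have "complex_of_real (- (x ^ c / b)) + of_real ((b - 1) / b * (\<Sum>a\<in>{1..<c}. x ^ a)) =
          of_real ((b - 1) / b * ((x - x ^ c) / (1 - x)) - x ^ c / b)"
        unfolding S by simp
      also have "(b - 1) / b * ((x - x ^ c) / (1 - x)) - x ^ c / b =
          (b - 1) / (b * B - b) - x ^ c * ((b * B - 1) / (b * B - b))"
      proof -
        have "(x - x ^ c) / (1 - x) = 1 / (B - 1) - x ^ c * B / (B - 1)"
        proof -
          have "1 / (1 - x) = B / (B - 1)" using B by (simp add: x_def field_simps)
          hence "x ^ c / (1 - x) = x ^ c * B / (B - 1)" by (metis times_divide_eq_right mult.right_neutral)
          thus ?thesis using x_div by (simp add: diff_divide_distrib)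
        qed
        moreover have "b * B - b = b * (B - 1)" by (simp add: algebra_simps)
        moreover have "(b - 1) / b * (1 / (B - 1) - X * B / (B - 1)) - X / b =
            (b - 1) / (b * (B - 1)) - X * ((b * B - 1) / (b * (B - 1)))" for X
        proof -
          define D where "D = B - 1"
          have D: "D > 0" "B = D + 1" using B by (auto simp: D_def)
          show ?thesis unfolding D_def [symmetric] unfolding D(2) using b D(1) by (simp add: field_simps)
        qed
        ultimately show ?thesis by (simp only:)
      qed
      also have "x ^ c = b powi ((int \<alpha> - 1) * (- int c))"
      proof -
        have "(int \<alpha> - 1) * (- int c) = - int ((\<alpha> - 1) * c)" using \<alpha> by (simp add: of_nat_diff)
        hence "b powi ((int \<alpha> - 1) * (- int c)) = 1 / b ^ ((\<alpha> - 1) * c)"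
          by (simp only: power_int_minus power_int_of_nat inverse_eq_divide)
        thus ?thesis by (simp add: x_def B_def power_mult power_one_over)
      qed
      also have "(b - 1) / (b * B - b) - b powi ((int \<alpha> - 1) * (- int c)) * ((b * B - 1) / (b * B - b)) = omega CARD('b) \<alpha> y"
        using y unfolding omega_def b_def [symmetric] bB by simp
      finally show ?thesis .
    qed
    have "\<forall>\<^sub>F L in sequentially. omega_trunc \<alpha> L \<xi> = of_real (omega CARD('b) \<alpha> y)"
      using eventually_ge_at_top[of c] by (rule eventually_mono) (rule eq)
    thus ?thesis unfolding y_def b_def by (rule tendsto_eventually)
  qed
qed

lemma merit_trunc_tendsto:
  fixes P :: "'b::prime_card mod_ring poly"
  assumes P: "Polynomial.degree P = m" "m \<ge> 1" and \<alpha>: "\<alpha> \<ge> 2"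
  shows "(\<lambda>L. merit_trunc \<alpha> \<gamma> L m P d q) \<longlonglongrightarrow> merit \<alpha> \<gamma> m P d q"
proof -
  define \<xi> where "\<xi> = (\<lambda>n J a. if a \<le> m then quot_digit P (poly_of_index m n * q J) a else 0)"
  define W where "W = (\<lambda>w. complex_of_real (interlaced_weight CARD('b) \<alpha> \<gamma> w))"
  have coord: "lattice_coord m P n (q J) = (\<Sum>l\<in>{1..m}. real_of_int (to_int_mod_ring (\<xi> n J l)) / real CARD('b) ^ l)" for n J
    unfolding lattice_coord_def v_trunc_def \<xi>_def quot_digit_def by (intro sum.cong) auto
  have lim: "(\<lambda>L. omega_trunc \<alpha> L (\<xi> n J)) \<longlonglongrightarrow> of_real (omega CARD('b) \<alpha> (lattice_coord m P n (q J)))" for n J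
    unfolding coord by (rule omega_trunc_tendsto[OF \<alpha>]) (simp add: \<xi>_def)
  have "(\<lambda>L. (\<Sum>n<CARD('b) ^ m. \<Sum>w\<in>Pow {1..d} - {{}}. W w * (\<Prod>J\<in>w. omega_trunc \<alpha> L (\<xi> n J))) / of_nat (CARD('b) ^ m))
      \<longlonglongrightarrow> (\<Sum>n<CARD('b) ^ m. \<Sum>w\<in>Pow {1..d} - {{}}. W w *
        (\<Prod>J\<in>w. of_real (omega CARD('b) \<alpha> (lattice_coord m P n (q J))))) / of_nat (CARD('b) ^ m)"
    by (intro tendsto_intros lim) auto
  also have "(\<Sum>n<CARD('b) ^ m. \<Sum>w\<in>Pow {1..d} - {{}}. W w *
        (\<Prod>J\<in>w. of_real (omega CARD('b) \<alpha> (lattice_coord m P n (q J))))) / of_nat (CARD('b) ^ m) =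
      complex_of_real (merit \<alpha> \<gamma> m P d q)"
    by (simp add: merit_def W_def)
  finally have lims: "(\<lambda>L. (\<Sum>n<CARD('b) ^ m. \<Sum>w\<in>Pow {1..d} - {{}}. W w * (\<Prod>J\<in>w. omega_trunc \<alpha> L (\<xi> n J))) / of_nat (CARD('b) ^ m))
      \<longlonglongrightarrow> complex_of_real (merit \<alpha> \<gamma> m P d q)" .
  have eq: "complex_of_real (merit_trunc \<alpha> \<gamma> L m P d q) =
      (\<Sum>n<CARD('b) ^ m. \<Sum>w\<in>Pow {1..d} - {{}}. W w * (\<Prod>J\<in>w. omega_trunc \<alpha> L (\<xi> n J))) / of_nat (CARD('b) ^ m)"
    if "L \<ge> m" for L
  proof -
    have "omega_trunc \<alpha> L (net_array d L m P q n J) = omega_trunc \<alpha> L (\<xi> n J)" if "J \<in> {1..d}" for n J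
    proof -
      have "net_array d L m P q n J a = \<xi> n J a" if "a \<in> {1..L}" for a
        using \<open>J \<in> _\<close> that by (simp add: net_array_def \<xi>_def)
      thus ?thesis unfolding omega_trunc_def by (intro sum.cong prod.cong arg_cong2[of _ _ _ _ "(*)"] refl) auto
    qed
    hence "(\<Prod>J\<in>w. omega_trunc \<alpha> L (net_array d L m P q n J)) = (\<Prod>J\<in>w. omega_trunc \<alpha> L (\<xi> n J))"
      if "w \<in> Pow {1..d} - {{}}" for w n
      using that by (intro prod.cong refl) auto
    thus ?thesis unfolding merit_trunc_eq_omega_trunc[OF P that] W_def by simp
  qed
  have ev: "\<forall>\<^sub>F L in sequentially. (\<Sum>n<CARD('b) ^ m. \<Sum>w\<in>Pow {1..d} - {{}}. W w * (\<Prod>J\<in>w. omega_trunc \<alpha> L (\<xi> n J))) / of_nat (CARD('b) ^ m) =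
      complex_of_real (merit_trunc \<alpha> \<gamma> L m P d q)"
    using eventually_ge_at_top[of m] by (rule eventually_mono) (simp only: eq)
  have "(\<lambda>L. complex_of_real (merit_trunc \<alpha> \<gamma> L m P d q)) \<longlonglongrightarrow> complex_of_real (merit \<alpha> \<gamma> m P d q)"
    by (rule Lim_transform_eventually[OF lims ev])
  thus ?thesis by (simp add: tendsto_of_real_iff)
qed

text \<open>
  For every \<open>L \<ge> m\<close> the points of the rule lie in the grid with \<open>\<alpha> * L\<close> digits, and the distance between the
  two means is at most \<open>merit_trunc\<close>. Both sides converge as \<open>L\<close> grows.
\<close>

lemma quadrature_error_le_merit:
  fixes P :: "'b::prime_card mod_ring poly" and F :: "(nat \<Rightarrow> real) \<Rightarrow> real"
  assumes P: "Polynomial.degree P = m" "m \<ge> 1" and \<alpha>: "\<alpha> \<ge> 2" and \<beta>: "\<forall>j\<ge>1. \<beta> j > 0"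
    and F: "smooth_on_cube s F" "cube_norm s \<alpha> \<beta> F \<le> 1"
  shows "\<bar>(\<Sum>n<CARD('b) ^ m. F (interlaced_point \<alpha> s m P q n)) / real (CARD('b) ^ m) - cube_integral s F\<bar>
    \<le> merit \<alpha> (spod_weight \<alpha> \<beta>) m P (\<alpha> * s) q"
proof -
  define N where "N = CARD('b) ^ m"
  define Q where "Q = (\<Sum>n<N. F (interlaced_point \<alpha> s m P q n)) / real N"
  define A where "A = (\<lambda>L. (\<Sum>\<xi>\<in>digit_arrays {1..\<alpha> * s} {1..L}. F (array_point \<alpha> L s (\<xi> :: nat \<Rightarrow> nat \<Rightarrow> 'b mod_ring))) /
      real CARD('b) ^ (\<alpha> * s * L))"
  have N: "N > 0" using card_prime_gt_1[where 'b='b] by (simp add: N_def)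
  have b: "real CARD('b) > 1" using card_prime_gt_1[where 'b='b] by simp
  have bound: "\<bar>Q - A L\<bar> \<le> merit_trunc \<alpha> (spod_weight \<alpha> \<beta>) L m P (\<alpha> * s) q" if L: "L \<ge> m" for L
  proof -
    let ?S = "{1..\<alpha> * s}" and ?Q = "{1..L}"
    let ?z = "zero_array ?S ?Q :: nat \<Rightarrow> nat \<Rightarrow> 'b mod_ring"
    define \<Phi> where "\<Phi> = (\<lambda>\<xi> :: nat \<Rightarrow> nat \<Rightarrow> 'b mod_ring. complex_of_real (F (array_point \<alpha> L s \<xi>)))"
    define \<eta> where "\<eta> = net_array (\<alpha> * s) L m P q"
    have "complex_of_real (Q - A L) = (\<Sum>n<N. \<Phi> (\<eta> n)) / of_nat N -
        (\<Sum>\<xi>\<in>digit_arrays ?S ?Q. \<Phi> \<xi>) / of_nat CARD('b) ^ (card ?S * card ?Q)"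
      using interlaced_point_eq_array_point[OF L, where \<alpha> = \<alpha> and s = s and P = P and q = q] \<alpha> by (simp add: Q_def A_def \<Phi>_def \<eta>_def)
    hence "\<bar>Q - A L\<bar> = cmod ((\<Sum>n<N. \<Phi> (\<eta> n)) / of_nat N -
        (\<Sum>\<xi>\<in>digit_arrays ?S ?Q. \<Phi> \<xi>) / of_nat CARD('b) ^ (card ?S * card ?Q))"
      by (metis norm_of_real real_norm_def)
    also have "\<dots> \<le> (\<Sum>\<kappa>\<in>digit_arrays ?S ?Q - {?z}.
        cmod (fourier_coeff ?S ?Q \<Phi> \<kappa>) * cmod ((\<Sum>n<N. wal ?S ?Q \<kappa> (\<eta> n)) / of_nat N))"
      unfolding \<eta>_def by (intro discrete_quadrature_error net_array_in N) auto
    also have "\<dots> \<le> merit_trunc \<alpha> (spod_weight \<alpha> \<beta>) L m P (\<alpha> * s) q"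
      unfolding merit_trunc_def
    proof (intro sum_mono mult_mono)
      fix \<kappa> :: "nat \<Rightarrow> nat \<Rightarrow> 'b mod_ring"
      show "cmod (fourier_coeff ?S ?Q \<Phi> \<kappa>) \<le> interlaced_weight CARD('b) \<alpha> (spod_weight \<alpha> \<beta>) (support L (\<alpha> * s) \<kappa>) * decay \<alpha> L (\<alpha> * s) \<kappa>"
        unfolding \<Phi>_def by (rule fourier_coeff_bound[OF F \<beta> \<alpha>])
      thus "0 \<le> interlaced_weight CARD('b) \<alpha> (spod_weight \<alpha> \<beta>) (support L (\<alpha> * s) \<kappa>) * decay \<alpha> L (\<alpha> * s) \<kappa>"
        using norm_ge_zero order_trans by blast
      show "cmod ((\<Sum>n<N. wal ?S ?Q \<kappa> (\<eta> n)) / of_nat N) \<le> of_bool (P dvd dual_poly (\<alpha> * s) m \<kappa> q)"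
        unfolding N_def \<eta>_def net_character_sum[OF P L] by simp
    qed auto
    finally show ?thesis .
  qed
  have "A \<longlonglongrightarrow> cube_integral s F"
  proof -
    have "(\<lambda>L. A L - cube_integral s F) \<longlonglongrightarrow> 0"
    proof (rule Lim_null_comparison)
      show "\<forall>\<^sub>F L in sequentially. norm (A L - cube_integral s F) \<le> (\<Sum>j\<in>{1..s}. \<beta> j) / real CARD('b) ^ (\<alpha> * L)"
        using array_mean_approx[OF F \<beta>, where 'b='b] \<alpha> by (intro always_eventually allI) (simp add: A_def)
      have "(\<lambda>L. (\<Sum>j\<in>{1..s}. \<beta> j) * (1 / real CARD('b) ^ \<alpha>) ^ L) \<longlonglongrightarrow> (\<Sum>j\<in>{1..s}. \<beta> j) * 0"
        using b \<alpha> by (intro tendsto_intros LIMSEQ_realpow_zero) auto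
      thus "(\<lambda>L. (\<Sum>j\<in>{1..s}. \<beta> j) / real CARD('b) ^ (\<alpha> * L)) \<longlonglongrightarrow> 0"
        by (simp add: power_mult power_one_over)
    qed
    thus ?thesis by (rule LIM_zero_cancel)
  qed
  hence "(\<lambda>L. \<bar>Q - A L\<bar>) \<longlonglongrightarrow> \<bar>Q - cube_integral s F\<bar>"
    by (intro tendsto_intros)
  moreover have "\<forall>\<^sub>F L in sequentially. \<bar>Q - A L\<bar> \<le> merit_trunc \<alpha> (spod_weight \<alpha> \<beta>) L m P (\<alpha> * s) q"
    using eventually_ge_at_top[of m] by (rule eventually_mono) (rule bound)
  ultimately have "\<bar>Q - cube_integral s F\<bar> \<le> merit \<alpha> (spod_weight \<alpha> \<beta>) m P (\<alpha> * s) q"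
    using merit_trunc_tendsto[OF P \<alpha>, of "spod_weight \<alpha> \<beta>" "\<alpha> * s" q]
    by (intro tendsto_le[OF trivial_limit_sequentially])
  thus ?thesis by (simp add: Q_def N_def)
qed

section \<open>Averaging over generators\<close>

lemma powr_add_le_add_powr:
  fixes x y p :: real
  assumes "x \<ge> 0" "y \<ge> 0" "0 < p" "p \<le> 1"
  shows "(x + y) powr p \<le> x powr p + y powr p"
proof (cases "x + y = 0")
  case True
  thus ?thesis using assms by simp
next
  case False
  hence pos: "x + y > 0" using assms by simp
  have le: "z * (x + y) powr (p - 1) \<le> z powr p" if "0 \<le> z" "z \<le> x + y" for z
  proof (cases "z = 0")
    case False
    hence z: "z > 0" using that by simp
    have "(x + y) powr (p - 1) \<le> z powr (p - 1)" using z that assms by (intro powr_mono2') auto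
    hence "z * (x + y) powr (p - 1) \<le> z * z powr (p - 1)" using z by (intro mult_left_mono) auto
    also have "\<dots> = z powr p" using z by (simp add: powr_diff)
    finally show ?thesis .
  qed simp
  have "(x + y) powr p = (x + y) * (x + y) powr (p - 1)"
    using pos by (simp add: powr_diff)
  also have "\<dots> = x * (x + y) powr (p - 1) + y * (x + y) powr (p - 1)"
    by (rule distrib_right)
  also have "\<dots> \<le> x powr p + y powr p" using assms by (intro add_mono le) auto
  finally show ?thesis .
qed

lemma sum_powr_le_powr_sum:
  fixes f :: "'i \<Rightarrow> real"
  assumes "\<And>i. i \<in> A \<Longrightarrow> f i \<ge> 0" "0 < p" "p \<le> 1"
  shows "(\<Sum>i\<in>A. f i) powr p \<le> (\<Sum>i\<in>A. f i powr p)"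
  using assms
proof (induction A rule: infinite_finite_induct)
  case (insert i A)
  have "(f i + (\<Sum>i\<in>A. f i)) powr p \<le> f i powr p + (\<Sum>i\<in>A. f i) powr p"
    using insert by (intro powr_add_le_add_powr sum_nonneg) auto
  thus ?case using insert by force
qed auto

lemma coeff_digit_poly: "Polynomial.coeff (digit_poly m k) n = (if n < m then k (Suc n) else 0)"
proof -
  have "Polynomial.coeff (digit_poly m k) n = (\<Sum>a\<in>{1..m}. if a = Suc n then k a else 0)"
    unfolding digit_poly_def Polynomial.coeff_sum by (intro sum.cong refl) auto
  thus ?thesis by simp
qed

lemma degree_digit_poly_less: "m \<ge> 1 \<Longrightarrow> Polynomial.degree (digit_poly m k) < m"
  using degree_le[of "m - 1" "digit_poly m k"] by (force simp: coeff_digit_poly)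

lemma digit_poly_eq_0_iff: "digit_poly m k = 0 \<longleftrightarrow> (\<forall>a\<in>{1..m}. k a = 0)"
proof
  assume z: "digit_poly m k = 0"
  show "\<forall>a\<in>{1..m}. k a = 0"
  proof
    fix a assume "a \<in> {1..m}"
    then obtain n where "a = Suc n" "n < m" by (cases a) auto
    thus "k a = 0" using coeff_digit_poly[of m k n] z by simp
  qed
qed (simp add: digit_poly_def)

definition generators :: "nat \<Rightarrow> 'b::prime_card mod_ring poly set" where
  "generators m = {r. r \<noteq> 0 \<and> Polynomial.degree r < m}"

lemma finite_generators: "m \<ge> 1 \<Longrightarrow> finite (generators m :: 'b::prime_card mod_ring poly set)"
  and card_generators: "m \<ge> 1 \<Longrightarrow> card (generators m :: 'b::prime_card mod_ring poly set) = CARD('b) ^ m - 1"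
proof -
  assume m: "m \<ge> 1"
  have eq: "insert 0 (generators m) = (digit_poly m ` digit_vectors m :: 'b mod_ring poly set)"
  proof (intro equalityI subsetI)
    fix r :: "'b mod_ring poly" assume "r \<in> insert 0 (generators m)"
    hence deg: "Polynomial.degree r < m" using m by (auto simp: generators_def)
    define k where "k = (\<lambda>a\<in>{1..m}. Polynomial.coeff r (a - 1))"
    have "r = digit_poly m k"
      using deg by (auto simp: poly_eq_iff coeff_digit_poly coeff_eq_0 k_def)
    moreover have "k \<in> digit_vectors m" by (simp add: restrict_PiE_iff k_def)
    ultimately show "r \<in> digit_poly m ` digit_vectors m" by blast
  qed (use degree_digit_poly_less[OF m] in \<open>auto simp: generators_def\<close>)
  have inj: "inj_on (digit_poly m) (digit_vectors m :: (nat \<Rightarrow> 'b mod_ring) set)"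
  proof (rule inj_onI)
    fix k k' :: "nat \<Rightarrow> 'b mod_ring"
    assume k: "k \<in> digit_vectors m" "k' \<in> digit_vectors m" and e: "digit_poly m k = digit_poly m k'"
    show "k = k'"
    proof (rule PiE_ext[OF k])
      fix a assume "a \<in> {1..m}"
      then obtain n where "a = Suc n" "n < m" by (cases a) auto
      thus "k a = k' a" using coeff_digit_poly[of m k n] coeff_digit_poly[of m k' n] e by simp
    qed
  qed
  have fin: "finite (insert 0 (generators m) :: 'b mod_ring poly set)" unfolding eq by simp
  thus "finite (generators m :: 'b mod_ring poly set)" by simp
  have "card (insert 0 (generators m) :: 'b mod_ring poly set) = CARD('b) ^ m"
    unfolding eq card_image[OF inj] by (simp add: card_PiE CARD_mod_ring)
  moreover have "(0 :: 'b mod_ring poly) \<notin> generators m" by (simp add: generators_def)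
  ultimately show "card (generators m :: 'b mod_ring poly set) = CARD('b) ^ m - 1"
    using fin by simp
qed

text \<open>
  If two generators qualify, then the prime element \<open>P\<close> divides \<open>g\<close> times their difference, and a nonzero
  polynomial of degree below \<open>m\<close> is no multiple of \<open>P\<close>.
\<close>

lemma card_dual_generators:
  fixes P g :: "'b::prime_card mod_ring poly"
  assumes P: "irreducible P" "Polynomial.degree P = m" and m: "m \<ge> 1"
    and g: "g \<noteq> 0" "Polynomial.degree g < m"
  shows "card {r \<in> generators m. P dvd A + g * r} \<le> 1"
proof (rule card_le_Suc0_iff_eq[THEN iffD2, unfolded One_nat_def[symmetric]])
  show "finite {r \<in> generators m. P dvd A + g * r}" 
    by (rule finite_subset[OF _ finite_generators[OF m]]) auto
  have prime: "prime_elem P" using P(1) by (rule irreducible_imp_prime_elem_gcd)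
  have small: "f = 0" if "P dvd f" "Polynomial.degree f < m" for f
    using dvd_imp_degree_le[OF that(1)] that(2) P(2) by (cases "f = 0") auto
  show "\<forall>r\<in>{r \<in> generators m. P dvd A + g * r}. \<forall>r'\<in>{r \<in> generators m. P dvd A + g * r}. r = r'"
  proof (intro ballI)
    fix r r' assume r: "r \<in> {r \<in> generators m. P dvd A + g * r}" "r' \<in> {r \<in> generators m. P dvd A + g * r}"
    have "P dvd (A + g * r) - (A + g * r')" using r by (intro dvd_diff) auto
    hence "P dvd g * (r - r')" by (simp add: algebra_simps)
    hence "P dvd g \<or> P dvd (r - r')" using prime prime_elem_dvd_mult_iff by blast
    hence "P dvd (r - r')" using small[of g] g by blast
    moreover have "Polynomial.degree (r - r') < m"
      using r by (intro degree_diff_less) (auto simp: generators_def)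
    ultimately show "r = r'" using small[of "r - r'"] by simp
  qed
qed

text \<open>
  There are fewer than \<open>b ^ a\<close> vectors of level \<open>a\<close>, so the series over all frequencies is dominated by a
  geometric one with ratio \<open>b powr (1 - e)\<close>. Vanishing of the first \<open>m\<close> digits shifts all levels by \<open>m\<close>, which
  gains the factor \<open>b powr (- e * m)\<close>.
\<close>

lemma sum_level_powers_le:
  fixes e :: real
  assumes e: "e > 1"
  defines "\<rho> \<equiv> real CARD('b::prime_card) powr (1 - e)"
  shows "\<rho> < 1"
    "(\<Sum>k\<in>digit_vectors L - {zero_vector L :: nat \<Rightarrow> 'b mod_ring}. (real CARD('b) powr (- e)) ^ level L k) \<le> 1 / (1 - \<rho>)"
    "(\<Sum>k\<in>digit_vectors L - {zero_vector L :: nat \<Rightarrow> 'b mod_ring}. of_bool (\<forall>a\<in>{1..m}. k a = 0) * (real CARD('b) powr (- e)) ^ level L k)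
      \<le> 1 / (1 - \<rho>) / real CARD('b) ^ m"
proof -
  define b where "b = real CARD('b)"
  define x where "x = b powr (- e)"
  have b: "b > 1" using card_prime_gt_1[where 'b='b] by (simp add: b_def)
  have x0: "x > 0" using b by (simp add: x_def)
  have \<rho>: "\<rho> = b * x"
    using powr_add[of b 1 "- e"] b by (simp add: \<rho>_def b_def[symmetric] x_def)
  have "b powr (1 - e) < b powr 0" using b e by (intro powr_less_mono) auto
  thus \<rho>1: "\<rho> < 1" using b by (simp add: \<rho>_def b_def)
  have \<rho>0: "\<rho> > 0" using b x0 by (simp add: \<rho>)
  have geo: "(\<Sum>a\<in>A. \<rho> ^ a) \<le> 1 / (1 - \<rho>)" if "finite A" for A :: "nat set"
    using \<rho>0 \<rho>1 that by (intro sum_le_suminf[of "\<lambda>a. \<rho> ^ a", THEN order_trans]) (auto simp: suminf_geometric summable_geometric)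
  have "(\<Sum>k\<in>digit_vectors L - {zero_vector L :: nat \<Rightarrow> 'b mod_ring}. x ^ level L k) =
      (\<Sum>a\<in>{1..L}. real (card {k \<in> digit_vectors L. level L (k :: nat \<Rightarrow> 'b mod_ring) = a}) * x ^ a)"
    unfolding sum_level_sets by (intro sum.cong refl) simp
  also have "\<dots> \<le> (\<Sum>a\<in>{1..L}. b ^ a * x ^ a)"
  proof (intro sum_mono mult_right_mono)
    fix a assume a: "a \<in> {1..L}"
    have "CARD('b) ^ (a - 1) * (CARD('b) - 1) \<le> CARD('b) ^ (a - 1) * CARD('b)" by simp
    also have "\<dots> = CARD('b) ^ a" using a by (cases a) auto
    finally show "real (card {k \<in> digit_vectors L. level L (k :: nat \<Rightarrow> 'b mod_ring) = a}) \<le> b ^ a"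
      unfolding card_level_set[OF a] b_def by (metis of_nat_le_iff of_nat_power)
  qed (use x0 in auto)
  also have "\<dots> = (\<Sum>a\<in>{1..L}. \<rho> ^ a)" by (simp add: \<rho> power_mult_distrib)
  also have "\<dots> \<le> 1 / (1 - \<rho>)" by (rule geo) simp
  finally show "(\<Sum>k\<in>digit_vectors L - {zero_vector L :: nat \<Rightarrow> 'b mod_ring}. (real CARD('b) powr (- e)) ^ level L k) \<le> 1 / (1 - \<rho>)"
    by (simp add: x_def b_def)
  define C where "C = (\<lambda>a. {k \<in> digit_vectors L. level L (k :: nat \<Rightarrow> 'b mod_ring) = a \<and> (\<forall>a\<in>{1..m}. k a = 0)})"
  have "(\<Sum>k\<in>digit_vectors L - {zero_vector L :: nat \<Rightarrow> 'b mod_ring}. of_bool (\<forall>a\<in>{1..m}. k a = 0) * x ^ level L k) =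
      (\<Sum>a\<in>{1..L}. real (card (C a)) * x ^ a)"
    unfolding sum_level_sets
  proof (rule sum.cong[OF refl])
    fix a
    have "(\<Sum>k\<in>{k \<in> digit_vectors L. level L (k :: nat \<Rightarrow> 'b mod_ring) = a}. of_bool (\<forall>a\<in>{1..m}. k a = 0) * x ^ level L k) =
        (\<Sum>k\<in>C a. x ^ level L k)"
      by (rule sum.mono_neutral_cong_right) (auto simp: C_def)
    also have "\<dots> = real (card (C a)) * x ^ a" by (simp add: C_def)
    finally show "(\<Sum>k\<in>{k \<in> digit_vectors L. level L (k :: nat \<Rightarrow> 'b mod_ring) = a}. of_bool (\<forall>a\<in>{1..m}. k a = 0) * x ^ level L k) = real (card (C a)) * x ^ a" .
  qed
  also have "\<dots> = (\<Sum>a\<in>{m<..L}. real (card (C a)) * x ^ a)"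
  proof (rule sum.mono_neutral_right)
    show "\<forall>a\<in>{1..L} - {m<..L}. real (card (C a)) * x ^ a = 0"
    proof
      fix a assume a: "a \<in> {1..L} - {m<..L}"
      have "C a = {}"
      proof (rule ccontr)
        assume "C a \<noteq> {}"
        then obtain k where k: "level L k = a" "\<forall>a\<in>{1..m}. (k a :: 'b mod_ring) = 0" by (auto simp: C_def)
        thus False using level_nonzero(2)[of L k] a by auto
      qed
      thus "real (card (C a)) * x ^ a = 0" by simp
    qed
  qed auto
  also have "\<dots> \<le> (\<Sum>a\<in>{m<..L}. b ^ (a - m) * x ^ a)"
  proof (intro sum_mono mult_right_mono)
    fix a assume a: "a \<in> {m<..L}"
    define D where "D = (\<Pi>\<^sub>E c\<in>{1..L}. if c \<in> {m<..a} then UNIV else {0 :: 'b mod_ring})"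
    have "C a \<subseteq> D"
    proof
      fix k assume "k \<in> C a"
      hence k: "k \<in> digit_vectors L" "level L k = a" "\<forall>a\<in>{1..m}. k a = 0" by (auto simp: C_def)
      have "k c = 0" if "c \<in> {1..L}" "c > a" for c
      proof (rule ccontr)
        assume "k c \<noteq> 0"
        hence "c \<le> level L k" unfolding level_def using that by (intro Max_ge) auto
        thus False using k that by simp
      qed
      thus "k \<in> D" unfolding D_def using k by (intro PiE_I) (auto simp: PiE_iff extensional_def)
    qed
    moreover have "finite D" unfolding D_def by (intro finite_PiE) auto
    ultimately have "card (C a) \<le> card D" by (rule card_mono[rotated])
    also have "card D = (\<Prod>c\<in>{1..L}. if c \<in> {m<..a} then CARD('b) else 1)"
      unfolding D_def by (subst card_PiE) (auto intro!: prod.cong simp: CARD_mod_ring)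
    also have "\<dots> = (\<Prod>c\<in>{c \<in> {1..L}. c \<in> {m<..a}}. CARD('b))"
      by (rule prod.inter_filter [symmetric]) simp
    also have "{c \<in> {1..L}. c \<in> {m<..a}} = {m<..a}" using a by auto
    finally have "card (C a) \<le> CARD('b) ^ (a - m)" by simp
    thus "real (card (C a)) \<le> b ^ (a - m)" unfolding b_def by (metis of_nat_le_iff of_nat_power)
  qed (use x0 in auto)
  also have "\<dots> = x ^ m * (\<Sum>a\<in>{m<..L}. \<rho> ^ (a - m))"
    unfolding sum_distrib_left
  proof (intro sum.cong refl)
    fix a assume "a \<in> {m<..L}"
    hence "x ^ a = x ^ m * x ^ (a - m)" by (simp flip: power_add)
    thus "b ^ (a - m) * x ^ a = x ^ m * \<rho> ^ (a - m)" by (simp add: \<rho> power_mult_distrib)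
  qed
  also have "(\<Sum>a\<in>{m<..L}. \<rho> ^ (a - m)) = (\<Sum>a\<in>{0<..L - m}. \<rho> ^ a)"
    by (rule sum.reindex_bij_witness[where i = "\<lambda>a. a + m" and j = "\<lambda>a. a - m"]) auto
  also have "x ^ m * (\<Sum>a\<in>{0<..L - m}. \<rho> ^ a) \<le> (1 / b) ^ m * (1 / (1 - \<rho>))"
  proof (intro mult_mono power_mono geo)
    have "b powr (- e) \<le> b powr (- 1)" using b e by (intro powr_mono) auto
    thus "x \<le> 1 / b" using b by (simp add: x_def powr_minus divide_inverse)
  qed (use x0 \<rho>0 b in \<open>auto intro!: sum_nonneg\<close>)
  also have "\<dots> = 1 / (1 - \<rho>) / b ^ m" by (simp add: power_one_over)
  finally show "(\<Sum>k\<in>digit_vectors L - {zero_vector L :: nat \<Rightarrow> 'b mod_ring}. of_bool (\<forall>a\<in>{1..m}. k a = 0) * (real CARD('b) powr (- e)) ^ level L k)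
      \<le> 1 / (1 - \<rho>) / real CARD('b) ^ m"
    by (simp add: x_def b_def)
qed

section \<open>The component-by-component construction\<close>

definition merit_term :: "nat \<Rightarrow> (nat set \<Rightarrow> real) \<Rightarrow> nat \<Rightarrow> nat \<Rightarrow> 'b::prime_card mod_ring poly \<Rightarrow> nat \<Rightarrow>
    (nat \<Rightarrow> 'b mod_ring poly) \<Rightarrow> (nat \<Rightarrow> nat \<Rightarrow> 'b mod_ring) \<Rightarrow> real" where
  "merit_term \<alpha> \<gamma> L m P d q \<kappa> =
     interlaced_weight CARD('b) \<alpha> \<gamma> (support L d \<kappa>) * decay \<alpha> L d \<kappa> * of_bool (P dvd dual_poly d m \<kappa> q)"

text \<open>
  The part of the truncated figure of merit in which component \<open>d\<close> of the frequency is nonzero. It is all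
  that the choice of \<open>q d\<close> influences.
\<close>

definition merit_increment :: "nat \<Rightarrow> (nat set \<Rightarrow> real) \<Rightarrow> nat \<Rightarrow> nat \<Rightarrow> 'b::prime_card mod_ring poly \<Rightarrow> nat \<Rightarrow>
    (nat \<Rightarrow> 'b mod_ring poly) \<Rightarrow> real" where
  "merit_increment \<alpha> \<gamma> L m P d q =
     (\<Sum>\<kappa>\<in>digit_arrays {1..d} {1..L}. of_bool (level L (\<kappa> d) \<noteq> 0) * merit_term \<alpha> \<gamma> L m P d q \<kappa>)"

lemma support_subset: "support L d \<kappa> \<subseteq> {1..d}"
  by (auto simp: support_def)

lemma decay_nonneg: "decay \<alpha> L d \<kappa> \<ge> 0"
  unfolding decay_def by (intro prod_nonneg) auto

lemma merit_trunc_Suc: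
  fixes P :: "'b::prime_card mod_ring poly"
  assumes L: "m \<le> L"
  shows "merit_trunc \<alpha> \<gamma> L m P (Suc d) q = merit_trunc \<alpha> \<gamma> L m P d q + merit_increment \<alpha> \<gamma> L m P (Suc d) q"
proof -
  let ?K = "\<lambda>d. digit_arrays {1..d} {1..L} :: (nat \<Rightarrow> nat \<Rightarrow> 'b mod_ring) set"
  define T where "T = (\<lambda>d \<kappa>. of_bool (support L d \<kappa> \<noteq> {}) * merit_term \<alpha> \<gamma> L m P d q \<kappa>)"
  have finK: "finite (?K d)" for d by (rule finite_digit_arrays) auto
  have trunc: "merit_trunc \<alpha> \<gamma> L m P d q = (\<Sum>\<kappa>\<in>?K d. T d \<kappa>)" for d
    unfolding merit_trunc_def T_def merit_term_def
    by (rule sum.mono_neutral_cong_left) (use finK in \<open>auto simp: support_empty_iff\<close>)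
  have ins: "{1..Suc d} = insert (Suc d) {1..d}" by auto
  have "(\<Sum>\<kappa>\<in>?K (Suc d). of_bool (level L (\<kappa> (Suc d)) = 0) * T (Suc d) \<kappa>) =
      (\<Sum>z\<in>digit_vectors L. \<Sum>\<kappa>\<in>?K d. of_bool (level L z = 0) * T (Suc d) (\<kappa>(Suc d := z)))"
    unfolding ins by (subst sum_PiE_insert) auto
  also have "\<dots> = (\<Sum>z\<in>digit_vectors L. if z = zero_vector L then \<Sum>\<kappa>\<in>?K d. T (Suc d) (\<kappa>(Suc d := z)) else 0)"
    by (intro sum.cong refl) (auto simp: level_eq_0_iff_zero_vector)
  also have "\<dots> = (\<Sum>\<kappa>\<in>?K d. T (Suc d) (\<kappa>(Suc d := zero_vector L)))"
    by (subst sum.delta) (auto simp del: One_nat_def)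
  also have "\<dots> = (\<Sum>\<kappa>\<in>?K d. T d \<kappa>)"
  proof (rule sum.cong[OF refl])
    fix \<kappa> :: "nat \<Rightarrow> nat \<Rightarrow> 'b mod_ring"
    let ?k = "\<kappa>(Suc d := zero_vector L)"
    have supp: "support L (Suc d) ?k = support L d \<kappa>"
      by (auto simp: support_def le_Suc_eq)
    have "decay \<alpha> L (Suc d) ?k = decay \<alpha> L d \<kappa>"
      unfolding decay_def supp by (intro prod.cong refl) (auto simp: support_def)
    moreover have "dual_poly (Suc d) m ?k q = dual_poly d m \<kappa> q"
    proof -
      have "digit_poly m (zero_vector L :: nat \<Rightarrow> 'b mod_ring) = 0"
        using L by (auto simp: digit_poly_eq_0_iff zero_vector_def)
      thus ?thesis unfolding dual_poly_def ins by (subst sum.insert) (auto intro!: sum.cong)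
    qed
    ultimately show "T (Suc d) ?k = T d \<kappa>" by (simp add: T_def merit_term_def supp)
  qed
  finally have 1: "(\<Sum>\<kappa>\<in>?K (Suc d). of_bool (level L (\<kappa> (Suc d)) = 0) * T (Suc d) \<kappa>) = (\<Sum>\<kappa>\<in>?K d. T d \<kappa>)" .
  have 2: "(\<Sum>\<kappa>\<in>?K (Suc d). of_bool (level L (\<kappa> (Suc d)) \<noteq> 0) * T (Suc d) \<kappa>) = merit_increment \<alpha> \<gamma> L m P (Suc d) q"
    unfolding merit_increment_def T_def by (intro sum.cong refl) (auto simp: support_def)
  have "(\<Sum>\<kappa>\<in>?K (Suc d). T (Suc d) \<kappa>) =
      (\<Sum>\<kappa>\<in>?K (Suc d). of_bool (level L (\<kappa> (Suc d)) = 0) * T (Suc d) \<kappa>) +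
      (\<Sum>\<kappa>\<in>?K (Suc d). of_bool (level L (\<kappa> (Suc d)) \<noteq> 0) * T (Suc d) \<kappa>)"
    unfolding sum.distrib [symmetric] by (intro sum.cong refl) auto
  thus ?thesis unfolding 1 2 trunc .
qed

text \<open>
  For a fixed frequency the number of generators that put it into the dual net is at most one, unless the
  first \<open>m\<close> digits of its component \<open>d\<close> vanish, and then it is at most the number \<open>R < N\<close> of all generators. In
  the second case the sum over component \<open>d\<close> is smaller by the factor \<open>1 / N\<close>, so both cases contribute at
  most \<open>Z\<close>; this is the factor \<open>2\<close>.
\<close>

lemma merit_increment_powr_average:
  fixes P :: "'b::prime_card mod_ring poly"
  assumes P: "irreducible P" "Polynomial.degree P = m" "m \<ge> 1" and L: "m \<le> L"
    and p: "0 < p" "p \<le> 1" "real \<alpha> * p > 1" and "d \<ge> 1"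
    and W: "\<And>w. w \<subseteq> {1..d} \<Longrightarrow> interlaced_weight CARD('b) \<alpha> \<gamma> w \<ge> 0"
  defines "Z \<equiv> 1 / (1 - real CARD('b) powr (1 - real \<alpha> * p))"
  shows "(\<Sum>r\<in>generators m. merit_increment \<alpha> \<gamma> L m P d (q(d := r)) powr p) \<le>
    2 * (\<Sum>w\<in>Pow {1..d}. of_bool (d \<in> w) * interlaced_weight CARD('b) \<alpha> \<gamma> w powr p * Z ^ card w)"
proof -
  let ?K = "digit_arrays {1..d} {1..L} :: (nat \<Rightarrow> nat \<Rightarrow> 'b mod_ring) set"
  let ?V = "digit_vectors L - {zero_vector L} :: (nat \<Rightarrow> 'b mod_ring) set"
  define W' where "W' = (\<lambda>w. interlaced_weight CARD('b) \<alpha> \<gamma> w powr p)"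
  define x where "x = real CARD('b) powr (- (real \<alpha> * p))"
  define R where "R = real (card (generators m :: 'b mod_ring poly set))"
  define N where "N = real CARD('b) ^ m"
  define h where "h = (\<lambda>J (k :: nat \<Rightarrow> 'b mod_ring). x ^ level L k *
    (if J = d \<and> level L k \<noteq> 0 then 1 + R * of_bool (digit_poly m k = 0) else 1))"
  have b: "real CARD('b) > 1" using card_prime_gt_1[where 'b='b] by simp
  have x0: "x > 0" using b by (simp add: x_def)
  have finG: "finite (generators m :: 'b mod_ring poly set)" using finite_generators[OF P(3)] .
  have finK: "finite ?K" by (rule finite_digit_arrays) auto
  note Zb = sum_level_powers_le[OF p(3), where 'b='b, folded Z_def x_def]
  have Z0: "Z > 0" using Zb(1) by (simp add: Z_def)
  have decay: "decay \<alpha> L d \<kappa> powr p = (\<Prod>J\<in>{1..d}. x ^ level L (\<kappa> J))" for \<kappa> :: "nat \<Rightarrow> nat \<Rightarrow> 'b mod_ring"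
  proof -
    have "(1 / real CARD('b) ^ (\<alpha> * l)) powr p = x ^ l" for l
    proof -
      have "(1 / real CARD('b) ^ (\<alpha> * l)) powr p = (real CARD('b) powr (- (real \<alpha> * real l))) powr p"
        using b by (simp add: powr_minus powr_realpow[symmetric] divide_inverse del: powr_minus)
          (simp add: powr_minus divide_inverse)
      also have "\<dots> = x powr real l" by (simp add: x_def powr_powr mult_ac)
      also have "\<dots> = x ^ l" using x0 by (rule powr_realpow)
      finally show ?thesis .
    qed
    thus ?thesis unfolding decay_eq by (subst prod_powr_distrib) auto
  qed
  have "(\<Sum>r\<in>generators m. merit_increment \<alpha> \<gamma> L m P d (q(d := r)) powr p) \<le>
      (\<Sum>r\<in>generators m. \<Sum>\<kappa>\<in>?K. of_bool (level L (\<kappa> d) \<noteq> 0) * (W' (support L d \<kappa>) * decay \<alpha> L d \<kappa> powr p) *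
        of_bool (P dvd dual_poly d m \<kappa> (q(d := r))))"
  proof (rule sum_mono)
    fix r :: "'b mod_ring poly"
    have "merit_increment \<alpha> \<gamma> L m P d (q(d := r)) powr p \<le>
        (\<Sum>\<kappa>\<in>?K. (of_bool (level L (\<kappa> d) \<noteq> 0) * merit_term \<alpha> \<gamma> L m P d (q(d := r)) \<kappa>) powr p)"
      unfolding merit_increment_def
      by (intro sum_powr_le_powr_sum p) (auto simp: merit_term_def W[OF support_subset] decay_nonneg)
    also have "\<dots> = (\<Sum>\<kappa>\<in>?K. of_bool (level L (\<kappa> d) \<noteq> 0) * (W' (support L d \<kappa>) * decay \<alpha> L d \<kappa> powr p) *
        of_bool (P dvd dual_poly d m \<kappa> (q(d := r))))"
      by (intro sum.cong refl) (auto simp: merit_term_def W'_def powr_mult W[OF support_subset] decay_nonneg)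
    finally show "merit_increment \<alpha> \<gamma> L m P d (q(d := r)) powr p \<le> (\<Sum>\<kappa>\<in>?K. of_bool (level L (\<kappa> d) \<noteq> 0) *
        (W' (support L d \<kappa>) * decay \<alpha> L d \<kappa> powr p) * of_bool (P dvd dual_poly d m \<kappa> (q(d := r))))" .
  qed
  also have "\<dots> = (\<Sum>\<kappa>\<in>?K. of_bool (level L (\<kappa> d) \<noteq> 0) * (W' (support L d \<kappa>) * decay \<alpha> L d \<kappa> powr p) *
      (\<Sum>r\<in>generators m. of_bool (P dvd dual_poly d m \<kappa> (q(d := r)))))"
    by (subst sum.swap) (simp add: sum_distrib_left)
  also have "\<dots> \<le> (\<Sum>\<kappa>\<in>?K. of_bool (level L (\<kappa> d) \<noteq> 0) * (W' (support L d \<kappa>) * decay \<alpha> L d \<kappa> powr p) *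
      (1 + R * of_bool (digit_poly m (\<kappa> d) = 0)))"
  proof (intro sum_mono mult_left_mono)
    fix \<kappa> :: "nat \<Rightarrow> nat \<Rightarrow> 'b mod_ring"
    define A where "A = (\<Sum>J\<in>{1..<d}. digit_poly m (\<kappa> J) * q J)"
    have dual: "dual_poly d m \<kappa> (q(d := r)) = A + digit_poly m (\<kappa> d) * r" for r
    proof -
      have "{1..d} = insert d {1..<d}" using \<open>d \<ge> 1\<close> by auto
      thus ?thesis unfolding dual_poly_def A_def by (simp add: add.commute)
    qed
    have "(\<Sum>r\<in>generators m. of_bool (P dvd dual_poly d m \<kappa> (q(d := r)))) =
        real (card {r \<in> generators m. P dvd A + digit_poly m (\<kappa> d) * r})"
      unfolding dual using finG by (simp add: of_bool_def sum.If_cases Int_def)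
    also have "\<dots> \<le> 1 + R * of_bool (digit_poly m (\<kappa> d) = 0)"
    proof (cases "digit_poly m (\<kappa> d) = 0")
      case True
      have "card {r \<in> generators m. P dvd A + digit_poly m (\<kappa> d) * r} \<le> card (generators m :: 'b mod_ring poly set)"
        using finG by (intro card_mono) auto
      thus ?thesis using True by (simp add: R_def)
    next
      case False
      thus ?thesis
        using card_dual_generators[OF P False degree_digit_poly_less[OF P(3)], of A] by simp
    qed
    finally show "(\<Sum>r\<in>generators m. of_bool (P dvd dual_poly d m \<kappa> (q(d := r)))) \<le> 1 + R * of_bool (digit_poly m (\<kappa> d) = 0)" .
  qed (auto simp: W'_def)
  also have "\<dots> = (\<Sum>\<kappa>\<in>?K. of_bool (d \<in> support L d \<kappa>) * W' (support L d \<kappa>) * (\<Prod>J\<in>{1..d}. h J (\<kappa> J)))"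
  proof (rule sum.cong[OF refl])
    fix \<kappa> :: "nat \<Rightarrow> nat \<Rightarrow> 'b mod_ring"
    have "(\<Prod>J\<in>{1..d}. h J (\<kappa> J)) = decay \<alpha> L d \<kappa> powr p *
        (\<Prod>J\<in>{1..d}. if J = d then (if level L (\<kappa> J) \<noteq> 0 then 1 + R * of_bool (digit_poly m (\<kappa> J) = 0) else 1) else 1)"
      unfolding decay h_def prod.distrib [symmetric] by (intro prod.cong refl) auto
    also have "(\<Prod>J\<in>{1..d}. if J = d then (if level L (\<kappa> J) \<noteq> 0 then 1 + R * of_bool (digit_poly m (\<kappa> J) = 0) else 1) else 1) =
        (if level L (\<kappa> d) \<noteq> 0 then 1 + R * of_bool (digit_poly m (\<kappa> d) = 0) else 1)"
      using \<open>d \<ge> 1\<close> by (subst prod.delta) auto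
    finally have "(\<Prod>J\<in>{1..d}. h J (\<kappa> J)) = decay \<alpha> L d \<kappa> powr p *
        (if level L (\<kappa> d) \<noteq> 0 then 1 + R * of_bool (digit_poly m (\<kappa> d) = 0) else 1)" .
    thus "of_bool (level L (\<kappa> d) \<noteq> 0) * (W' (support L d \<kappa>) * decay \<alpha> L d \<kappa> powr p) * (1 + R * of_bool (digit_poly m (\<kappa> d) = 0)) =
        of_bool (d \<in> support L d \<kappa>) * W' (support L d \<kappa>) * (\<Prod>J\<in>{1..d}. h J (\<kappa> J))"
      using \<open>d \<ge> 1\<close> by (simp add: support_def)
  qed
  also have "\<dots> = (\<Sum>w\<in>Pow {1..d}. of_bool (d \<in> w) * W' w * (\<Prod>J\<in>w. \<Sum>k\<in>?V. h J k))"
    by (rule sum_by_support) (simp add: h_def)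
  also have "\<dots> \<le> (\<Sum>w\<in>Pow {1..d}. of_bool (d \<in> w) * W' w * (2 * Z ^ card w))"
  proof (rule sum_mono)
    fix w assume w: "w \<in> Pow {1..d}"
    have finw: "finite w" using w finite_subset by auto
    have R: "R \<le> N" unfolding R_def N_def card_generators[OF P(3)] by (metis diff_le_self of_nat_le_iff of_nat_power)
    have h0: "h J k \<ge> 0" for J k using x0 by (simp add: h_def R_def)
    have hJ: "(\<Sum>k\<in>?V. h J k) \<le> Z" if "J \<noteq> d" for J
      using Zb(2)[of L] that by (simp add: h_def)
    have hd: "(\<Sum>k\<in>?V. h d k) \<le> 2 * Z"
    proof -
      have "(\<Sum>k\<in>?V. h d k) = (\<Sum>k\<in>?V. x ^ level L k) + R * (\<Sum>k\<in>?V. of_bool (\<forall>a\<in>{1..m}. k a = 0) * x ^ level L k)"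
        unfolding sum_distrib_left sum.distrib [symmetric]
      proof (rule sum.cong[OF refl])
        fix k assume "k \<in> ?V"
        hence "level L k \<noteq> 0" using level_eq_0_iff_zero_vector[of k L] by auto
        thus "h d k = x ^ level L k + R * (of_bool (\<forall>a\<in>{1..m}. k a = 0) * x ^ level L k)"
          by (simp add: h_def digit_poly_eq_0_iff algebra_simps)
      qed
      also have "\<dots> \<le> Z + N * (Z / N)"
        using Zb(2,3) R x0 by (intro add_mono mult_mono) (auto simp: N_def R_def intro!: sum_nonneg)
      also have "N * (Z / N) = Z" using b by (simp add: N_def)
      finally show ?thesis by simp
    qed
    have "(\<Prod>J\<in>w. \<Sum>k\<in>?V. h J k) \<le> 2 * Z ^ card w" if "d \<in> w"
    proof -
      have "(\<Prod>J\<in>w. \<Sum>k\<in>?V. h J k) \<le> (\<Prod>J\<in>w. if J = d then 2 * Z else Z)"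
        using hJ hd by (intro prod_mono) (auto intro!: sum_nonneg h0)
      also have "\<dots> = 2 * Z * (\<Prod>J\<in>w - {d}. Z)"
        using that finw by (subst prod.remove[of _ d]) (auto intro!: prod.cong)
      also have "\<dots> = 2 * Z ^ card w"
      proof -
        have "card w = Suc (card (w - {d}))" using that finw by (metis card_Suc_Diff1)
        thus ?thesis by simp
      qed
      finally show ?thesis .
    qed
    thus "of_bool (d \<in> w) * W' w * (\<Prod>J\<in>w. \<Sum>k\<in>?V. h J k) \<le> of_bool (d \<in> w) * W' w * (2 * Z ^ card w)"
      by (cases "d \<in> w") (auto simp: W'_def intro!: mult_left_mono)
  qed
  also have "\<dots> = 2 * (\<Sum>w\<in>Pow {1..d}. of_bool (d \<in> w) * W' w * Z ^ card w)"
    by (simp add: sum_distrib_left mult_ac)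
  finally show ?thesis by (simp add: W'_def)
qed

text \<open>
  In each step the increment is at most every other possible increment, so its \<open>p\<close>-th power is at most the
  average of the \<open>p\<close>-th powers over the \<open>N - 1 \<ge> N / 2\<close> generators. The increments exist as limits for
  untruncated frequencies because the truncated ones are differences of consecutive figures of merit.
\<close>

lemma cbc_merit_bound:
  fixes P :: "'b::prime_card mod_ring poly"
  assumes P: "irreducible P" "Polynomial.degree P = m" "m \<ge> 1" and \<alpha>: "\<alpha> \<ge> 2"
    and p: "0 < p" "p \<le> 1" "real \<alpha> * p > 1"
    and W: "\<And>w. w \<subseteq> {1..D} \<Longrightarrow> interlaced_weight CARD('b) \<alpha> \<gamma> w \<ge> 0"
    and opt: "\<And>d r. d \<in> {1..D} \<Longrightarrow> r \<in> generators m \<Longrightarrow> merit \<alpha> \<gamma> m P d q \<le> merit \<alpha> \<gamma> m P d (q(d := r))"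
  defines "Z \<equiv> 1 / (1 - real CARD('b) powr (1 - real \<alpha> * p))"
  shows "merit \<alpha> \<gamma> m P D q powr p \<le>
    4 / real CARD('b) ^ m * (\<Sum>w\<in>Pow {1..D}. interlaced_weight CARD('b) \<alpha> \<gamma> w powr p * Z ^ card w)"
  using opt W
proof (induction D)
  case 0
  have "merit \<alpha> \<gamma> m P 0 q = 0" by (simp add: merit_def)
  thus ?case by (simp add: Z_def)
next
  case (Suc D)
  define d where "d = Suc D"
  define N where "N = real CARD('b) ^ m"
  define W' where "W' = (\<lambda>w. interlaced_weight CARD('b) \<alpha> \<gamma> w powr p * Z ^ card w)"
  define R where "R = real (card (generators m :: 'b mod_ring poly set))"
  define \<Theta> where "\<Theta> = (\<lambda>q. merit \<alpha> \<gamma> m P d q - merit \<alpha> \<gamma> m P D q)"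
  have b: "real CARD('b) > 1" using card_prime_gt_1[where 'b='b] by simp
  have N1: "N \<ge> 2"
  proof -
    have "2 \<le> CARD('b)" using card_prime_gt_1[where 'b='b] by simp
    hence "2 ^ 1 \<le> real CARD('b) ^ 1" by simp
    also have "\<dots> \<le> N" unfolding N_def using b P(3) by (intro power_increasing) auto
    finally show ?thesis by simp
  qed
  have R: "R = N - 1"
    unfolding R_def N_def card_generators[OF P(3)] using b by (subst of_nat_diff) auto
  have W_d: "interlaced_weight CARD('b) \<alpha> \<gamma> w \<ge> 0" if "w \<subseteq> {1..d}" for w
    using Suc.prems(2) that by (simp add: d_def)
  have W_D: "interlaced_weight CARD('b) \<alpha> \<gamma> w \<ge> 0" if "w \<subseteq> {1..D}" for w
    using that by (intro W_d) (auto simp: d_def)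
  have incr: "(\<lambda>L. merit_increment \<alpha> \<gamma> L m P d q) \<longlonglongrightarrow> \<Theta> q" for q
  proof -
    have "(\<lambda>L. merit_trunc \<alpha> \<gamma> L m P d q - merit_trunc \<alpha> \<gamma> L m P D q) \<longlonglongrightarrow> \<Theta> q"
      unfolding \<Theta>_def by (intro tendsto_diff merit_trunc_tendsto P \<alpha>)
    moreover have "\<forall>\<^sub>F L in sequentially. merit_trunc \<alpha> \<gamma> L m P d q - merit_trunc \<alpha> \<gamma> L m P D q = merit_increment \<alpha> \<gamma> L m P d q"
      using eventually_ge_at_top[of m] by (rule eventually_mono) (simp add: d_def merit_trunc_Suc)
    ultimately show ?thesis by (rule Lim_transform_eventually)
  qed
  have incr0: "merit_increment \<alpha> \<gamma> L m P d q \<ge> 0" for L q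
    unfolding merit_increment_def merit_term_def using support_subset[of L d]
    by (intro sum_nonneg mult_nonneg_nonneg W_d decay_nonneg) auto
  have \<Theta>0: "\<Theta> q \<ge> 0" for q
    by (rule LIMSEQ_le_const[OF incr]) (use incr0 in auto)
  have trunc0: "merit_trunc \<alpha> \<gamma> L m P D q \<ge> 0" for L
    unfolding merit_trunc_def by (intro sum_nonneg mult_nonneg_nonneg W_D[OF support_subset] decay_nonneg) auto
  have merit0: "merit \<alpha> \<gamma> m P D q \<ge> 0"
    by (rule LIMSEQ_le_const[OF merit_trunc_tendsto[OF P(2,3) \<alpha>]]) (use trunc0 in auto)
  have \<Theta>_opt: "\<Theta> q \<le> \<Theta> (q(d := r))" if "r \<in> generators m" for r
  proof -
    have "merit \<alpha> \<gamma> m P D (q(d := r)) = merit \<alpha> \<gamma> m P D q"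
      unfolding merit_def d_def
      by (intro arg_cong2[of _ _ _ _ "(*)"] sum.cong prod.cong refl) auto
    moreover have "merit \<alpha> \<gamma> m P d q \<le> merit \<alpha> \<gamma> m P d (q(d := r))"
      by (rule Suc.prems(1)[OF _ that]) (simp add: d_def)
    ultimately show ?thesis by (simp add: \<Theta>_def)
  qed
  have "(\<Sum>r\<in>generators m. \<Theta> (q(d := r)) powr p) \<le> 2 * (\<Sum>w\<in>Pow {1..d}. of_bool (d \<in> w) * W' w)"
  proof (rule LIMSEQ_le_const2)
    show "(\<lambda>L. \<Sum>r\<in>generators m. merit_increment \<alpha> \<gamma> L m P d (q(d := r)) powr p) \<longlonglongrightarrow> (\<Sum>r\<in>generators m. \<Theta> (q(d := r)) powr p)"
      using p incr0 by (intro tendsto_sum tendsto_powr' incr tendsto_const) auto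
    show "\<exists>M. \<forall>L\<ge>M. (\<Sum>r\<in>generators m. merit_increment \<alpha> \<gamma> L m P d (q(d := r)) powr p) \<le> 2 * (\<Sum>w\<in>Pow {1..d}. of_bool (d \<in> w) * W' w)"
    proof (intro exI[of _ m] allI impI)
      fix L assume L: "L \<ge> m"
      have "d \<ge> 1" by (simp add: d_def)
      from merit_increment_powr_average[OF P L p this W_d, of q, folded Z_def]
      show "(\<Sum>r\<in>generators m. merit_increment \<alpha> \<gamma> L m P d (q(d := r)) powr p) \<le> 2 * (\<Sum>w\<in>Pow {1..d}. of_bool (d \<in> w) * W' w)"
        by (simp only: W'_def mult.assoc)
    qed
  qed
  moreover have "R * \<Theta> q powr p \<le> (\<Sum>r\<in>generators m. \<Theta> (q(d := r)) powr p)"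
  proof -
    have "R * \<Theta> q powr p = (\<Sum>r\<in>(generators m :: 'b mod_ring poly set). \<Theta> q powr p)" by (simp add: R_def)
    also have "\<dots> \<le> (\<Sum>r\<in>generators m. \<Theta> (q(d := r)) powr p)"
      using \<Theta>_opt \<Theta>0 p by (intro sum_mono powr_mono2) auto
    finally show ?thesis .
  qed
  moreover have "N / 2 * \<Theta> q powr p \<le> R * \<Theta> q powr p"
    using N1 by (intro mult_right_mono) (auto simp: R)
  ultimately have half: "N / 2 * \<Theta> q powr p \<le> 2 * (\<Sum>w\<in>Pow {1..d}. of_bool (d \<in> w) * W' w)" by linarith
  have cancel: "x \<le> 4 / N * y" if "N / 2 * x \<le> 2 * y" for x y
  proof -
    have "2 / N * (N / 2 * x) \<le> 2 / N * (2 * y)" using that N1 by (intro mult_left_mono) auto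
    thus ?thesis using N1 by simp
  qed
  have \<Theta>p: "\<Theta> q powr p \<le> 4 / N * (\<Sum>w\<in>Pow {1..d}. of_bool (d \<in> w) * W' w)"
    by (rule cancel[OF half])
  have IH: "merit \<alpha> \<gamma> m P D q powr p \<le> 4 / N * (\<Sum>w\<in>Pow {1..D}. W' w)"
    unfolding W'_def N_def by (rule Suc.IH[OF Suc.prems(1) W_D]) auto
  have "merit \<alpha> \<gamma> m P d q powr p = (merit \<alpha> \<gamma> m P D q + \<Theta> q) powr p" by (simp add: \<Theta>_def)
  also have "\<dots> \<le> merit \<alpha> \<gamma> m P D q powr p + \<Theta> q powr p"
    using merit0 \<Theta>0 p by (intro powr_add_le_add_powr)
  also have "\<dots> \<le> 4 / N * (\<Sum>w\<in>Pow {1..D}. W' w) + 4 / N * (\<Sum>w\<in>Pow {1..d}. of_bool (d \<in> w) * W' w)"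
    using IH \<Theta>p by (rule add_mono)
  also have "\<dots> = 4 / N * (\<Sum>w\<in>Pow {1..d}. W' w)"
  proof -
    have "(\<Sum>w\<in>Pow {1..D}. W' w) = (\<Sum>w\<in>Pow {1..d}. of_bool (d \<notin> w) * W' w)"
      unfolding d_def by (rule sum.mono_neutral_cong_left) (auto simp: le_Suc_eq)
    hence "(\<Sum>w\<in>Pow {1..D}. W' w) + (\<Sum>w\<in>Pow {1..d}. of_bool (d \<in> w) * W' w) =
        (\<Sum>w\<in>Pow {1..d}. of_bool (d \<notin> w) * W' w + of_bool (d \<in> w) * W' w)" by (simp add: sum.distrib)
    also have "\<dots> = (\<Sum>w\<in>Pow {1..d}. W' w)" by (intro sum.cong refl) auto
    finally have eq: "(\<Sum>w\<in>Pow {1..D}. W' w) + (\<Sum>w\<in>Pow {1..d}. of_bool (d \<in> w) * W' w) = (\<Sum>w\<in>Pow {1..d}. W' w)" .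
    show ?thesis unfolding distrib_left [symmetric] eq ..
  qed
  finally show ?case by (simp add: W'_def N_def d_def)
qed

section \<open>Summability of the weights\<close>

lemma one_plus_geometric_le:
  fixes K y :: real
  assumes "K \<ge> 1" "y \<ge> 0"
  shows "1 + K * (\<Sum>i\<in>{1..n}. y ^ i) \<le> (1 + K * y) ^ n"
proof (induction n)
  case (Suc n)
  have sum0: "(\<Sum>i\<in>{1..n}. y ^ i) \<ge> 0" using assms by (intro sum_nonneg) auto
  have step: "y ^ Suc n \<le> y * (1 + K * (\<Sum>i\<in>{1..n}. y ^ i))"
  proof -
    have "y ^ n \<le> 1 + K * (\<Sum>i\<in>{1..n}. y ^ i)"
    proof (cases "n = 0")
      case False
      hence "y ^ n \<le> (\<Sum>i\<in>{1..n}. y ^ i)" using assms by (intro member_le_sum) auto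
      also have "\<dots> \<le> K * (\<Sum>i\<in>{1..n}. y ^ i)" using assms sum0 by (simp add: mult_le_cancel_right1)
      finally show ?thesis by simp
    qed simp
    thus ?thesis using assms by (simp add: mult_left_mono)
  qed
  have "1 + K * (\<Sum>i\<in>{1..Suc n}. y ^ i) = (1 + K * (\<Sum>i\<in>{1..n}. y ^ i)) + K * y ^ Suc n"
    by (simp add: distrib_left)
  also have "\<dots> \<le> (1 + K * (\<Sum>i\<in>{1..n}. y ^ i)) + K * (y * (1 + K * (\<Sum>i\<in>{1..n}. y ^ i)))"
    using step assms by (intro add_left_mono mult_left_mono) auto
  also have "\<dots> = (1 + K * y) * (1 + K * (\<Sum>i\<in>{1..n}. y ^ i))" by (simp add: algebra_simps)
  also have "\<dots> \<le> (1 + K * y) * (1 + K * y) ^ n" using Suc assms by (intro mult_left_mono) auto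
  finally show ?case by simp
qed simp

text \<open>
  A factor \<open>1 + K * y\<close> is at most \<open>exp (K * y)\<close>, and also at most \<open>exp (\<delta> * K * y) / \<delta>\<close> for \<open>0 < \<delta> \<le> 1\<close>. The
  second estimate is used for the first \<open>J\<close> factors, where \<open>\<delta>\<close> makes the exponent small, and the first one for
  the others, where the tail of the convergent series does.
\<close>

lemma generating_product_growth:
  fixes b :: "nat \<Rightarrow> real" and K \<epsilon> :: real
  assumes b: "\<And>j. j \<ge> 1 \<Longrightarrow> b j \<ge> 0" and sum: "summable (\<lambda>j. b (Suc j))" and K: "K \<ge> 1" and \<epsilon>: "\<epsilon> > 0"
  shows "\<exists>C\<ge>0. \<forall>s R. R \<ge> 0 \<longrightarrow> (\<Prod>j\<in>{1..s}. 1 + K * (\<Sum>i\<in>{1..\<alpha>}. (b j * R) ^ i)) \<le> C * exp (\<epsilon> * R)"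
proof -
  define S where "S = (\<Sum>j. b (Suc j))"
  define c where "c = real \<alpha> * K + 1"
  have c: "c > 0" "real \<alpha> * K \<le> c" using K by (auto simp: c_def intro!: add_nonneg_pos)
  have S0: "S \<ge> 0" unfolding S_def using b by (intro suminf_nonneg sum) auto
  define \<tau> where "\<tau> = \<epsilon> / (2 * c)"
  have \<tau>: "\<tau> > 0" using \<epsilon> c by (simp add: \<tau>_def)
  define \<delta> where "\<delta> = min 1 (\<epsilon> / (2 * c * (S + 1)))"
  have \<delta>: "0 < \<delta>" "\<delta> \<le> 1" using \<epsilon> c S0 by (auto simp: \<delta>_def)
  have \<delta>S: "\<delta> * S \<le> \<epsilon> / (2 * c)"
  proof -
    have "\<delta> * S \<le> \<epsilon> / (2 * c * (S + 1)) * (S + 1)"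
      using \<delta> S0 \<epsilon> c by (intro mult_mono) (auto simp: \<delta>_def)
    also have "\<dots> = \<epsilon> / (2 * c)" using S0 c by (simp add: divide_simps)
    finally show ?thesis .
  qed
  obtain J where J: "\<And>n. n \<ge> J \<Longrightarrow> norm (\<Sum>i. b (Suc (i + n))) < \<tau>"
    using suminf_exist_split[OF \<tau> sum] by auto
  define D where "D = (1 / \<delta>) ^ \<alpha>"
  have D: "D \<ge> 1" using \<delta> by (auto simp: D_def intro!: one_le_power)
  define e where "e = (\<lambda>j. if j \<le> J then \<delta> else 1)"
  have factor: "1 + K * (\<Sum>i\<in>{1..\<alpha>}. y ^ i) \<le> (if j \<le> J then D else 1) * exp (c * (e j * y))" if "y \<ge> 0" for y j
  proof -
    have "1 + K * y \<le> (if j \<le> J then 1 / \<delta> else 1) * exp (K * (e j * y))"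
    proof (cases "j \<le> J")
      case True
      have "\<delta> * (1 + K * y) \<le> 1 + K * (\<delta> * y)" using \<delta> by (simp add: algebra_simps)
      also have "\<dots> \<le> exp (K * (\<delta> * y))" by (rule exp_ge_add_one_self)
      finally show ?thesis using True \<delta> by (simp add: e_def field_simps)
    next
      case False
      thus ?thesis using exp_ge_add_one_self[of "K * y"] by (simp add: e_def)
    qed
    hence "(1 + K * y) ^ \<alpha> \<le> ((if j \<le> J then 1 / \<delta> else 1) * exp (K * (e j * y))) ^ \<alpha>"
      using K that by (intro power_mono) auto
    also have "\<dots> = (if j \<le> J then D else 1) * exp (real \<alpha> * K * (e j * y))"
      by (simp add: power_mult_distrib D_def exp_of_nat_mult [symmetric] mult.assoc)
    also have "\<dots> \<le> (if j \<le> J then D else 1) * exp (c * (e j * y))"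
    proof (rule mult_left_mono)
      have "real \<alpha> * K * (e j * y) \<le> c * (e j * y)"
        using that \<delta> by (intro mult_right_mono c(2)) (auto simp: e_def)
      thus "exp (real \<alpha> * K * (e j * y)) \<le> exp (c * (e j * y))" by simp
    qed (use D in auto)
    finally show ?thesis using one_plus_geometric_le[OF K that, of \<alpha>] by linarith
  qed
  have sum_e: "(\<Sum>j\<in>{1..s}. e j * b j) \<le> \<epsilon> / c" for s
  proof -
    have "(\<Sum>j\<in>{1..s}. e j * b j) \<le> (\<Sum>j\<in>{1..s}. \<delta> * b j + of_bool (J < j) * b j)"
      using b \<delta> by (intro sum_mono) (auto simp: e_def)
    also have "\<dots> = \<delta> * (\<Sum>j\<in>{1..s}. b j) + (\<Sum>j\<in>{1..s}. of_bool (J < j) * b j)"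
      by (simp add: sum.distrib sum_distrib_left)
    also have "(\<Sum>j\<in>{1..s}. b j) = (\<Sum>j<s. b (Suc j))"
      by (rule sum.reindex_bij_witness[where i = Suc and j = "\<lambda>j. j - 1"]) auto
    also have "\<dots> \<le> S" unfolding S_def using b by (intro sum_le_suminf sum) auto
    also have "(\<Sum>j\<in>{1..s}. of_bool (J < j) * b j) = (\<Sum>j\<in>{J<..s}. b j)"
      by (rule sum.mono_neutral_cong_right) auto
    also have "\<dots> = (\<Sum>i<s - J. b (Suc (i + J)))"
      by (rule sum.reindex_bij_witness[where i = "\<lambda>i. Suc (i + J)" and j = "\<lambda>j. j - Suc J"]) auto
    also have "\<dots> \<le> (\<Sum>i. b (Suc (i + J)))"
      using b sum summable_iff_shift[of "\<lambda>j. b (Suc j)" J] by (intro sum_le_suminf) auto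
    also have "\<dots> \<le> \<tau>" using J[of J] by simp
    finally have "(\<Sum>j\<in>{1..s}. e j * b j) \<le> \<delta> * S + \<tau>" using \<delta> by (simp add: mult_left_mono)
    also have "\<dots> \<le> \<epsilon> / (2 * c) + \<epsilon> / (2 * c)" using \<delta>S by (simp add: \<tau>_def)
    also have "\<dots> = \<epsilon> / c" using c by (simp add: field_simps)
    finally show ?thesis .
  qed
  show ?thesis
  proof (intro exI[of _ "D ^ J"] conjI allI impI)
    show "D ^ J \<ge> 0" using D by simp
    fix s and R :: real assume R: "R \<ge> 0"
    have "(\<Prod>j\<in>{1..s}. 1 + K * (\<Sum>i\<in>{1..\<alpha>}. (b j * R) ^ i)) \<le>
        (\<Prod>j\<in>{1..s}. (if j \<le> J then D else 1) * exp (c * (e j * (b j * R))))"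
      using b R K by (intro prod_mono conjI factor) (auto intro!: add_nonneg_nonneg mult_nonneg_nonneg sum_nonneg)
    also have "\<dots> = (\<Prod>j\<in>{1..s}. if j \<le> J then D else 1) * exp (c * R * (\<Sum>j\<in>{1..s}. e j * b j))"
      by (simp add: prod.distrib exp_sum [symmetric] sum_distrib_left mult_ac)
    also have "(\<Prod>j\<in>{1..s}. if j \<le> J then D else 1) = (\<Prod>j\<in>{j \<in> {1..s}. j \<le> J}. D)"
      by (rule prod.inter_filter [symmetric]) simp
    also have "\<dots> * exp (c * R * (\<Sum>j\<in>{1..s}. e j * b j)) \<le> D ^ J * exp (\<epsilon> * R)"
    proof (rule mult_mono)
      have "card {j \<in> {1..s}. j \<le> J} \<le> card {1..J}" by (intro card_mono) auto
      thus "(\<Prod>j\<in>{j \<in> {1..s}. j \<le> J}. D) \<le> D ^ J" using D by (simp add: power_increasing)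
      have "c * R * (\<Sum>j\<in>{1..s}. e j * b j) \<le> c * R * (\<epsilon> / c)" using sum_e c R by (intro mult_left_mono) auto
      also have "c * R * (\<epsilon> / c) = \<epsilon> * R" using c by simp
      finally show "exp (c * R * (\<Sum>j\<in>{1..s}. e j * b j)) \<le> exp (\<epsilon> * R)" by simp
    qed (use D in auto)
    finally show "(\<Prod>j\<in>{1..s}. 1 + K * (\<Sum>i\<in>{1..\<alpha>}. (b j * R) ^ i)) \<le> D ^ J * exp (\<epsilon> * R)" .
  qed
qed

lemma finite_multi_indices: "finite v \<Longrightarrow> finite (multi_indices \<alpha> v)"
  unfolding multi_indices_def by (intro finite_PiE) auto

lemma sum_index_weights:
  fixes b :: "nat \<Rightarrow> real"
  shows "(\<Sum>v\<in>Pow {1..s}. \<Sum>\<nu>\<in>multi_indices \<alpha> v. K ^ card v * (\<Prod>j\<in>v. b j ^ \<nu> j) * R ^ (\<Sum>j\<in>v. \<nu> j)) =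
    (\<Prod>j\<in>{1..s}. 1 + K * (\<Sum>i\<in>{1..\<alpha>}. (b j * R) ^ i))"
proof -
  have "(\<Sum>\<nu>\<in>multi_indices \<alpha> v. K ^ card v * (\<Prod>j\<in>v. b j ^ \<nu> j) * R ^ (\<Sum>j\<in>v. \<nu> j)) =
      (\<Prod>j\<in>v. K * (\<Sum>i\<in>{1..\<alpha>}. (b j * R) ^ i))" if "v \<in> Pow {1..s}" for v
  proof -
    have fin: "finite v" using that finite_subset by auto
    have "(\<Sum>\<nu>\<in>multi_indices \<alpha> v. K ^ card v * (\<Prod>j\<in>v. b j ^ \<nu> j) * R ^ (\<Sum>j\<in>v. \<nu> j)) =
        K ^ card v * (\<Sum>\<nu>\<in>multi_indices \<alpha> v. \<Prod>j\<in>v. (b j * R) ^ \<nu> j)"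
      unfolding sum_distrib_left power_sum power_mult_distrib prod.distrib by (simp only: mult.assoc)
    also have "(\<Sum>\<nu>\<in>multi_indices \<alpha> v. \<Prod>j\<in>v. (b j * R) ^ \<nu> j) = (\<Prod>j\<in>v. \<Sum>i\<in>{1..\<alpha>}. (b j * R) ^ i)"
      unfolding multi_indices_def using fin by (intro prod_sum_PiE [symmetric]) auto
    finally show ?thesis by (simp add: prod.distrib)
  qed
  hence "(\<Sum>v\<in>Pow {1..s}. \<Sum>\<nu>\<in>multi_indices \<alpha> v. K ^ card v * (\<Prod>j\<in>v. b j ^ \<nu> j) * R ^ (\<Sum>j\<in>v. \<nu> j)) =
      (\<Sum>v\<in>Pow {1..s}. (\<Prod>j\<in>v. K * (\<Sum>i\<in>{1..\<alpha>}. (b j * R) ^ i)) * (\<Prod>j\<in>{1..s} - v. 1))"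
    by (intro sum.cong refl) simp
  also have "\<dots> = (\<Prod>j\<in>{1..s}. K * (\<Sum>i\<in>{1..\<alpha>}. (b j * R) ^ i) + 1)"
    by (rule prod_add [symmetric]) simp
  finally show ?thesis by (simp add: add.commute)
qed

text \<open>
  The terms are grouped by the total order \<open>n\<close> of the multi-index. The sum of the coefficients of order \<open>n\<close> is at
  most \<open>G R / R ^ n\<close>, where \<open>G\<close> is the generating product and \<open>R\<close> is arbitrary. With \<open>R = 2 * n\<close> and
  \<open>n! \<le> n ^ n\<close> the group is at most \<open>C * (exp (2 * \<epsilon>) / 2) ^ n\<close>, and \<open>\<epsilon>\<close> is chosen so that the ratio is \<open>3 / 4\<close>.
\<close>

lemma fact_sum_bounded:
  fixes b :: "nat \<Rightarrow> real" and K :: real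
  assumes b: "\<And>j. j \<ge> 1 \<Longrightarrow> b j \<ge> 0" and sum: "summable (\<lambda>j. b (Suc j))" and K: "K \<ge> 1"
  shows "\<exists>A\<ge>0. \<forall>s. (\<Sum>v\<in>Pow {1..s}. spod_weight \<alpha> b v * K ^ card v) \<le> A"
proof -
  define \<epsilon> where "\<epsilon> = (ln (3 / 2) / 2 :: real)"
  have \<epsilon>: "\<epsilon> > 0" by (simp add: \<epsilon>_def)
  obtain C where C: "C \<ge> 0" "\<And>s R. R \<ge> 0 \<Longrightarrow> (\<Prod>j\<in>{1..s}. 1 + K * (\<Sum>i\<in>{1..\<alpha>}. (b j * R) ^ i)) \<le> C * exp (\<epsilon> * R)"
    using generating_product_growth[OF b sum K \<epsilon>, of \<alpha>] by blast
  show ?thesis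
  proof (intro exI[of _ "4 * C"] conjI allI)
    show "4 * C \<ge> 0" using C by simp
    fix s :: nat
    define \<Omega> where "\<Omega> = Sigma (Pow {1..s}) (multi_indices \<alpha>)"
    define deg where "deg = (\<lambda>(v :: nat set, \<nu> :: nat \<Rightarrow> nat). \<Sum>j\<in>v. \<nu> j)"
    define W where "W = (\<lambda>(v :: nat set, \<nu> :: nat \<Rightarrow> nat). K ^ card v * (\<Prod>j\<in>v. b j ^ \<nu> j))"
    have fin: "finite \<Omega>" unfolding \<Omega>_def using finite_subset by (intro finite_SigmaI finite_multi_indices) auto
    have W0: "W x \<ge> 0" if "x \<in> \<Omega>" for x
      using that b K unfolding W_def \<Omega>_def by (auto intro!: mult_nonneg_nonneg prod_nonneg zero_le_power)
    have G: "(\<Sum>x\<in>\<Omega>. W x * R ^ deg x) \<le> C * exp (\<epsilon> * R)" if "R \<ge> 0" for R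
    proof -
      have "(\<Sum>x\<in>\<Omega>. W x * R ^ deg x) = (\<Prod>j\<in>{1..s}. 1 + K * (\<Sum>i\<in>{1..\<alpha>}. (b j * R) ^ i))"
        unfolding sum_index_weights [symmetric] \<Omega>_def using finite_subset
        by (subst sum.Sigma) (auto simp: W_def deg_def case_prod_unfold intro!: finite_multi_indices)
      thus ?thesis using C(2)[OF that, of s] by simp
    qed
    have shell: "(\<Sum>x\<in>{x \<in> \<Omega>. deg x = n}. fact (deg x) * W x) \<le> C * (3 / 4) ^ n" for n
    proof -
      define R where "R = 2 * real n"
      have "(\<Sum>x\<in>{x \<in> \<Omega>. deg x = n}. fact (deg x) * W x) \<le> (\<Sum>x\<in>{x \<in> \<Omega>. deg x = n}. (1 / 2) ^ n * (W x * R ^ deg x))"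
      proof (intro sum_mono)
        fix x assume x: "x \<in> {x \<in> \<Omega>. deg x = n}"
        have "(fact n :: real) \<le> real (n ^ n)" by (rule fact_le_power)
        also have "\<dots> = (1 / 2 * R) ^ n" by (simp add: R_def)
        also have "\<dots> = (1 / 2) ^ n * R ^ n" by (rule power_mult_distrib)
        finally have "fact n * W x \<le> (1 / 2) ^ n * R ^ n * W x" using W0 x by (intro mult_right_mono) auto
        thus "fact (deg x) * W x \<le> (1 / 2) ^ n * (W x * R ^ deg x)" using x by (simp add: mult_ac)
      qed
      also have "\<dots> = (1 / 2) ^ n * (\<Sum>x\<in>{x \<in> \<Omega>. deg x = n}. W x * R ^ deg x)" by (simp add: sum_distrib_left)
      also have "\<dots> \<le> (1 / 2) ^ n * (\<Sum>x\<in>\<Omega>. W x * R ^ deg x)"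
        using fin W0 by (intro mult_left_mono sum_mono2) (auto simp: R_def)
      also have "\<dots> \<le> (1 / 2) ^ n * (C * exp (\<epsilon> * R))"
        by (intro mult_left_mono G) (auto simp: R_def)
      also have "exp (\<epsilon> * R) = (3 / 2) ^ n"
        by (simp add: \<epsilon>_def R_def exp_of_nat_mult mult.commute)
      also have "(1 / 2) ^ n * (C * (3 / 2) ^ n) = C * (3 / 4) ^ n"
      proof -
        have "(1 / 2 :: real) ^ n * (3 / 2) ^ n = (3 / 4) ^ n"
          unfolding power_mult_distrib [symmetric] by simp
        thus ?thesis by (simp only: mult.left_commute[of _ C])
      qed
      finally show ?thesis .
    qed
    have "(\<Sum>v\<in>Pow {1..s}. spod_weight \<alpha> b v * K ^ card v) = (\<Sum>x\<in>\<Omega>. fact (deg x) * W x)"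
      unfolding \<Omega>_def spod_weight_def gamma_coeff_def sum_distrib_right using finite_subset
      by (subst sum.Sigma) (auto simp: W_def deg_def case_prod_unfold mult_ac intro!: finite_multi_indices sum.cong)
    also have "\<dots> = (\<Sum>n\<in>deg ` \<Omega>. \<Sum>x\<in>{x \<in> \<Omega>. deg x = n}. fact (deg x) * W x)"
      using fin by (rule sum.image_gen)
    also have "\<dots> \<le> (\<Sum>n\<in>deg ` \<Omega>. C * (3 / 4) ^ n)" by (intro sum_mono shell)
    also have "\<dots> \<le> (\<Sum>n. C * (3 / 4) ^ n)"
      using fin C by (intro sum_le_suminf summable_mult summable_geometric) auto
    also have "\<dots> = 4 * C" by (subst suminf_mult) (auto simp: suminf_geometric summable_geometric)
    finally show "(\<Sum>v\<in>Pow {1..s}. spod_weight \<alpha> b v * K ^ card v) \<le> 4 * C" .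
  qed
qed

lemma spod_weight_nonneg:
  assumes "\<forall>j\<ge>1. \<beta> j > 0" "v \<subseteq> {1..s}"
  shows "spod_weight \<alpha> \<beta> v \<ge> 0"
  unfolding spod_weight_def using gamma_coeff_pos[OF assms] by (intro sum_nonneg) (auto intro: less_imp_le)

text \<open>
  The power \<open>p \<le> 1\<close> may be taken term by term, and it does not increase a factorial. The result is again a
  weight of the same form, for the summable sequence \<open>\<beta> j powr p\<close>.
\<close>

lemma spod_weight_powr_le:
  assumes \<beta>: "\<forall>j\<ge>1. \<beta> j > 0" and v: "v \<subseteq> {1..s}" and p: "0 < p" "p \<le> 1"
  shows "spod_weight \<alpha> \<beta> v powr p \<le> spod_weight \<alpha> (\<lambda>j. \<beta> j powr p) v"
proof -
  have pos: "\<beta> j > 0" if "j \<in> v" for j using v \<beta> that by auto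
  have "spod_weight \<alpha> \<beta> v powr p \<le> (\<Sum>\<nu>\<in>multi_indices \<alpha> v. gamma_coeff \<beta> v \<nu> powr p)"
    unfolding spod_weight_def using gamma_coeff_pos[OF \<beta> v] p
    by (intro sum_powr_le_powr_sum) (auto intro: less_imp_le)
  also have "\<dots> \<le> (\<Sum>\<nu>\<in>multi_indices \<alpha> v. gamma_coeff (\<lambda>j. \<beta> j powr p) v \<nu>)"
  proof (rule sum_mono)
    fix \<nu>
    have "(\<Prod>j\<in>v. \<beta> j ^ \<nu> j) powr p = (\<Prod>j\<in>v. (\<beta> j powr p) ^ \<nu> j)"
    proof -
      have "(\<beta> j ^ \<nu> j) powr p = (\<beta> j powr p) ^ \<nu> j" if "j \<in> v" for j
        using pos[OF that] by (simp add: powr_realpow [symmetric] powr_powr mult.commute)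
      thus ?thesis using pos by (subst prod_powr_distrib) (auto intro: less_imp_le)
    qed
    moreover have "(fact (\<Sum>j\<in>v. \<nu> j) :: real) powr p \<le> fact (\<Sum>j\<in>v. \<nu> j) powr 1"
      using p by (intro powr_mono) (auto simp: fact_ge_1)
    moreover have "(\<Prod>j\<in>v. (\<beta> j powr p) ^ \<nu> j) \<ge> 0" by (intro prod_nonneg) auto
    moreover have "(\<Prod>j\<in>v. \<beta> j ^ \<nu> j) \<ge> 0" using pos by (intro prod_nonneg) (auto intro: less_imp_le)
    ultimately show "gamma_coeff \<beta> v \<nu> powr p \<le> gamma_coeff (\<lambda>j. \<beta> j powr p) v \<nu>"
      unfolding gamma_coeff_def by (subst powr_mult) (auto intro!: mult_right_mono)
  qed
  finally show ?thesis by (simp add: spod_weight_def)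
qed

lemma block_set_subset:
  assumes "\<alpha> > 0" "w \<subseteq> {1..\<alpha> * s}"
  shows "block_set \<alpha> w \<subseteq> {1..s}"
    "w \<subseteq> (\<lambda>(j, i). \<alpha> * (j - 1) + i) ` (block_set \<alpha> w \<times> {1..\<alpha>})"
proof -
  have *: "\<exists>j i. J = \<alpha> * (j - 1) + i \<and> j \<in> {1..s} \<and> i \<in> {1..\<alpha>} \<and> nat \<lceil>real J / real \<alpha>\<rceil> = j" if "J \<in> w" for J
  proof -
    have "J \<in> (\<lambda>(j, i). \<alpha> * (j - 1) + i) ` ({1..s} \<times> {1..\<alpha>})"
      using that assms(2) bij_betw_imp_surj_on[OF component_bij[OF assms(1), of s]] by blast
    then obtain j i where ji: "J = \<alpha> * (j - 1) + i" "j \<in> {1..s}" "i \<in> {1..\<alpha>}" by auto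
    have "nat \<lceil>real J / real \<alpha>\<rceil> = j" unfolding ji(1) using ji(2,3) by (intro block_of_component) auto
    thus ?thesis using ji by blast
  qed
  show "block_set \<alpha> w \<subseteq> {1..s}" unfolding block_set_def using * by blast
  show "w \<subseteq> (\<lambda>(j, i). \<alpha> * (j - 1) + i) ` (block_set \<alpha> w \<times> {1..\<alpha>})"
  proof
    fix J assume J: "J \<in> w"
    then obtain j i where ji: "J = \<alpha> * (j - 1) + i" "i \<in> {1..\<alpha>}" "nat \<lceil>real J / real \<alpha>\<rceil> = j" using * by blast
    have "j \<in> block_set \<alpha> w" unfolding block_set_def using J ji(3) by blast
    thus "J \<in> (\<lambda>(j, i). \<alpha> * (j - 1) + i) ` (block_set \<alpha> w \<times> {1..\<alpha>})" using ji by force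
  qed
qed

lemma interlaced_weight_nonneg:
  assumes "prime b" "\<alpha> \<ge> 2" "\<forall>j\<ge>1. \<beta> j > 0" "w \<subseteq> {1..\<alpha> * s}"
  shows "interlaced_weight b \<alpha> (spod_weight \<alpha> \<beta>) w \<ge> 0"
  unfolding interlaced_weight_def
  using assms block_set_subset(1)[of \<alpha> w s]
  by (intro mult_nonneg_nonneg zero_le_power C_const_nonneg spod_weight_nonneg[of \<beta> _ s]) auto

text \<open>
  The weight of \<open>w\<close> depends only on the set \<open>v\<close> of blocks that \<open>w\<close> meets, and \<open>w\<close> is one of the subsets of
  the union of these blocks, which has \<open>\<alpha> * card v\<close> elements. So the sum over \<open>w\<close> costs a constant per element of \<open>v\<close>.
\<close>

lemma interlaced_weights_powr_sum_bounded:
  assumes b: "prime b" and \<alpha>: "\<alpha> \<ge> 2" and \<beta>: "\<forall>j\<ge>1. \<beta> j > 0" and p: "0 < p" "p \<le> 1"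
    and sum: "summable (\<lambda>j. \<beta> (Suc j) powr p)" and Z: "Z \<ge> 0"
  shows "\<exists>A\<ge>0. \<forall>s. (\<Sum>w\<in>Pow {1..\<alpha> * s}. interlaced_weight b \<alpha> (spod_weight \<alpha> \<beta>) w powr p * Z ^ card w) \<le> A"
proof -
  define c where "c = C_const \<alpha> b * real b ^ (\<alpha> * (\<alpha> - 1) div 2)"
  have c0: "c \<ge> 0" unfolding c_def using C_const_nonneg[OF b \<alpha>] by simp
  have \<alpha>0: "\<alpha> > 0" using \<alpha> by simp
  define K where "K = max 1 (c powr p * (1 + Z) ^ \<alpha>)"
  have K: "K \<ge> 1" by (simp add: K_def)
  obtain A where A: "A \<ge> 0" "\<And>s. (\<Sum>v\<in>Pow {1..s}. spod_weight \<alpha> (\<lambda>j. \<beta> j powr p) v * K ^ card v) \<le> A"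
    using fact_sum_bounded[of "\<lambda>j. \<beta> j powr p" K \<alpha>] sum K by auto
  show ?thesis
  proof (intro exI[of _ A] conjI allI A(1))
    fix s :: nat
    define u where "u = block_set \<alpha>"
    have inner: "(\<Sum>w\<in>{w \<in> Pow {1..\<alpha> * s}. u w = v}. Z ^ card w) \<le> ((1 + Z) ^ \<alpha>) ^ card v" if v: "v \<in> Pow {1..s}" for v
    proof -
      define B where "B = (\<lambda>(j, i). \<alpha> * (j - 1) + i) ` (v \<times> {1..\<alpha>})"
      have finv: "finite v" using v finite_subset by auto
      have finB: "finite B" using finv by (simp add: B_def)
      have "card B \<le> \<alpha> * card v"
        unfolding B_def using finv by (intro order_trans[OF card_image_le]) (auto simp: card_cartesian_product)
      have "(\<Sum>w\<in>{w \<in> Pow {1..\<alpha> * s}. u w = v}. Z ^ card w) \<le> (\<Sum>w\<in>Pow B. Z ^ card w)"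
        using block_set_subset(2)[OF \<alpha>0] finB Z by (intro sum_mono2) (auto simp: u_def B_def)
      also have "\<dots> = (\<Sum>w\<in>Pow B. (\<Prod>j\<in>w. Z) * (\<Prod>j\<in>B - w. 1))" by simp
      also have "\<dots> = (\<Prod>j\<in>B. Z + 1)" by (rule prod_add [OF finB, symmetric])
      also have "\<dots> = (1 + Z) ^ card B" by (simp add: add.commute)
      also have "\<dots> \<le> (1 + Z) ^ (\<alpha> * card v)" using \<open>card B \<le> _\<close> Z by (intro power_increasing) auto
      finally show ?thesis by (simp add: power_mult)
    qed
    have "(\<Sum>w\<in>Pow {1..\<alpha> * s}. interlaced_weight b \<alpha> (spod_weight \<alpha> \<beta>) w powr p * Z ^ card w) =
        (\<Sum>v\<in>Pow {1..s}. \<Sum>w\<in>{w \<in> Pow {1..\<alpha> * s}. u w = v}. interlaced_weight b \<alpha> (spod_weight \<alpha> \<beta>) w powr p * Z ^ card w)"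
    proof (rule sum.group [symmetric])
      show "u ` Pow {1..\<alpha> * s} \<subseteq> Pow {1..s}" using block_set_subset(1)[OF \<alpha>0] by (auto simp: u_def)
    qed auto
    also have "\<dots> = (\<Sum>v\<in>Pow {1..s}. (spod_weight \<alpha> \<beta> v * c ^ card v) powr p * (\<Sum>w\<in>{w \<in> Pow {1..\<alpha> * s}. u w = v}. Z ^ card w))"
      unfolding sum_distrib_left by (intro sum.cong refl) (auto simp: interlaced_weight_def u_def c_def)
    also have "\<dots> \<le> (\<Sum>v\<in>Pow {1..s}. spod_weight \<alpha> (\<lambda>j. \<beta> j powr p) v * K ^ card v)"
    proof (rule sum_mono)
      fix v assume v: "v \<in> Pow {1..s}"
      have \<beta>': "\<forall>j\<ge>1. \<beta> j powr p > 0"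
      proof (intro allI impI)
        fix j :: nat assume "j \<ge> 1"
        hence "\<beta> j > 0" using \<beta> by blast
        thus "\<beta> j powr p > 0" by simp
      qed
      have sp0: "spod_weight \<alpha> (\<lambda>j. \<beta> j powr p) v \<ge> 0"
        using v by (intro spod_weight_nonneg[OF \<beta>', of v s]) auto
      have "(c ^ card v) powr p = (c powr p) ^ card v"
        using prod_powr_distrib[of "\<lambda>_. c" v p] c0 by simp
      hence e1: "(spod_weight \<alpha> \<beta> v * c ^ card v) powr p = spod_weight \<alpha> \<beta> v powr p * (c powr p) ^ card v"
        using c0 spod_weight_nonneg[OF \<beta>, of v s] v by (simp add: powr_mult)
      have e2: "spod_weight \<alpha> \<beta> v powr p * (c powr p) ^ card v * (\<Sum>w\<in>{w \<in> Pow {1..\<alpha> * s}. u w = v}. Z ^ card w) \<le>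
          spod_weight \<alpha> (\<lambda>j. \<beta> j powr p) v * (c powr p) ^ card v * ((1 + Z) ^ \<alpha>) ^ card v"
      proof (intro mult_mono mult_right_mono inner[OF v] mult_nonneg_nonneg sp0)
        show "spod_weight \<alpha> \<beta> v powr p \<le> spod_weight \<alpha> (\<lambda>j. \<beta> j powr p) v"
          using v by (intro spod_weight_powr_le[OF \<beta> _ p, of v s]) auto
      qed (use Z in \<open>auto intro!: sum_nonneg\<close>)
      have e3: "spod_weight \<alpha> (\<lambda>j. \<beta> j powr p) v * (c powr p) ^ card v * ((1 + Z) ^ \<alpha>) ^ card v \<le>
          spod_weight \<alpha> (\<lambda>j. \<beta> j powr p) v * K ^ card v"
      proof -
        have "(c powr p * (1 + Z) ^ \<alpha>) ^ card v \<le> K ^ card v"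
          using Z by (intro power_mono) (auto simp: K_def)
        thus ?thesis using sp0 by (simp only: mult.assoc power_mult_distrib [symmetric] mult_left_mono)
      qed
      show "(spod_weight \<alpha> \<beta> v * c ^ card v) powr p * (\<Sum>w\<in>{w \<in> Pow {1..\<alpha> * s}. u w = v}. Z ^ card w) \<le>
          spod_weight \<alpha> (\<lambda>j. \<beta> j powr p) v * K ^ card v"
        unfolding e1 by (rule order_trans[OF e2 e3])
    qed
    also have "\<dots> \<le> A" by (rule A(2))
    finally show "(\<Sum>w\<in>Pow {1..\<alpha> * s}. interlaced_weight b \<alpha> (spod_weight \<alpha> \<beta>) w powr p * Z ^ card w) \<le> A" .
  qed
qed

section \<open>The error bound\<close>

theorem theorem6:
  fixes \<beta> :: "nat \<Rightarrow> real" and p :: real and \<alpha> b :: nat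
  assumes "\<forall>j\<ge>1. \<beta> j > 0"
    and "0 < p" and "p \<le> 1"
    and "summable (\<lambda>j. \<beta> (Suc j) powr p)"
    and "\<alpha> = nat \<lfloor>1 / p\<rfloor> + 1"
    and "b = CARD('b::prime_card)"
  shows "\<exists>C::real. \<forall>s\<ge>1. \<forall>m\<ge>1. \<forall>(P :: 'b mod_ring poly) q.
    irreducible P \<and> Polynomial.degree P = m \<and> cbc_constructed \<alpha> (spod_weight \<alpha> \<beta>) s m P q \<longrightarrow>
    (\<forall>F. smooth_on_cube s F \<and> cube_norm s \<alpha> \<beta> F \<le> 1 \<longrightarrow>
      \<bar>(\<Sum>n<b ^ m. F (interlaced_point \<alpha> s m P q n)) / real (b ^ m) - cube_integral s F\<bar>
        \<le> C * real (b ^ m) powr (- 1 / p))"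
proof -
  note \<beta> = assms(1) and p = assms(2,3) and sum = assms(4) and \<alpha> = assms(5) and b = assms(6)
  have "1 / p \<ge> 1" using p by simp
  hence "\<lfloor>1 / p\<rfloor> \<ge> 1" by (simp add: le_floor_iff)
  then obtain k where "\<lfloor>1 / p\<rfloor> = int k" "k \<ge> 1" by (cases "\<lfloor>1 / p\<rfloor>") auto
  hence \<alpha>2: "\<alpha> \<ge> 2" and "real \<alpha> = real_of_int \<lfloor>1 / p\<rfloor> + 1" using \<alpha> by auto
  hence "1 / p < real \<alpha>" using floor_correct[of "1 / p"] by simp
  hence \<alpha>p: "real \<alpha> * p > 1" using p by (simp add: field_simps)
  define Z where "Z = 1 / (1 - real CARD('b) powr (1 - real \<alpha> * p))"
  have "Z > 0" using sum_level_powers_le(1)[OF \<alpha>p, where 'b='b] by (simp add: Z_def)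
  then obtain A where A: "A \<ge> 0"
    "\<And>s. (\<Sum>w\<in>Pow {1..\<alpha> * s}. interlaced_weight CARD('b) \<alpha> (spod_weight \<alpha> \<beta>) w powr p * Z ^ card w) \<le> A"
    using interlaced_weights_powr_sum_bounded[OF prime_card \<alpha>2 \<beta> p sum, of Z] by auto
  have "\<bar>(\<Sum>n<b ^ m. F (interlaced_point \<alpha> s m P q n)) / real (b ^ m) - cube_integral s F\<bar>
      \<le> (4 * A) powr (1 / p) * real (b ^ m) powr (- 1 / p)"
    if m: "m \<ge> 1" and P: "irreducible P" "Polynomial.degree P = m"
      and cbc: "cbc_constructed \<alpha> (spod_weight \<alpha> \<beta>) s m P q" and "s \<ge> 1"
      and F: "smooth_on_cube s F" "cube_norm s \<alpha> \<beta> F \<le> 1"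
    for s m F and P :: "'b mod_ring poly" and q
  proof -
    let ?E = "\<lambda>d q. merit \<alpha> (spod_weight \<alpha> \<beta>) m P d q"
    define N where "N = real (b ^ m)"
    have N: "N > 0" unfolding N_def b using card_prime_gt_1[where 'b='b] by simp
    have W: "interlaced_weight CARD('b) \<alpha> (spod_weight \<alpha> \<beta>) w \<ge> 0" if "w \<subseteq> {1..\<alpha> * s}" for w
      using that by (intro interlaced_weight_nonneg[OF prime_card \<alpha>2 \<beta>])
    have q1: "q 1 = 1" using cbc by (simp add: cbc_constructed_def)
    have opt: "?E d q \<le> ?E d (q(d := r))" if d: "d \<in> {1..\<alpha> * s}" and r: "r \<in> generators m" for d r
    proof (cases "d = 1")
      case False
      thus ?thesis using cbc d r unfolding cbc_constructed_def generators_def by auto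
    next
      case True
      \<comment> \<open>For the first component the prescribed generator \<open>1\<close> is a minimizer: if \<open>P\<close> divides a polynomial,
      then it divides all its multiples.\<close>
      have le: "merit_trunc \<alpha> (spod_weight \<alpha> \<beta>) L m P 1 q \<le> merit_trunc \<alpha> (spod_weight \<alpha> \<beta>) L m P 1 (q(1 := r))" for L
        unfolding merit_trunc_def
      proof (intro sum_mono mult_left_mono)
        fix \<kappa> :: "nat \<Rightarrow> nat \<Rightarrow> 'b mod_ring"
        show "of_bool (P dvd dual_poly 1 m \<kappa> q) \<le> (of_bool (P dvd dual_poly 1 m \<kappa> (q(1 := r))) :: real)"
          using q1 by (auto simp: dual_poly_def)
        have "{1..1} \<subseteq> {1..\<alpha> * s}" using d True by simp
        thus "0 \<le> interlaced_weight CARD('b) \<alpha> (spod_weight \<alpha> \<beta>) (support L 1 \<kappa>) * decay \<alpha> L 1 \<kappa>"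
          using support_subset[of L 1 \<kappa>] by (intro mult_nonneg_nonneg W decay_nonneg) blast
      qed
      show ?thesis unfolding True
        by (rule LIMSEQ_le[OF merit_trunc_tendsto[OF P(2) m \<alpha>2] merit_trunc_tendsto[OF P(2) m \<alpha>2]])
          (use le in blast)
    qed
    have "?E (\<alpha> * s) q powr p \<le>
        4 / real CARD('b) ^ m * (\<Sum>w\<in>Pow {1..\<alpha> * s}. interlaced_weight CARD('b) \<alpha> (spod_weight \<alpha> \<beta>) w powr p * Z ^ card w)"
      unfolding Z_def by (rule cbc_merit_bound[OF P m \<alpha>2 p \<alpha>p W opt])
    also have "\<dots> \<le> 4 / real CARD('b) ^ m * A" by (intro mult_left_mono A(2)) auto
    also have "\<dots> = 4 * A / N" by (simp add: N_def b)
    finally have Ep: "?E (\<alpha> * s) q powr p \<le> 4 * A / N" .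
    have err: "\<bar>(\<Sum>n<b ^ m. F (interlaced_point \<alpha> s m P q n)) / real (b ^ m) - cube_integral s F\<bar> \<le> ?E (\<alpha> * s) q"
      unfolding b by (rule quadrature_error_le_merit[OF P(2) m \<alpha>2 \<beta> F])
    hence E0: "?E (\<alpha> * s) q \<ge> 0" using abs_ge_zero order_trans by blast
    have "?E (\<alpha> * s) q = (?E (\<alpha> * s) q powr p) powr (1 / p)" using E0 p by (simp add: powr_powr)
    also have "\<dots> \<le> (4 * A / N) powr (1 / p)" using Ep p by (intro powr_mono2) auto
    also have "\<dots> = (4 * A) powr (1 / p) * N powr (- 1 / p)"
    proof -
      have "- 1 / p = - (1 / p)" by simp
      hence "N powr (- 1 / p) = 1 / N powr (1 / p)" by (simp only: powr_minus_divide)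
      thus ?thesis using powr_divide[of "4 * A" N "1 / p"] A(1) N by simp
    qed
    finally show ?thesis using err by (simp add: N_def)
  qed
  thus ?thesis by blast
qed

end
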